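(* Let $n$ be a positive integer and let $\mathrm{Cov}(\boldsymbol{S}_n)$ be the set of covering relations of the strong Bruhat order $\boldsymbol{S}_n$ on the symmetric group $S_n$. Let $f:\mathrm{Cov}(\boldsymbol{S}_n)\to\mathbb{Z}[z_A,z_B,z_C,z_D]$ be the weight function $$f(v\lessdot w):=1+a_{v\lessdot w}z_A+b_{v\lessdot w}z_B+c_{v\lessdot w}z_C+d_{v\lessdot w}z_D .$$ Let $\mathrm{wt}:\mathrm{Cov}(\boldsymbol{S}_n)\to\mathbb{Z}[z]$ be any weight function obtained from $f$ by specializing the variables $z_A,z_B,z_C,z_D$ to elements of $\mathbb{Z}[z]$ in such a way that $\{z_A,z_B,z_C,z_D\}=\{0,0,z,2-z\}$ as multisets. Then $$m_{\mathrm{wt}}(e,w_0)=\binom{n}{2}!.$$ In particular, $m_{\mathrm{wt}}(e,w_0)$ does not depend on $z$.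
   Context: Permutations $v\in S_n$ are written in one-line notation $v=v_1v_2\cdots v_n$ with $v_i=v(i)$; $e$ is the identity and $w_0=n\,(n-1)\cdots 2\,1$. $t_{ij}=(i\;j)$ is a transposition, so $vt_{ij}$ is obtained from $v$ by exchanging the entries in positions $i$ and $j$. $\ell(w)$ is the Coxeter length (minimal number of adjacent transpositions whose product is $w$). The strong Bruhat order $\boldsymbol{S}_n$ is the partial order on $S_n$ with covering relations $v\lessdot w$ whenever $w=vt_{ij}$ for some $i<j$ and $\ell(w)=\ell(v)+1$. For a covering relation $v\lessdot w=vt_{ij}$ with $i<j$, define $a_{v\lessdot w}=\#\{k<i : v_i<v_k<v_j\}$, $b_{v\lessdot w}=\#\{i<k<j : v_k>v_j\}$, $c_{v\lessdot w}=\#\{k>j : v_i<v_k<v_j\}$, $d_{v\lessdot w}=\#\{i<k<j : v_k<v_i\}$. Given a ring $R$ and a weight function $\mathrm{wt}:\mathrm{Cov}(\boldsymbol{S}_n)\to R$, the weight of a saturated chain $c=(u_1\lessdot u_2\lessdot\cdots\lessdot u_k)$ is $\mathrm{wt}(c)=\prod_{i=1}^{k-1}\mathrm{wt}(u_i\lessdot u_{i+1})$ (an empty product is $1$). For $v\le w$, $m_{\mathrm{wt}}(v,w)=\sum_{c}\mathrm{wt}(c)$, the sum over all saturated chains $c$ from $v$ to $w$. *)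

theory Defs
  imports
    "HOL-Combinatorics.Permutations"
    "HOL-Computational_Algebra.Polynomial"
    "HOL-Library.Multiset"
    "HOL-Library.Poly_Mapping"
begin

text \<open>
  \<open>S\<^sub>n\<close> is the set of functions permuting \<open>{1..n}\<close> (and fixing every other natural number); the
  one-line notation of \<open>v\<close> is \<open>v 1, \<dots>, v n\<close>.  The product is composition, so
  \<open>v \<circ> transpose i j\<close> exchanges the entries in the positions \<open>i\<close> and \<open>j\<close>.
\<close>

definition Sym :: "nat \<Rightarrow> (nat \<Rightarrow> nat) set" where
  "Sym n = {v. v permutes {1..n}}"

definition longest :: "nat \<Rightarrow> nat \<Rightarrow> nat" where
  "longest n = (\<lambda>i. if i \<in> {1..n} then n + 1 - i else i)"

definition coxeter_length :: "nat \<Rightarrow> (nat \<Rightarrow> nat) \<Rightarrow> nat" where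
  "coxeter_length n w =
    (LEAST k. \<exists>is. length is = k \<and> set is \<subseteq> {1..<n} \<and>
                   w = foldr (\<circ>) (map (\<lambda>i. transpose i (i + 1)) is) id)"

definition Cov :: "nat \<Rightarrow> ((nat \<Rightarrow> nat) \<times> (nat \<Rightarrow> nat)) set" where
  "Cov n = {(v, w). v \<in> Sym n \<and> w \<in> Sym n \<and>
     (\<exists>i j. 1 \<le> i \<and> i < j \<and> j \<le> n \<and> w = v \<circ> transpose i j) \<and>
     coxeter_length n w = coxeter_length n v + 1}"

text \<open>
  A saturated chain is the nonempty list of its elements.  Membership in \<^term>\<open>Sym n\<close> is only a
  restriction for one-element chains.
\<close>

definition saturated_chains ::
    "nat \<Rightarrow> (nat \<Rightarrow> nat) \<Rightarrow> (nat \<Rightarrow> nat) \<Rightarrow> (nat \<Rightarrow> nat) list set" where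
  "saturated_chains n v w =
    {us. us \<noteq> [] \<and> set us \<subseteq> Sym n \<and> hd us = v \<and> last us = w \<and>
         successively (\<lambda>x y. (x, y) \<in> Cov n) us}"

definition chain_weight ::
    "((nat \<Rightarrow> nat) \<times> (nat \<Rightarrow> nat) \<Rightarrow> 'r::ring_1) \<Rightarrow> (nat \<Rightarrow> nat) list \<Rightarrow> 'r" where
  "chain_weight wt us = (\<Prod>p\<leftarrow>zip us (tl us). wt p)"

definition weighted_chain_sum ::
    "nat \<Rightarrow> ((nat \<Rightarrow> nat) \<times> (nat \<Rightarrow> nat) \<Rightarrow> 'r::ring_1) \<Rightarrow> (nat \<Rightarrow> nat) \<Rightarrow> (nat \<Rightarrow> nat) \<Rightarrow> 'r" where
  "weighted_chain_sum n wt v w = (\<Sum>us\<in>saturated_chains n v w. chain_weight wt us)"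

definition a_stat :: "nat \<Rightarrow> (nat \<Rightarrow> nat) \<Rightarrow> nat \<Rightarrow> nat \<Rightarrow> nat" where
  "a_stat n v i j = card {k \<in> {1..n}. k < i \<and> v i < v k \<and> v k < v j}"

definition b_stat :: "nat \<Rightarrow> (nat \<Rightarrow> nat) \<Rightarrow> nat \<Rightarrow> nat \<Rightarrow> nat" where
  "b_stat n v i j = card {k \<in> {1..n}. i < k \<and> k < j \<and> v k > v j}"

definition c_stat :: "nat \<Rightarrow> (nat \<Rightarrow> nat) \<Rightarrow> nat \<Rightarrow> nat \<Rightarrow> nat" where
  "c_stat n v i j = card {k \<in> {1..n}. k > j \<and> v i < v k \<and> v k < v j}"

definition d_stat :: "nat \<Rightarrow> (nat \<Rightarrow> nat) \<Rightarrow> nat \<Rightarrow> nat \<Rightarrow> nat" where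
  "d_stat n v i j = card {k \<in> {1..n}. i < k \<and> k < j \<and> v k < v i}"

text \<open>
  \<open>\<int>[z\<^sub>A, z\<^sub>B, z\<^sub>C, z\<^sub>D]\<close> is the monoid algebra over \<open>\<int>\<close> of the free commutative monoid on the four
  variables: a polynomial maps exponent vectors to coefficients, with finite support.
\<close>

datatype zvar = ZA | ZB | ZC | ZD

type_synonym zpoly = "(zvar \<Rightarrow>\<^sub>0 nat) \<Rightarrow>\<^sub>0 int"

definition Var :: "zvar \<Rightarrow> zpoly" where
  "Var x = Poly_Mapping.single (Poly_Mapping.single x 1) 1"

definition specialize :: "(zvar \<Rightarrow> 'r::comm_ring_1) \<Rightarrow> zpoly \<Rightarrow> 'r" where
  "specialize \<sigma> p = (\<Sum>m\<in>Poly_Mapping.keys p. of_int (Poly_Mapping.lookup p m) *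
      (\<Prod>x\<in>Poly_Mapping.keys m. \<sigma> x ^ Poly_Mapping.lookup m x))"

text \<open>
  The positions \<open>i < j\<close> exchanged by a cover are determined by its two permutations.
\<close>

definition cover_positions :: "nat \<Rightarrow> (nat \<Rightarrow> nat) \<times> (nat \<Rightarrow> nat) \<Rightarrow> nat \<times> nat" where
  "cover_positions n = (\<lambda>(v, w).
     THE (i, j). 1 \<le> i \<and> i < j \<and> j \<le> n \<and> w = v \<circ> transpose i j)"

definition generic_weight :: "nat \<Rightarrow> (nat \<Rightarrow> nat) \<times> (nat \<Rightarrow> nat) \<Rightarrow> zpoly" where
  "generic_weight n = (\<lambda>(v, w). let (i, j) = cover_positions n (v, w) in
     1 + of_nat (a_stat n v i j) * Var ZA + of_nat (b_stat n v i j) * Var ZB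
       + of_nat (c_stat n v i j) * Var ZC + of_nat (d_stat n v i j) * Var ZD)"

lemma cover_positions_eq:
  assumes "v \<in> Sym n" "1 \<le> i" "i < j" "j \<le> n"
  shows "cover_positions n (v, v \<circ> transpose i j) = (i, j)"
proof -
  have inj: "inj v"
    using assms(1) by (simp add: Sym_def permutes_inj)
  have "(i', j') = (i, j)"
    if "i' < j'" and eq: "v \<circ> transpose i j = v \<circ> transpose i' j'" for i' j'
  proof -
    have "transpose i j k = transpose i' j' k" for k
      using fun_cong[OF eq, of k] inj by (simp add: inj_eq)
    from this[of i] this[of j] show ?thesis
      using \<open>i < j\<close> \<open>i' < j'\<close> by (auto simp: transpose_def split: if_splits)
  qed
  then show ?thesis
    unfolding cover_positions_def using assms(2-) by (auto intro!: the_equality)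
qed

lemma specialize_superset:
  assumes "finite K" "Poly_Mapping.keys p \<subseteq> K"
  shows "specialize \<sigma> p = (\<Sum>m\<in>K. of_int (Poly_Mapping.lookup p m) *
      (\<Prod>x\<in>Poly_Mapping.keys m. \<sigma> x ^ Poly_Mapping.lookup m x))"
  unfolding specialize_def using assms
  by (intro sum.mono_neutral_left) (auto simp: in_keys_iff)

lemma specialize_add: "specialize \<sigma> (p + q) = specialize \<sigma> p + specialize \<sigma> q"
proof -
  let ?K = "Poly_Mapping.keys p \<union> Poly_Mapping.keys q"
  have "finite ?K" by simp
  moreover have "Poly_Mapping.keys (p + q) \<subseteq> ?K" by (rule Poly_Mapping.keys_add)
  ultimately show ?thesis
    by (simp add: specialize_superset[of ?K] lookup_add algebra_simps sum.distrib)
qed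

lemma specialize_of_nat_Var: "specialize \<sigma> (of_nat k * Var x) = of_nat k * \<sigma> x"
proof (induction k)
  case 0
  show ?case by (simp add: specialize_def)
next
  case (Suc k)
  have "specialize \<sigma> (Var x) = \<sigma> x"
    by (simp add: specialize_def Var_def)
  with Suc show ?case by (simp add: algebra_simps specialize_add)
qed

lemma specialize_one: "specialize \<sigma> 1 = 1"
  by (simp add: specialize_def flip: single_one)

lemma specialize_generic_weight:
  assumes "v \<in> Sym n" "1 \<le> i" "i < j" "j \<le> n"
  shows "specialize \<sigma> (generic_weight n (v, v \<circ> transpose i j)) =
    1 + of_nat (a_stat n v i j) * \<sigma> ZA + of_nat (b_stat n v i j) * \<sigma> ZB
      + of_nat (c_stat n v i j) * \<sigma> ZC + of_nat (d_stat n v i j) * \<sigma> ZD"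
  using cover_positions_eq[OF assms]
  by (simp add: generic_weight_def specialize_add specialize_one specialize_of_nat_Var)

end

(*
  Let functions on S_n stand for expansions in the basis of Schubert classes of the coinvariant
  algebra.  Monk's rule turns multiplication by x_m into a signed sum over covers (var_op), the
  derivation sum x_m^2 d/dx_m becomes the sum over covers with weight d - b (deriv_op), and both
  satisfy a Leibniz rule with respect to the divided differences.  Hence the operator with cover
  weights 1 + (1+t) b + (1-t) d is multiplication by sum (n-m) x_m minus t times the derivation.
  Its (n choose 2)-th power, applied to 1, is an explicit combination of monomials; the top
  coefficient is an alternating function of the exponents, so it becomes a determinant of falling
  factorials with step t, which does not depend on t.

  For the weights 1 + x b + y c with x + y = 2, Macdonald's sum over reduced words,
  psi(w) = sum a_1 ... a_l, solves the recursion from above of the chain sums for the weight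
  1 + 2c (an sl_2 argument); since psi(w) = psi(w^-1), it solves the one for 1 + 2b as well, hence
  that of every mixture.  The remaining weights follow from w -> w^-1 and w -> w_0 w.
*)
theory Submission
  imports Defs "Jordan_Normal_Form.Determinant" "HOL-Combinatorics.Multiset_Permutations"
begin

section \<open>Covers and divided differences\<close>

text \<open>No Schubert polynomial and no quotient ring is built. The operators act on functions of
  injective maps, and a relation between them is proved by climbing the weak order: at a sorted
  \<open>w\<close> every cover operator vanishes, and a value at \<open>w \<circ> s\<close> with
  \<open>w\<close> ascending is a divided difference at \<open>w\<close>, so the Leibniz rules carry
  the relation one step up. The parameter \<open>t\<close> disappears because
  \<open>step_falling t j\<close> is monic of degree \<open>j\<close> in its last argument, whatever
  \<open>t\<close> is: changing the step multiplies the matrix by a unitriangular one. Pairing chain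
  sums with Macdonald's sum gives only the product of their two values at the longest permutation, a
  squared factorial. The missing normalisation comes from the weight 1 + 2b, which belongs to both
  families (t = 1 in the first one) and so fixes psi at the longest permutation. The condition that
  the two parameters add up to 2 enters as (1+t) + (1-t) in the first family. In the second it makes
  1 + x b + y c the mixture of 1 + 2b and 1 + 2c with coefficients x/2 and y/2.\<close>

definition position_pairs :: "nat \<Rightarrow> (nat \<times> nat) set" where
  "position_pairs n = {(i, j). 1 \<le> i \<and> i < j \<and> j \<le> n}"

lemma finite_position_pairs [simp]: "finite (position_pairs n)"
  by (rule finite_subset[of _ "{1..n} \<times> {1..n}"]) (auto simp: position_pairs_def)

definition inversion_set :: "nat \<Rightarrow> (nat \<Rightarrow> nat) \<Rightarrow> (nat \<times> nat) set" where
  "inversion_set n w = {(i, j) \<in> position_pairs n. w j < w i}"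

definition inversions :: "nat \<Rightarrow> (nat \<Rightarrow> nat) \<Rightarrow> nat" where
  "inversions n w = card (inversion_set n w)"

lemma finite_inversion_set [simp]: "finite (inversion_set n w)"
  by (rule finite_subset[of _ "position_pairs n"]) (auto simp: inversion_set_def)

text \<open>A cover read off the one-line notation of its upper permutation: no value in between
  occurs at a position in between. \<open>Cov_iff\<close> makes the link with Coxeter
  length.\<close>

definition down_cover :: "(nat \<Rightarrow> nat) \<Rightarrow> nat \<Rightarrow> nat \<Rightarrow> bool" where
  "down_cover w i j \<longleftrightarrow> i < j \<and> w j < w i \<and> (\<forall>k. i < k \<longrightarrow> k < j \<longrightarrow> w k < w j \<or> w i < w k)"

lemma inj_comp_transpose: "inj w \<Longrightarrow> inj (w \<circ> transpose i j)"
  by (simp add: inj_compose)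

text \<open>Only the pair \<open>(k, Suc k)\<close> is reversed by the adjacent transposition; once
  it is split off, a sum over pairs may be relabelled.\<close>

lemma swap_positions_bij:
  assumes "1 \<le> k" "Suc k \<le> n"
  shows "bij_betw (\<lambda>(i, j). (transpose k (Suc k) i, transpose k (Suc k) j))
    (position_pairs n - {(k, Suc k)}) (position_pairs n - {(k, Suc k)})"
  by (rule bij_betwI[where g="\<lambda>(i, j). (transpose k (Suc k) i, transpose k (Suc k) j)"])
    (use assms in \<open>auto simp: position_pairs_def transpose_def split: if_splits\<close>)

lemma inversions_sum: "inversions n w = (\<Sum>(i, j)\<in>position_pairs n. of_bool (w j < w i))"
proof -
  have "inversion_set n w = position_pairs n \<inter> {p. w (snd p) < w (fst p)}"
    by (auto simp: inversion_set_def)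
  then show ?thesis
    by (simp add: inversions_def case_prod_unfold)
qed

lemma inversions_swap:
  assumes "1 \<le> k" "Suc k \<le> n" "w k < w (Suc k)"
  shows "inversions n (w \<circ> transpose k (Suc k)) = Suc (inversions n w)"
proof -
  let ?s = "transpose k (Suc k)"
  let ?P = "position_pairs n - {(k, Suc k)}"
  have kP: "(k, Suc k) \<in> position_pairs n"
    using assms by (simp add: position_pairs_def)
  have adj: "inversions n u = of_bool (u (Suc k) < u k) + (\<Sum>(i, j)\<in>?P. of_bool (u j < u i))" for u
    unfolding inversions_sum
    by (rule trans[OF sum.remove[OF finite_position_pairs kP]]) simp
  have "(\<Sum>(i, j)\<in>?P. of_bool (w j < w i)) =
      (\<Sum>(i, j)\<in>?P. of_bool (w (?s j) < w (?s i)) :: nat)"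
    using sum.reindex_bij_betw[OF swap_positions_bij[OF assms(1,2)], of "\<lambda>(i, j). of_bool (w j < w i) :: nat"]
    by (simp only: case_prod_unfold prod.sel)
  then show ?thesis
    using assms(3) by (simp add: adj)
qed

lemma inversions_swap_descent:
  assumes "1 \<le> k" "Suc k \<le> n" "w (Suc k) < w k"
  shows "Suc (inversions n (w \<circ> transpose k (Suc k))) = inversions n w"
  using inversions_swap[OF assms(1,2), of "w \<circ> transpose k (Suc k)"] assms(3)
  by (simp add: comp_assoc)

section \<open>Lower covers under an exchange of adjacent positions\<close>

lemma split_gt: "Suc k < j \<Longrightarrow>
    (\<forall>m. k < m \<longrightarrow> m < j \<longrightarrow> Q m) \<longleftrightarrow> Q (Suc k) \<and> (\<forall>m. Suc k < m \<longrightarrow> m < j \<longrightarrow> Q m)"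
  by (auto simp: Suc_less_eq2 dest: Suc_lessI) 

lemma split_lt: "i < k \<Longrightarrow>
    (\<forall>m. i < m \<longrightarrow> m < Suc k \<longrightarrow> Q m) \<longleftrightarrow> Q k \<and> (\<forall>m. i < m \<longrightarrow> m < k \<longrightarrow> Q m)"
  by (auto simp: less_Suc_eq)

text \<open>Lifting property: a lower cover of \<open>w \<circ> s\<close> other than
  \<open>w\<close> is \<open>v \<circ> s\<close> for a lower cover \<open>v\<close> of
  \<open>w\<close> that ascends at \<open>k\<close>. If \<open>i\<close> and \<open>j\<close> avoid
  \<open>k\<close> and \<open>Suc k\<close>, the interval between them is permuted within itself.
  Otherwise the two intervals differ by one position, and the ascent condition accounts for
  it.\<close>

lemma down_cover_lift:
  assumes "inj w" "w k < w (Suc k)" "i < j" "(i, j) \<noteq> (k, Suc k)"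
  defines "s \<equiv> transpose k (Suc k)"
  shows "down_cover (w \<circ> s) i j \<longleftrightarrow> down_cover w (s i) (s j) \<and>
    (w \<circ> transpose (s i) (s j)) k < (w \<circ> transpose (s i) (s j)) (Suc k)"
proof -
  have ne: "w p = w q \<longleftrightarrow> p = q" for p q
    using assms(1) by (simp add: inj_eq)
  consider "i \<notin> {k, Suc k}" "j \<notin> {k, Suc k}" | "i = k" "Suc k < j" | "i = Suc k"
    | "i < k" "j = k" | "i < k" "j = Suc k"
    using assms(3,4) by fastforce
  then show ?thesis
  proof cases
    case 1
    have "(\<forall>m. i < m \<longrightarrow> m < j \<longrightarrow> P (w (s m))) \<longleftrightarrow> (\<forall>m. i < m \<longrightarrow> m < j \<longrightarrow> P (w m))" for P
    proof -
      have m: "i < s m \<longleftrightarrow> i < m" "s m < j \<longleftrightarrow> m < j" for m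
        using 1 by (auto simp: s_def transpose_def)
      show ?thesis
        using m by (metis s_def transpose_involutory)
    qed
    from this[of "\<lambda>x. x < w j \<or> w i < x"] show ?thesis
      using 1 assms(2) by (simp add: down_cover_def s_def)
  next
    case 2
    have "(w \<circ> s) m = w m" if "Suc k < m" for m
      using that by (simp add: s_def)
    then show ?thesis
      using 2 assms(2) ne[of k j] ne[of "Suc k" j]
      unfolding down_cover_def by (auto simp: s_def split_gt)
  next
    case 3
    have "(w \<circ> s) m = w m" if "Suc k < m" for m
      using that by (simp add: s_def)
    then show ?thesis
      using 3 assms(2,3) ne[of k j] ne[of "Suc k" j]
      unfolding down_cover_def by (auto simp: s_def split_gt)
  next
    case 4
    have "(w \<circ> s) m = w m" if "m < k" for m
      using that by (simp add: s_def)
    then show ?thesis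
      using 4 assms(2,3) ne[of k i] ne[of "Suc k" i]
      unfolding down_cover_def by (auto simp: s_def split_lt)
  next
    case 5
    have "(w \<circ> s) m = w m" if "m < k" for m
      using that by (simp add: s_def)
    then show ?thesis
      using 5 assms(2,3) ne[of k i] ne[of "Suc k" i]
      unfolding down_cover_def by (auto simp: s_def split_lt)
  qed
qed

text \<open>The companion at a descent: if the exchange moves one of the positions \<open>k\<close>,
  \<open>Suc k\<close> and the other one lies inside the interval, an intermediate value is
  forbidden there, and this forces the descent to survive.\<close>

lemma down_cover_descent:
  assumes "inj w" "w (Suc k) < w k" "down_cover w i j" "(i, j) \<noteq> (k, Suc k)"
  shows "(w \<circ> transpose i j) (Suc k) < (w \<circ> transpose i j) k"
proof -
  have ne: "w p = w q \<longleftrightarrow> p = q" for p q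
    using assms(1) by (simp add: inj_eq)
  have ij: "i < j" "w j < w i"
    using assms(3) by (simp_all add: down_cover_def)
  have b: "w m < w j \<or> w i < w m" if "i < m" "m < j" for m
    using assms(3) that by (simp add: down_cover_def)
  consider "i \<notin> {k, Suc k}" "j \<notin> {k, Suc k}" | "i = k" "Suc k < j" | "i = Suc k"
    | "i < k" "j = k" | "i < k" "j = Suc k"
    using ij(1) assms(4) by fastforce
  then show ?thesis
    using b[of k] b[of "Suc k"] ij assms(2) by cases (auto simp: transpose_def)
qed

section \<open>Weighted cover operators and divided differences\<close>

definition cover_op ::
    "nat \<Rightarrow> ((nat \<Rightarrow> nat) \<Rightarrow> nat \<Rightarrow> nat \<Rightarrow> 'a) \<Rightarrow> ((nat \<Rightarrow> nat) \<Rightarrow> 'a) \<Rightarrow> (nat \<Rightarrow> nat) \<Rightarrow> 'a::comm_ring_1"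
  where "cover_op n g F w =
    (\<Sum>(i, j)\<in>position_pairs n. if down_cover w i j then g w i j * F (w \<circ> transpose i j) else 0)"

text \<open>\<open>F w\<close> is the coefficient of the Schubert class of \<open>w\<close>, so these operators look down in Bruhat order
  where multiplication by a variable goes up, and up where a divided difference goes down.\<close>

definition divided_diff :: "nat \<Rightarrow> ((nat \<Rightarrow> nat) \<Rightarrow> 'a) \<Rightarrow> (nat \<Rightarrow> nat) \<Rightarrow> 'a::comm_ring_1" where
  "divided_diff k F w = (if w k < w (Suc k) then F (w \<circ> transpose k (Suc k)) else 0)"

lemma cover_op_cong:
  assumes "\<And>u. inj u \<Longrightarrow> F u = G u" "inj w"
  shows "cover_op n g F w = cover_op n g G w"
  unfolding cover_op_def
  by (intro sum.cong refl) (auto simp: assms(1)[OF inj_comp_transpose[OF assms(2)]])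

lemma cover_op_add: "cover_op n g (\<lambda>w. F w + G w) w = cover_op n g F w + cover_op n g G w"
  unfolding cover_op_def sum.distrib[symmetric] by (intro sum.cong) (auto simp: algebra_simps)

lemma cover_op_scale: "cover_op n g (\<lambda>w. c * F w) w = c * cover_op n g F w"
  unfolding cover_op_def sum_distrib_left by (intro sum.cong) (auto simp: algebra_simps)

lemma cover_op_weight_add:
  "cover_op n (\<lambda>w i j. g w i j + h w i j) F w = cover_op n g F w + cover_op n h F w"
  unfolding cover_op_def sum.distrib[symmetric] by (intro sum.cong) (auto simp: algebra_simps)

lemma cover_op_weight_scale:
  "cover_op n (\<lambda>w i j. c * g w i j) F w = c * cover_op n g F w"
  unfolding cover_op_def sum_distrib_left by (intro sum.cong) (auto simp: algebra_simps)

text \<open>Common source of the Leibniz rules. At an ascent the summand of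
  \<open>(k, Suc k)\<close> leads back to \<open>w\<close> and yields \<open>C * F w\<close>, while
  the lifting property matches all other summands. At a descent the left side is 0, and on the right
  only \<open>(k, Suc k)\<close> survives because every other lower cover keeps the descent; it has
  to cancel \<open>C * F w\<close>, hence the sign in the last hypothesis.\<close>

lemma divided_diff_cover_op:
  assumes w: "inj w" and k: "1 \<le> k" "Suc k \<le> n"
    and eq: "\<And>i j. (i, j) \<in> position_pairs n \<Longrightarrow> (i, j) \<noteq> (k, Suc k) \<Longrightarrow> w k < w (Suc k) \<Longrightarrow>
      down_cover (w \<circ> transpose k (Suc k)) i j \<Longrightarrow>
      g (w \<circ> transpose k (Suc k)) i j = h w (transpose k (Suc k) i) (transpose k (Suc k) j)"
    and asc: "w k < w (Suc k) \<Longrightarrow> g (w \<circ> transpose k (Suc k)) k (Suc k) = C"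
    and desc: "w (Suc k) < w k \<Longrightarrow> h w k (Suc k) = - C"
  shows "divided_diff k (cover_op n g F) w = cover_op n h (divided_diff k F) w + C * F w"
proof -
  let ?s = "transpose k (Suc k)"
  let ?P = "position_pairs n - {(k, Suc k)}"
  have kP: "(k, Suc k) \<in> position_pairs n"
    using k by (simp add: position_pairs_def)
  have adj: "cover_op n g F u =
      (if down_cover u k (Suc k) then g u k (Suc k) * F (u \<circ> ?s) else 0) +
      (\<Sum>(i, j)\<in>?P. if down_cover u i j then g u i j * F (u \<circ> transpose i j) else 0)" for g F u
    unfolding cover_op_def by (rule trans[OF sum.remove[OF finite_position_pairs kP]]) (rule arg_cong2[where f=plus], simp_all)
  have ss: "w \<circ> ?s \<circ> ?s = w"
    by (simp add: comp_assoc)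
  have "w k \<noteq> w (Suc k)"
    using w by (simp add: inj_eq)
  then consider "w k < w (Suc k)" | "w (Suc k) < w k"
    by linarith
  then show ?thesis
  proof cases
    case 1
    have "divided_diff k (cover_op n g F) w = cover_op n g F (w \<circ> ?s)"
      using 1 by (simp add: divided_diff_def)
    also have "\<dots> = C * F w + (\<Sum>(i, j)\<in>?P. if down_cover (w \<circ> ?s) i j
        then g (w \<circ> ?s) i j * F (w \<circ> ?s \<circ> transpose i j) else 0)"
    proof -
      have "down_cover (w \<circ> ?s) k (Suc k)"
        using 1 by (simp add: down_cover_def)
      then show ?thesis
        by (simp only: adj[of g F] ss asc[OF 1] if_True)
    qed
    also have "(\<Sum>(i, j)\<in>?P. if down_cover (w \<circ> ?s) i j
        then g (w \<circ> ?s) i j * F (w \<circ> ?s \<circ> transpose i j) else 0) =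
      (\<Sum>(i, j)\<in>?P. if down_cover w i j then h w i j * divided_diff k F (w \<circ> transpose i j) else 0)"
      (is "?A = (\<Sum>(i, j)\<in>?P. ?H i j)")
    proof -
      have "(\<Sum>(i, j)\<in>?P. ?H i j) = (\<Sum>(i, j)\<in>?P. ?H (?s i) (?s j))"
        using sum.reindex_bij_betw[OF swap_positions_bij[OF k], of "\<lambda>(i, j). ?H i j"]
        by (simp only: case_prod_unfold prod.sel)
      also have "\<dots> = ?A"
      proof (rule sum.cong[OF refl])
        fix p assume p: "p \<in> ?P"
        obtain i j where p_eq: "p = (i, j)" by (cases p)
        with p have ij: "(i, j) \<in> position_pairs n" "(i, j) \<noteq> (k, Suc k)" by auto
        then have "i < j" by (simp add: position_pairs_def)
        have c: "w \<circ> ?s \<circ> transpose i j = w \<circ> transpose (?s i) (?s j) \<circ> ?s"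
          using transpose_comp_eq[of ?s "?s i" "?s j"] by (simp add: comp_assoc)
        note lift = down_cover_lift[OF w 1 \<open>i < j\<close> ij(2)]
        have "?H (?s i) (?s j) = (if down_cover (w \<circ> ?s) i j
            then g (w \<circ> ?s) i j * F (w \<circ> ?s \<circ> transpose i j) else 0)"
        proof (cases "down_cover (w \<circ> ?s) i j")
          case True
          then show ?thesis
            using lift by (simp only: c eq[OF ij 1 True] divided_diff_def if_True simp_thms)
        next
          case False
          \<comment> \<open>Either \<open>w\<close> has no cover at the relabelled pair, or that
            cover descends at \<open>k\<close> and its divided difference is 0 by
            definition.\<close>
          then show ?thesis
            using lift by (auto simp only: divided_diff_def if_False simp_thms mult_zero_right split: if_split)
        qed
        then show "(case p of (i, j) \<Rightarrow> ?H (?s i) (?s j)) = (case p of (i, j) \<Rightarrow>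
            if down_cover (w \<circ> ?s) i j then g (w \<circ> ?s) i j * F (w \<circ> ?s \<circ> transpose i j) else 0)"
          by (simp only: p_eq prod.case)
      qed
      finally show ?thesis ..
    qed
    also have "\<dots> = cover_op n h (divided_diff k F) w"
    proof -
      have "\<not> down_cover w k (Suc k)"
        using 1 by (simp add: down_cover_def)
      then show ?thesis
        by (simp only: adj[of h] if_False add_0_left)
    qed
    finally show ?thesis by (simp only: add.commute)
  next
    case 2
    have "cover_op n h (divided_diff k F) w =
      (\<Sum>(i, j)\<in>{(k, Suc k)}. if down_cover w i j then h w i j * divided_diff k F (w \<circ> transpose i j) else 0)"
      unfolding cover_op_def
    proof (rule sum.mono_neutral_right)
      show "\<forall>x\<in>position_pairs n - {(k, Suc k)}. (case x of (i, j) \<Rightarrow>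
          if down_cover w i j then h w i j * divided_diff k F (w \<circ> transpose i j) else 0) = 0"
      proof
        fix p assume p: "p \<in> ?P"
        obtain i j where p_eq: "p = (i, j)" by (cases p)
        have "divided_diff k F (w \<circ> transpose i j) = 0" if "down_cover w i j"
          using down_cover_descent[OF w 2 that] p p_eq
          by (simp add: divided_diff_def not_less order.strict_implies_order del: comp_apply)
        then show "(case p of (i, j) \<Rightarrow>
            if down_cover w i j then h w i j * divided_diff k F (w \<circ> transpose i j) else 0) = 0"
          by (simp add: p_eq)
      qed
    qed (use kP in auto)
    also have "\<dots> = - C * F w"
      using 2 desc by (simp add: down_cover_def divided_diff_def comp_assoc)
    finally show ?thesis
      using 2 by (simp add: divided_diff_def)
  qed
qed

section \<open>Multiplication by a variable and the derivation\<close>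

definition var_op :: "nat \<Rightarrow> nat \<Rightarrow> ((nat \<Rightarrow> nat) \<Rightarrow> 'a) \<Rightarrow> (nat \<Rightarrow> nat) \<Rightarrow> 'a::comm_ring_1" where
  "var_op n m = cover_op n (\<lambda>w i j. of_bool (i = m) - of_bool (j = m))"

definition above_between :: "(nat \<Rightarrow> nat) \<Rightarrow> nat \<Rightarrow> nat \<Rightarrow> nat" where
  "above_between w i j = card {k. i < k \<and> k < j \<and> w i < w k}"

definition below_between :: "(nat \<Rightarrow> nat) \<Rightarrow> nat \<Rightarrow> nat \<Rightarrow> nat" where
  "below_between w i j = card {k. i < k \<and> k < j \<and> w k < w j}"

definition deriv_op :: "nat \<Rightarrow> ((nat \<Rightarrow> nat) \<Rightarrow> 'a) \<Rightarrow> (nat \<Rightarrow> nat) \<Rightarrow> 'a::comm_ring_1" where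
  "deriv_op n = cover_op n (\<lambda>w i j. of_nat (below_between w i j) - of_nat (above_between w i j))"

text \<open>Leibniz rule for x_m f; the constant is the divided difference of x_m, that is 1, -1 or
  0.\<close>

lemma divided_diff_var_op:
  assumes "inj w" "1 \<le> k" "Suc k \<le> n"
  shows "divided_diff k (var_op n m F) w = var_op n (transpose k (Suc k) m) (divided_diff k F) w +
    (of_bool (m = k) - of_bool (m = Suc k)) * F w"
  unfolding var_op_def
proof (rule divided_diff_cover_op[OF assms])
  let ?s = "transpose k (Suc k)"
  have [simp]: "?s a = ?s b \<longleftrightarrow> a = b" for a b
    by (metis transpose_involutory)
  show "of_bool (i = m) - of_bool (j = m) = (of_bool (?s i = ?s m) - of_bool (?s j = ?s m) :: 'a)" for i j
    by simp
  show "of_bool (k = m) - of_bool (Suc k = m) = (of_bool (m = k) - of_bool (m = Suc k) :: 'a)"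
    by (simp add: eq_commute)
  show "of_bool (k = ?s m) - of_bool (Suc k = ?s m) = - (of_bool (m = k) - of_bool (m = Suc k) :: 'a)"
    by (auto simp: transpose_def)
qed

lemma between_swap_outside:
  assumes "i \<notin> {k, Suc k}" "j \<notin> {k, Suc k}"
  shows "above_between (w \<circ> transpose k (Suc k)) i j = above_between w i j"
    and "below_between (w \<circ> transpose k (Suc k)) i j = below_between w i j"
proof -
  let ?s = "transpose k (Suc k)"
  have "bij_betw ?s {m. i < m \<and> m < j \<and> P (w (?s m))} {m. i < m \<and> m < j \<and> P (w m)}" for P
    by (rule bij_betwI[where g = ?s]) (use assms in \<open>auto simp: transpose_def split: if_splits\<close>)
  from this[THEN bij_betw_same_card, of "\<lambda>x. w i < x"] this[THEN bij_betw_same_card, of "\<lambda>x. x < w j"]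
  show "above_between (w \<circ> ?s) i j = above_between w i j"
    "below_between (w \<circ> ?s) i j = below_between w i j"
    using assms by (simp_all add: above_between_def below_between_def)
qed

lemma card_interval_left:
  assumes "Suc k < j"
  shows "card {m. k < m \<and> m < j \<and> P m} = of_bool (P (Suc k)) + card {m. Suc k < m \<and> m < j \<and> P m}"
proof -
  have "{m. k < m \<and> m < j \<and> P m} = (if P (Suc k) then {Suc k} else {}) \<union> {m. Suc k < m \<and> m < j \<and> P m}"
    using assms by (auto dest: Suc_lessI)
  then show ?thesis by (simp add: Collect_conj_eq)
qed

lemma card_interval_right:
  assumes "i < k"
  shows "card {m. i < m \<and> m < Suc k \<and> P m} = of_bool (P k) + card {m. i < m \<and> m < k \<and> P m}"
proof -
  have "{m. i < m \<and> m < Suc k \<and> P m} = (if P k then {k} else {}) \<union> {m. i < m \<and> m < k \<and> P m}"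
    using assms by (auto simp: less_Suc_eq)
  then show ?thesis by simp
qed

text \<open>At most one position enters or leaves the interval when adjacent positions are
  exchanged, and the covering hypothesis decides whether its value counts as above or below. The
  indicators are the weights of multiplication by x_k and by x_{k+1}.\<close>

lemma between_swap:
  assumes w: "inj w" "w k < w (Suc k)" and ij: "i < j" "(i, j) \<noteq> (k, Suc k)"
    and d: "down_cover (w \<circ> transpose k (Suc k)) i j"
  defines "s \<equiv> transpose k (Suc k)"
  shows "(of_nat (below_between (w \<circ> s) i j) - of_nat (above_between (w \<circ> s) i j) :: 'a::comm_ring_1) =
    of_nat (below_between w (s i) (s j)) - of_nat (above_between w (s i) (s j)) +
    (of_bool (s i = k) - of_bool (s j = k)) + (of_bool (s i = Suc k) - of_bool (s j = Suc k))"
proof -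
  consider "i \<notin> {k, Suc k}" "j \<notin> {k, Suc k}" | "i = k" "Suc k < j" | "i = Suc k" "Suc k < j"
    | "i < k" "j = k" | "i < k" "j = Suc k"
    using ij by fastforce
  then show ?thesis
  proof cases
    case 1
    then show ?thesis by (simp add: s_def between_swap_outside)
  next
    case 2
    have s: "s m = m" if "Suc k < m" for m
      using that by (simp add: s_def)
    have *: "{m. Suc k < m \<and> m < j \<and> P ((w \<circ> s) m)} = {m. Suc k < m \<and> m < j \<and> P (w m)}" for P
      using s by auto
    have "(w \<circ> s) (Suc k) = w k" "(w \<circ> s) k = w (Suc k)" "(w \<circ> s) j = w j" "s k = Suc k" "s j = j"
      using 2 by (simp_all add: s_def)
    moreover have "w k < w j"
      using d w 2 by (force simp: down_cover_def s_def)
    ultimately show ?thesis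
      using 2 w(2) *[of "\<lambda>x. x < w j"] *[of "\<lambda>x. w (Suc k) < x"] unfolding below_between_def above_between_def
      by (simp del: comp_apply add: card_interval_left)
  next
    case 3
    have s: "s m = m" if "Suc k < m" for m
      using that by (simp add: s_def)
    have *: "{m. Suc k < m \<and> m < j \<and> P ((w \<circ> s) m)} = {m. Suc k < m \<and> m < j \<and> P (w m)}" for P
      using s by auto
    have "(w \<circ> s) (Suc k) = w k" "(w \<circ> s) k = w (Suc k)" "(w \<circ> s) j = w j" "s (Suc k) = k" "s j = j"
      using 3 by (simp_all add: s_def)
    moreover have "w j < w (Suc k)"
      using d w 3 by (force simp: down_cover_def s_def)
    ultimately show ?thesis
      using 3 w(2) *[of "\<lambda>x. x < w j"] *[of "\<lambda>x. w k < x"] unfolding below_between_def above_between_def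
      by (simp del: comp_apply add: card_interval_left)
  next
    case 4
    have s: "s m = m" if "m < k" for m
      using that by (simp add: s_def)
    have *: "{m. i < m \<and> m < k \<and> P ((w \<circ> s) m)} = {m. i < m \<and> m < k \<and> P (w m)}" for P
      using s by auto
    have "(w \<circ> s) (Suc k) = w k" "(w \<circ> s) k = w (Suc k)" "(w \<circ> s) i = w i" "s k = Suc k" "s i = i"
      using 4 by (simp_all add: s_def)
    moreover have "w k < w i"
      using d w 4 by (force simp: down_cover_def s_def)
    ultimately show ?thesis
      using 4 w(2) *[of "\<lambda>x. x < w (Suc k)"] *[of "\<lambda>x. w i < x"] unfolding below_between_def above_between_def
      by (simp del: comp_apply add: card_interval_right)
  next
    case 5
    have s: "s m = m" if "m < k" for m
      using that by (simp add: s_def)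
    have *: "{m. i < m \<and> m < k \<and> P ((w \<circ> s) m)} = {m. i < m \<and> m < k \<and> P (w m)}" for P
      using s by auto
    have "(w \<circ> s) (Suc k) = w k" "(w \<circ> s) k = w (Suc k)" "(w \<circ> s) i = w i" "s (Suc k) = k" "s i = i"
      using 5 by (simp_all add: s_def)
    moreover have "w i < w (Suc k)"
      using d w 5 by (force simp: down_cover_def s_def)
    ultimately show ?thesis
      using 5 w(2) *[of "\<lambda>x. x < w k"] *[of "\<lambda>x. w i < x"] unfolding below_between_def above_between_def
      by (simp del: comp_apply add: card_interval_right)
  qed
qed

text \<open>With E the derivation and D_k the divided difference, D_k E = (E + x_k + x_{k+1}) D_k,
  since E maps x_k - x_{k+1} to x_k^2 - x_{k+1}^2. There is no multiple of F: nothing lies between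
  adjacent positions, and the two indicators cancel on the pair \<open>(k, Suc k)\<close>.\<close>

lemma divided_diff_deriv_op:
  fixes F :: "(nat \<Rightarrow> nat) \<Rightarrow> 'a::comm_ring_1"
  assumes "inj w" "1 \<le> k" "Suc k \<le> n"
  shows "divided_diff k (deriv_op n F) w = deriv_op n (divided_diff k F) w
    + var_op n k (divided_diff k F) w + var_op n (Suc k) (divided_diff k F) w"
proof -
  let ?h = "\<lambda>w i j. of_nat (below_between w i j) - of_nat (above_between w i j)
    + (of_bool (i = k) - of_bool (j = k)) + (of_bool (i = Suc k) - of_bool (j = Suc k)) :: 'a"
  have "divided_diff k (deriv_op n F) w = cover_op n ?h (divided_diff k F) w + 0 * F w"
    unfolding deriv_op_def
  proof (rule divided_diff_cover_op[OF assms])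
    fix i j assume "(i, j) \<in> position_pairs n" "(i, j) \<noteq> (k, Suc k)" "w k < w (Suc k)"
      "down_cover (w \<circ> transpose k (Suc k)) i j"
    then show "of_nat (below_between (w \<circ> transpose k (Suc k)) i j) -
        of_nat (above_between (w \<circ> transpose k (Suc k)) i j) =
        ?h w (transpose k (Suc k) i) (transpose k (Suc k) j)"
      using assms(1) by (intro between_swap) (auto simp: position_pairs_def)
  next
    have e: "{m. k < m \<and> m < Suc k \<and> P m} = {}" for P by auto
    show "of_nat (below_between (w \<circ> transpose k (Suc k)) k (Suc k)) -
        of_nat (above_between (w \<circ> transpose k (Suc k)) k (Suc k)) = (0 :: 'a)"
      by (simp add: below_between_def above_between_def e)
    show "?h w k (Suc k) = - 0"
      by (simp add: below_between_def above_between_def e)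
  qed
  then show ?thesis
    by (simp add: deriv_op_def var_op_def cover_op_weight_add)
qed

section \<open>Commutation relations\<close>

lemma mono_from_steps:
  assumes "\<And>k. 1 \<le> k \<Longrightarrow> Suc k \<le> n \<Longrightarrow> w k < (w (Suc k) :: nat)" "1 \<le> i" "i < j" "j \<le> n"
  shows "w i < w j"
  using assms(3,4)
proof (induction j)
  case (Suc j)
  then show ?case
    using assms(1)[of j] assms(2) by (cases "i = j") (auto intro: less_trans)
qed simp

lemma cover_op_sorted:
  assumes "\<And>k. 1 \<le> k \<Longrightarrow> Suc k \<le> n \<Longrightarrow> w k < w (Suc k)"
  shows "cover_op n g F w = 0"
  unfolding cover_op_def
proof (rule sum.neutral, clarify)
  fix i j assume "(i, j) \<in> position_pairs n"
  then have "w i < w j"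
    using mono_from_steps[of n w i j] assms by (simp add: position_pairs_def)
  then show "(if down_cover w i j then g w i j * F (w \<circ> transpose i j) else 0) = 0"
    by (simp add: down_cover_def)
qed

text \<open>Removing a descent lowers the number of inversions, so every injective map is reached
  from one that increases on 1, ..., n. Operator identities need the induction hypothesis for other
  functions at the same \<open>w\<close>, hence the generalised variables in its
  applications.\<close>

lemma weak_order_induct [consumes 1, case_names sorted swap]:
  assumes "inj (w :: nat \<Rightarrow> nat)"
    and "\<And>w. inj w \<Longrightarrow> (\<And>k. 1 \<le> k \<Longrightarrow> Suc k \<le> n \<Longrightarrow> w k < w (Suc k)) \<Longrightarrow> P w"
    and swap: "\<And>w k. inj w \<Longrightarrow> 1 \<le> k \<Longrightarrow> Suc k \<le> n \<Longrightarrow> w k < w (Suc k) \<Longrightarrow> P w \<Longrightarrow>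
      P (w \<circ> transpose k (Suc k))"
  shows "P w"
  using assms(1)
proof (induction "inversions n w" arbitrary: w rule: less_induct)
  case less
  show ?case
  proof (cases "\<forall>k. 1 \<le> k \<longrightarrow> Suc k \<le> n \<longrightarrow> w k < w (Suc k)")
    case True
    then show ?thesis using assms(2) less.prems by blast
  next
    case False
    then obtain k where k: "1 \<le> k" "Suc k \<le> n" "w (Suc k) < w k"
      using less.prems by (metis inj_eq linorder_neqE_nat n_not_Suc_n)
    let ?u = "w \<circ> transpose k (Suc k)"
    have u: "P ?u"
      using less.hyps[of ?u] inversions_swap_descent[OF k] inj_comp_transpose[OF less.prems] by simp
    have "P (?u \<circ> transpose k (Suc k))"
      by (rule swap[OF inj_comp_transpose[OF less.prems] k(1,2) _ u]) (use k(3) in simp)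
    then show ?thesis by (simp add: comp_assoc)
  qed
qed

lemma divided_diff_ascent:
  "w k < w (Suc k) \<Longrightarrow> F (w \<circ> transpose k (Suc k)) = divided_diff k F w"
  by (simp add: divided_diff_def)

lemma divided_diff_cong:
  assumes "\<And>u. inj u \<Longrightarrow> F u = G u" "inj w"
  shows "divided_diff k F w = divided_diff k G w"
  unfolding divided_diff_def by (simp only: assms(1)[OF inj_comp_transpose[OF assms(2)]])

lemma divided_diff_add: "divided_diff k (\<lambda>w. F w + G w) w = divided_diff k F w + divided_diff k G w"
  by (simp add: divided_diff_def)

lemma divided_diff_diff: "divided_diff k (\<lambda>w. F w - G w) w = divided_diff k F w - divided_diff k G w"
  by (simp add: divided_diff_def)

lemma divided_diff_twice: "divided_diff k (divided_diff k F) = (\<lambda>w. 0)"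
  by (auto simp: divided_diff_def)

lemma var_op_cong:
  assumes "\<And>u. inj u \<Longrightarrow> F u = G u" "inj w"
  shows "var_op n m F w = var_op n m G w"
  unfolding var_op_def by (rule cover_op_cong[OF assms])

lemma var_op_add: "var_op n m (\<lambda>w. F w + G w) w = var_op n m F w + var_op n m G w"
  unfolding var_op_def by (rule cover_op_add)

lemma var_op_scale: "var_op n m (\<lambda>w. c * F w) w = c * var_op n m F w"
  unfolding var_op_def by (rule cover_op_scale)

lemma var_op_zero: "var_op n m (\<lambda>w. 0) w = 0"
  using var_op_scale[of n m 0 "\<lambda>w. 0"] by simp

lemma var_op_diff: "var_op n m (\<lambda>w. F w - G w) w = var_op n m F w - var_op n m G w"
  using var_op_add[of n m F "\<lambda>w. - 1 * G w" w] by (simp only: var_op_scale) simp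

lemma deriv_op_cong:
  assumes "\<And>u. inj u \<Longrightarrow> F u = G u" "inj w"
  shows "deriv_op n F w = deriv_op n G w"
  unfolding deriv_op_def by (rule cover_op_cong[OF assms])

lemma deriv_op_add: "deriv_op n (\<lambda>w. F w + G w) w = deriv_op n F w + deriv_op n G w"
  unfolding deriv_op_def by (rule cover_op_add)

lemma deriv_op_scale: "deriv_op n (\<lambda>w. c * F w) w = c * deriv_op n F w"
  unfolding deriv_op_def by (rule cover_op_scale)

lemma divided_diff_var_op_twice:
  fixes F :: "(nat \<Rightarrow> nat) \<Rightarrow> 'a::comm_ring_1"
  assumes "inj w" "1 \<le> k" "Suc k \<le> n"
  shows "divided_diff k (var_op n i (var_op n j F)) w =
    var_op n (transpose k (Suc k) i) (var_op n (transpose k (Suc k) j) (divided_diff k F)) w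
    + (of_bool (j = k) - of_bool (j = Suc k)) * var_op n (transpose k (Suc k) i) F w
    + (of_bool (i = k) - of_bool (i = Suc k)) * var_op n j F w"
proof -
  let ?s = "transpose k (Suc k)"
  have "var_op n (?s i) (divided_diff k (var_op n j F)) w = var_op n (?s i)
      (\<lambda>w. var_op n (?s j) (divided_diff k F) w + (of_bool (j = k) - of_bool (j = Suc k)) * F w) w"
    by (rule var_op_cong[OF _ assms(1)]) (rule divided_diff_var_op[OF _ assms(2,3)])
  then show ?thesis
    by (simp only: divided_diff_var_op[OF assms] var_op_add var_op_scale)
qed

text \<open>After two Leibniz rules the leading terms agree by the induction hypothesis for
  \<open>divided_diff k F\<close>.\<close>

lemma var_op_commute:
  fixes F :: "(nat \<Rightarrow> nat) \<Rightarrow> 'a::comm_ring_1"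
  assumes "inj w"
  shows "var_op n i (var_op n j F) w = var_op n j (var_op n i F) w"
  using assms
proof (induction w arbitrary: F i j rule: weak_order_induct[where n = n])
  case (sorted w)
  then show ?case by (simp add: var_op_def cover_op_sorted)
next
  case (swap w k)
  let ?s = "transpose k (Suc k)"
  \<comment> \<open>The two ways to expand the divided difference of the product x_i x_j.\<close>
  have "(of_bool (j = k) - of_bool (j = Suc k)) * var_op n (?s i) F w
      + (of_bool (i = k) - of_bool (i = Suc k)) * var_op n j F w =
    (of_bool (i = k) - of_bool (i = Suc k)) * var_op n (?s j) F w
      + (of_bool (j = k) - of_bool (j = Suc k)) * var_op n i F w"
    by (auto simp: transpose_def)
  then show ?case
    unfolding divided_diff_ascent[of w k, OF swap(4)] divided_diff_var_op_twice[OF swap(1-3)]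
      swap(5)[of "?s i" "?s j"] add.assoc
    by (rule arg_cong)
qed

text \<open>The commutator of the derivation with x_m is multiplication by its value x_m^2. This is
  the relation that makes \<open>deriv_op\<close> a derivation on monomials.\<close>

lemma deriv_op_var_op:
  fixes F :: "(nat \<Rightarrow> nat) \<Rightarrow> 'a::comm_ring_1"
  assumes "inj w"
  shows "deriv_op n (var_op n m F) w = var_op n m (deriv_op n F) w + var_op n m (var_op n m F) w"
  using assms
proof (induction w arbitrary: F m rule: weak_order_induct[where n = n])
  case (sorted w)
  then show ?case by (simp add: var_op_def deriv_op_def cover_op_sorted)
next
  case (swap w k)
  let ?s = "transpose k (Suc k)"
  let ?X = "var_op n" and ?E = "deriv_op n" and ?G = "divided_diff k F"
  define c :: 'a where "c = of_bool (m = k) - of_bool (m = Suc k)"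
  note dX = divided_diff_var_op[OF _ swap(2,3), of _ m F, folded c_def]
  have "divided_diff k (?E (?X m F)) w =
      ?E (divided_diff k (?X m F)) w + ?X k (divided_diff k (?X m F)) w
      + ?X (Suc k) (divided_diff k (?X m F)) w"
    by (rule divided_diff_deriv_op[OF swap(1-3)])
  also have "\<dots> = ?E (?X (?s m) ?G) w + c * ?E F w + (?X k (?X (?s m) ?G) w + c * ?X k F w)
      + (?X (Suc k) (?X (?s m) ?G) w + c * ?X (Suc k) F w)"
  proof -
    have "?E (divided_diff k (?X m F)) w = ?E (\<lambda>w. ?X (?s m) ?G w + c * F w) w"
      by (rule deriv_op_cong[OF _ swap(1)]) (rule dX)
    moreover have "?X i (divided_diff k (?X m F)) w = ?X i (\<lambda>w. ?X (?s m) ?G w + c * F w) w" for i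
      by (rule var_op_cong[OF _ swap(1)]) (rule dX)
    ultimately show ?thesis
      by (simp only: deriv_op_add deriv_op_scale var_op_add var_op_scale)
  qed
  also have "\<dots> = ?X (?s m) (?E ?G) w + ?X (?s m) (?X (?s m) ?G) w + c * ?E F w
      + (?X (?s m) (?X k ?G) w + c * ?X k F w) + (?X (?s m) (?X (Suc k) ?G) w + c * ?X (Suc k) F w)"
    unfolding swap(5)[of "?s m"] var_op_commute[OF swap(1), of n k] var_op_commute[OF swap(1), of n "Suc k"] ..
  finally have lhs: "divided_diff k (?E (?X m F)) w = \<dots>" .
  have "divided_diff k (?X m (?E F)) w = ?X (?s m) (?E ?G) w + ?X (?s m) (?X k ?G) w
      + ?X (?s m) (?X (Suc k) ?G) w + c * ?E F w"
  proof -
    have "?X (?s m) (divided_diff k (?E F)) w =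
        ?X (?s m) (\<lambda>w. ?E ?G w + ?X k ?G w + ?X (Suc k) ?G w) w"
      by (rule var_op_cong[OF _ swap(1)]) (rule divided_diff_deriv_op[OF _ swap(2,3)])
    then show ?thesis
      by (simp only: divided_diff_var_op[OF swap(1-3)] c_def var_op_add)
  qed
  moreover have "divided_diff k (?X m (?X m F)) w =
      ?X (?s m) (?X (?s m) ?G) w + c * ?X (?s m) F w + c * ?X m F w"
    unfolding divided_diff_var_op_twice[OF swap(1-3)] c_def ..
  \<comment> \<open>The divided difference of x_m^2: for \<open>m\<close> in
    \<open>{k, Suc k}\<close> the letters \<open>?s m\<close> and \<open>m\<close> are
    \<open>k\<close> and \<open>Suc k\<close> in some order, and otherwise \<open>c\<close> is
    0.\<close>
  moreover have "c * ?X (?s m) F w + c * ?X m F w = c * ?X k F w + c * ?X (Suc k) F w"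
    by (auto simp: c_def transpose_def)
  ultimately have "divided_diff k (?E (?X m F)) w =
      divided_diff k (?X m (?E F)) w + divided_diff k (?X m (?X m F)) w"
    unfolding lhs by (simp add: algebra_simps)
  then show ?case
    by (simp only: divided_diff_ascent[of w k, OF swap(4)])
qed

section \<open>Monomials as words in the variables\<close>

definition unit_fun :: "(nat \<Rightarrow> nat) \<Rightarrow> 'a::comm_ring_1" where
  "unit_fun w = of_bool (w = id)"

primrec word_op :: "nat \<Rightarrow> nat list \<Rightarrow> (nat \<Rightarrow> nat) \<Rightarrow> 'a::comm_ring_1" where
  "word_op n [] = unit_fun"
| "word_op n (m # ms) = var_op n m (word_op n ms)"

lemma divided_diff_unit_fun: "divided_diff k unit_fun = (\<lambda>w. 0)"
proof
  fix w :: "nat \<Rightarrow> nat"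
  have "w \<circ> transpose k (Suc k) \<noteq> id" if "w k < w (Suc k)"
  proof
    assume "w \<circ> transpose k (Suc k) = id"
    then have "(w \<circ> transpose k (Suc k)) k = k" "(w \<circ> transpose k (Suc k)) (Suc k) = Suc k"
      by simp_all
    with that show False by simp
  qed
  then show "divided_diff k unit_fun w = (0 :: 'a)"
    by (simp add: divided_diff_def unit_fun_def)
qed

text \<open>The identity s f = f - (x_k - x_{k+1}) D_k f. For polynomials it defines the divided
  difference; for operators it has to be derived letter by letter, as \<open>s\<close> acts on words
  only.\<close>

lemma word_op_swap_letters:
  fixes ms :: "nat list"
  assumes "inj w" "1 \<le> k" "Suc k \<le> n"
  defines "s \<equiv> transpose k (Suc k)"
  shows "word_op n (map s ms) w = (word_op n ms w :: 'a::comm_ring_1)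
    - var_op n k (divided_diff k (word_op n ms)) w + var_op n (Suc k) (divided_diff k (word_op n ms)) w"
  using assms(1)
proof (induction ms arbitrary: w)
  case Nil
  then show ?case by (simp add: divided_diff_unit_fun var_op_zero)
next
  case (Cons m ms)
  let ?X = "var_op n" and ?G = "word_op n ms :: (nat \<Rightarrow> nat) \<Rightarrow> 'a"
  let ?D = "divided_diff k ?G"
  define c :: 'a where "c = of_bool (m = k) - of_bool (m = Suc k)"
  note dX = divided_diff_var_op[OF _ assms(2,3), of _ m ?G, folded c_def s_def]
  have "word_op n (map s (m # ms)) w = ?X (s m) ?G w - ?X (s m) (?X k ?D) w + ?X (s m) (?X (Suc k) ?D) w"
  proof -
    have "?X (s m) (word_op n (map s ms)) w =
        ?X (s m) (\<lambda>w. ?G w - ?X k ?D w + ?X (Suc k) ?D w) w"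
      by (rule var_op_cong[OF _ Cons.prems]) (rule Cons.IH)
    then show ?thesis
      by (simp only: list.map word_op.simps var_op_add var_op_diff)
  qed
  moreover have "?X i (divided_diff k (?X m ?G)) w = ?X (s m) (?X i ?D) w + c * ?X i ?G w" for i
  proof -
    have "?X i (divided_diff k (?X m ?G)) w = ?X i (\<lambda>w. ?X (s m) ?D w + c * ?G w) w"
      by (rule var_op_cong[OF _ Cons.prems]) (rule dX)
    then show ?thesis
      by (simp only: var_op_add var_op_scale var_op_commute[OF Cons.prems, of n i])
  qed
  \<comment> \<open>The same identity for the single letter \<open>m\<close>, with \<open>c\<close>
    as the divided difference of x_m.\<close>
  moreover have "?X (s m) ?G w - ?X m ?G w = c * ?X (Suc k) ?G w - c * ?X k ?G w"
    by (auto simp: c_def s_def transpose_def)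
  ultimately show ?case
    by (simp add: algebra_simps)
qed

text \<open>Apply D_k to the previous identity: D_k vanishes on its own image, and D_k (x_k -
  x_{k+1}) = 2, so D_k f - 2 D_k f remains.\<close>

lemma divided_diff_swap_letters:
  fixes ms :: "nat list"
  assumes "inj w" "1 \<le> k" "Suc k \<le> n"
  shows "divided_diff k (word_op n (map (transpose k (Suc k)) ms)) w =
    - (divided_diff k (word_op n ms) w :: 'a::comm_ring_1)"
proof -
  let ?D = "divided_diff k (word_op n ms) :: (nat \<Rightarrow> nat) \<Rightarrow> 'a"
  have "divided_diff k (word_op n (map (transpose k (Suc k)) ms)) w =
    divided_diff k (\<lambda>w. word_op n ms w - var_op n k ?D w + var_op n (Suc k) ?D w) w"
    by (rule divided_diff_cong[OF word_op_swap_letters[OF _ assms(2,3)] assms(1)])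
  also have "\<dots> = ?D w - divided_diff k (var_op n k ?D) w + divided_diff k (var_op n (Suc k) ?D) w"
    by (simp only: divided_diff_add divided_diff_diff)
  also have "\<dots> = - ?D w"
    by (simp add: divided_diff_var_op[OF assms] divided_diff_twice var_op_zero)
  finally show ?thesis .
qed

lemma word_op_move:
  assumes "inj w" "x \<in> set ms"
  shows "word_op n ms w = (word_op n (x # remove1 x ms) w :: 'a::comm_ring_1)"
  using assms
proof (induction ms arbitrary: w)
  case (Cons m ms)
  show ?case
  proof (cases "x = m")
    case False
    then have "x \<in> set ms" using Cons.prems(2) by simp
    then have "var_op n m (word_op n ms) w = (var_op n m (word_op n (x # remove1 x ms)) w :: 'a)"
      by (intro var_op_cong[OF _ Cons.prems(1)]) (rule Cons.IH)
    then show ?thesis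
      using False var_op_commute[OF Cons.prems(1), of n m] by simp
  qed simp
qed simp

lemma word_op_mset:
  assumes "inj w" "mset ms = mset ms'"
  shows "word_op n ms w = (word_op n ms' w :: 'a::comm_ring_1)"
  using assms
proof (induction ms arbitrary: ms' w)
  case (Cons m ms)
  have "m \<in> set ms'"
    using Cons.prems(2) by (metis list.set_intros(1) set_mset_mset)
  then have "word_op n ms' w = (word_op n (m # remove1 m ms') w :: 'a)"
    by (rule word_op_move[OF Cons.prems(1)])
  also have "\<dots> = word_op n (m # ms) w"
    using Cons.prems by (auto intro!: var_op_cong Cons.IH[symmetric] simp flip: Cons.prems(2))
  finally show ?case ..
qed simp

lemma var_op_sum_list:
  "var_op n m (\<lambda>w. \<Sum>x\<leftarrow>xs. f x w) w = (\<Sum>x\<leftarrow>xs. var_op n m (f x) w)"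
  by (induction xs) (simp_all add: var_op_zero var_op_add)

lemma deriv_op_word_op:
  assumes "inj w"
  shows "deriv_op n (word_op n ms) w = (\<Sum>m\<leftarrow>ms. word_op n (m # ms) w :: 'a::comm_ring_1)"
  using assms
proof (induction ms arbitrary: w)
  case Nil
  show ?case
    unfolding deriv_op_def cover_op_def
  proof (simp only: list.map sum_list.Nil word_op.simps, rule sum.neutral, clarify)
    fix i j assume "(i, j) \<in> position_pairs n"
    then have "i < j" by (simp add: position_pairs_def)
    have "(of_nat (below_between w i j) - of_nat (above_between w i j)) * unit_fun (w \<circ> transpose i j) = (0 :: 'a)"
      if d: "down_cover w i j"
    proof (cases "w \<circ> transpose i j = id")
      case True
      then have "w \<circ> transpose i j \<circ> transpose i j = transpose i j" by simp
      then have w: "w = transpose i j" by (simp add: comp_assoc)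
      \<comment> \<open>The derivation kills 1: a permutation covering the identity is an adjacent
        transposition, because position \<open>i + 1\<close> would otherwise carry an intermediate
        value, and an adjacent exchange has weight 0.\<close>
      have "j = Suc i"
      proof (rule ccontr)
        assume "j \<noteq> Suc i"
        with \<open>i < j\<close> have "i < Suc i" "Suc i < j" by simp_all
        with d show False by (auto simp: down_cover_def w)
      qed
      have e: "{m. i < m \<and> m < Suc i \<and> P m} = {}" for P by auto
      from \<open>j = Suc i\<close> show ?thesis
        by (simp add: below_between_def above_between_def e)
    qed (simp add: unit_fun_def)
    then show "(if down_cover w i j then (of_nat (below_between w i j) - of_nat (above_between w i j)) *
      unit_fun (w \<circ> transpose i j) else 0) = (0 :: 'a)" by simp
  qed
next
  case (Cons m ms)
  let ?X = "var_op n" and ?W = "word_op n :: nat list \<Rightarrow> (nat \<Rightarrow> nat) \<Rightarrow> 'a"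
  have "deriv_op n (?W (m # ms)) w = ?X m (deriv_op n (?W ms)) w + ?X m (?X m (?W ms)) w"
    by (simp add: deriv_op_var_op[OF Cons.prems])
  also have "?X m (deriv_op n (?W ms)) w = (\<Sum>x\<leftarrow>ms. ?X m (?X x (?W ms)) w)"
  proof -
    have "?X m (deriv_op n (?W ms)) w = ?X m (\<lambda>w. \<Sum>x\<leftarrow>ms. ?W (x # ms) w) w"
      by (rule var_op_cong[OF _ Cons.prems]) (rule Cons.IH)
    then show ?thesis by (simp add: var_op_sum_list)
  qed
  also have "\<dots> = (\<Sum>x\<leftarrow>ms. ?W (x # m # ms) w)"
    by (simp add: var_op_commute[OF Cons.prems, of n m])
  finally show ?case by simp
qed

section \<open>The coefficient of the longest permutation\<close>

lemma Sym_inj: "w \<in> Sym n \<Longrightarrow> inj w"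
  by (simp add: Sym_def permutes_inj)

lemma Sym_transpose:
  "w \<in> Sym n \<Longrightarrow> i \<in> {1..n} \<Longrightarrow> j \<in> {1..n} \<Longrightarrow> w \<circ> transpose i j \<in> Sym n"
  unfolding Sym_def mem_Collect_eq by (rule permutes_compose[OF permutes_swap_id])

lemma Sym_bounds: "w \<in> Sym n \<Longrightarrow> i \<in> {1..n} \<Longrightarrow> w i \<in> {1..n}"
  unfolding Sym_def using permutes_in_image by fastforce

lemma id_Sym: "id \<in> Sym n"
  by (simp add: Sym_def permutes_id)

lemma longest_Sym: "longest n \<in> Sym n"
  unfolding Sym_def longest_def mem_Collect_eq
  by (rule bij_imp_permutes, rule bij_betwI[where g = "\<lambda>i. n + 1 - i"]) auto

lemma longest_longest: "longest n (longest n i) = i"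
  by (auto simp: longest_def)

lemma card_position_pairs: "card (position_pairs n) = n choose 2"
proof (induction n)
  case 0
  have "position_pairs 0 = {}" by (auto simp: position_pairs_def)
  then show ?case by simp
next
  case (Suc n)
  have "position_pairs (Suc n) = position_pairs n \<union> (\<lambda>i. (i, Suc n)) ` {1..n}"
    by (auto simp: position_pairs_def image_iff)
  moreover have "position_pairs n \<inter> (\<lambda>i. (i, Suc n)) ` {1..n} = {}"
    by (auto simp: position_pairs_def)
  ultimately have "card (position_pairs (Suc n)) = (n choose 2) + card ((\<lambda>i. (i, Suc n)) ` {1..n})"
    using Suc by (simp add: card_Un_disjoint)
  also have "card ((\<lambda>i. (i, Suc n)) ` {1..n}) = n"
    by (subst card_image) (auto simp: inj_on_def)
  finally show ?case by (simp add: numeral_2_eq_2)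
qed

lemma sorted_Sym_id:
  assumes v: "v \<in> Sym n" and "\<And>i j. 1 \<le> i \<Longrightarrow> i < j \<Longrightarrow> j \<le> n \<Longrightarrow> v i < v j"
  shows "v = id"
proof -
  have lower: "i \<le> v i" if "1 \<le> i" "i \<le> n" for i
    using that
  proof (induction i)
    case (Suc i)
    show ?case
    proof (cases "i = 0")
      case True
      then show ?thesis using Sym_bounds[OF v, of "Suc i"] Suc.prems by simp
    next
      case False
      then show ?thesis using Suc assms(2)[of i "Suc i"] by simp
    qed
  qed simp
  have upper': "v (n - k) \<le> n - k" if "k < n" for k
    using that
  proof (induction k)
    case 0
    then show ?case using Sym_bounds[OF v, of n] by simp
  next
    case (Suc k)
    then have "v (n - Suc k) < v (n - k)" by (intro assms(2)) auto
    with Suc show ?case by simp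
  qed
  have upper: "v i \<le> i" if "1 \<le> i" "i \<le> n" for i
    using upper'[of "n - i"] that by simp
  show ?thesis
  proof
    fix i show "v i = id i"
      using lower[of i] upper[of i] v
      by (cases "i \<in> {1..n}") (auto simp: Sym_def permutes_def intro: le_antisym)
  qed
qed

lemma inversions_0_iff:
  assumes "w \<in> Sym n"
  shows "inversions n w = 0 \<longleftrightarrow> w = id"
proof
  assume "inversions n w = 0"
  then have e: "inversion_set n w = {}" by (simp add: inversions_def)
  show "w = id"
  proof (rule sorted_Sym_id[OF assms])
    fix i j assume ij: "1 \<le> i" "i < j" "j \<le> n"
    then have "\<not> w j < w i" using e by (auto simp: inversion_set_def position_pairs_def)
    moreover have "w i \<noteq> w j" using Sym_inj[OF assms] ij by (simp add: inj_eq)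
    ultimately show "w i < w j" by simp
  qed
qed (auto simp: inversions_def inversion_set_def position_pairs_def card_eq_0_iff)

lemma inversions_longest: "inversions n (longest n) = n choose 2"
proof -
  have "inversion_set n (longest n) = position_pairs n"
    by (auto simp: inversion_set_def position_pairs_def longest_def)
  then show ?thesis by (simp add: inversions_def card_position_pairs)
qed

lemma inversions_max:
  assumes "w \<in> Sym n" "inversions n w = n choose 2"
  shows "w = longest n"
proof -
  have "inversion_set n w = position_pairs n"
    using assms(2) unfolding inversions_def card_position_pairs[symmetric]
    by (intro card_subset_eq) (auto simp: inversion_set_def)
  then have dec: "w j < w i" if "1 \<le> i" "i < j" "j \<le> n" for i j
    using that by (auto simp: inversion_set_def position_pairs_def)
  have "w \<circ> longest n = id"
  proof (rule sorted_Sym_id)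
    show "w \<circ> longest n \<in> Sym n"
      using assms(1) longest_Sym unfolding Sym_def by (auto intro: permutes_compose)
    show "(w \<circ> longest n) i < (w \<circ> longest n) j" if "1 \<le> i" "i < j" "j \<le> n" for i j
      using that dec[of "n + 1 - j" "n + 1 - i"] by (simp add: longest_def)
  qed
  then have "w (longest n i) = i" for i by (simp add: fun_eq_iff)
  then show ?thesis by (metis longest_longest ext)
qed

section \<open>Alternation of the top coefficient\<close>

lemma longest_descent:
  assumes "1 \<le> k" "Suc k \<le> n"
  shows "longest n (Suc k) < longest n k"
  using assms by (simp add: longest_def)

text \<open>As \<open>longest n\<close> descends everywhere, its coefficient is a divided difference
  one step below, and that changes sign with the letters.\<close>

lemma word_op_longest_swap:
  assumes "1 \<le> k" "Suc k \<le> n"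
  shows "word_op n (map (transpose k (Suc k)) ms) (longest n) = - (word_op n ms (longest n) :: 'a::comm_ring_1)"
proof -
  let ?u = "longest n \<circ> transpose k (Suc k)"
  have "inj ?u" by (rule inj_comp_transpose[OF Sym_inj[OF longest_Sym]])
  moreover have "divided_diff k F ?u = F (longest n)" for F :: "_ \<Rightarrow> 'a"
    using longest_descent[OF assms] by (simp add: divided_diff_def comp_assoc)
  ultimately show ?thesis
    using divided_diff_swap_letters[OF _ assms, of ?u ms] by metis
qed

text \<open>Conjugation by an adjacent transposition lowers the right end and costs two further
  signs, which cancel.\<close>

lemma word_op_longest_transpose:
  assumes "1 \<le> a" "a < b" "b \<le> n"
  shows "word_op n (map (transpose a b) ms) (longest n) = - (word_op n ms (longest n) :: 'a::comm_ring_1)"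
  using assms(2,3)
proof (induction b arbitrary: ms)
  case (Suc b)
  show ?case
  proof (cases "a = b")
    case True
    then show ?thesis using word_op_longest_swap[of b n] Suc.prems assms(1) by simp
  next
    case False
    let ?s = "transpose b (Suc b)"
    have "transpose a (Suc b) = ?s \<circ> transpose a b \<circ> ?s"
      using transpose_comp_triple[of "Suc b" a b] Suc.prems False by (simp add: transpose_commute)
    then have e: "map (transpose a (Suc b)) ms = map ?s (map (transpose a b) (map ?s ms))"
      by simp
    have "a < b" "1 \<le> b" using False Suc.prems assms(1) by auto
    then show ?thesis
      unfolding e using Suc by (simp only: word_op_longest_swap minus_minus Suc_leD)
  qed
qed simp

text \<open>The letter \<open>r\<close> stands for the variable \<open>x\<^bsub>n - r\<^esub>\<close>, whose coefficient in the linear form is \<open>r\<close>.\<close>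

definition top_coeff :: "nat \<Rightarrow> nat list \<Rightarrow> 'a::comm_ring_1" where
  "top_coeff n v = word_op n (map (\<lambda>r. n - r) v) (longest n)"

lemma top_coeff_mset: "mset v = mset v' \<Longrightarrow> top_coeff n v = top_coeff n v'"
  unfolding top_coeff_def by (rule word_op_mset[OF Sym_inj[OF longest_Sym]]) simp

lemma top_coeff_transpose:
  assumes "a < n" "b < n" "a \<noteq> b" "set v \<subseteq> {0..<n}"
  shows "top_coeff n (map (transpose a b) v) = - (top_coeff n v :: 'a::comm_ring_1)"
proof -
  have *: "top_coeff n (map (transpose a b) v) = - (top_coeff n v :: 'a)" if "a < b" "b < n" for a b
  proof -
    have e: "map (\<lambda>r. n - r) (map (transpose a b) v) = map (transpose (n - b) (n - a)) (map (\<lambda>r. n - r) v)"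
      using assms(4) that by (auto simp: transpose_def)
    show ?thesis
      unfolding top_coeff_def e by (rule word_op_longest_transpose) (use that in auto)
  qed
  show ?thesis
    using *[of a b] *[of b a] assms(1-3) by (cases "a < b") (auto simp: transpose_commute)
qed

lemma top_coeff_permutes:
  assumes "p permutes {0..<n}" "set v \<subseteq> {0..<n}"
  shows "top_coeff n (map p v) = of_int (sign p) * (top_coeff n v :: 'a::comm_ring_1)"
  using assms(1) finite_atLeastLessThan
proof (induction rule: permutes_induct)
  case id
  then show ?case by simp
next
  case (swap a b p)
  have "set (map p v) \<subseteq> {0..<n}"
    using assms(2) permutes_in_image[OF \<open>p permutes {0..<n}\<close>] by fastforce
  then have "top_coeff n (map (transpose a b \<circ> p) v) = - (top_coeff n (map p v) :: 'a)"
    unfolding map_map[symmetric] using swap by (intro top_coeff_transpose) auto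
  moreover have "sign (transpose a b \<circ> p) = - sign p"
    using swap by (subst sign_compose)
      (auto simp: permutation_swap_id sign_swap_id intro: permutes_imp_permutation[OF finite_atLeastLessThan])
  ultimately show ?case
    by (simp only: swap.IH of_int_minus mult_minus_left)
qed

section \<open>Vanishing and normalisation of the top coefficient\<close>

lemma mset_map_transpose:
  assumes "count_list v a = count_list v b"
  shows "mset (map (transpose a b) v) = mset v"
proof (rule multiset_eqI)
  fix x
  have "count_list (map (transpose a b) v) (transpose a b (transpose a b x)) = count_list v (transpose a b x)"
    by (rule count_list_map_conv[OF inj_transpose])
  then show "count (mset (map (transpose a b) v)) x = count (mset v) x"
    unfolding count_mset using assms by (auto simp: transpose_def split: if_splits)
qed

text \<open>Exchanging two variables with equal exponents fixes the monomial, so the coefficient is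
  its own negative; characteristic zero excludes other solutions.\<close>

lemma top_coeff_equal_counts:
  assumes "a < n" "b < n" "a \<noteq> b" "set v \<subseteq> {0..<n}" "count_list v a = count_list v b"
  shows "top_coeff n v = (0 :: 'a::{idom,ring_char_0})"
proof -
  have "mset (map (transpose a b) v) = mset v"
    by (rule mset_map_transpose[OF assms(5)])
  then have "top_coeff n v = - (top_coeff n v :: 'a)"
    using top_coeff_transpose[OF assms(1-4)] top_coeff_mset by metis
  then have "2 * top_coeff n v = (0 :: 'a)"
    by (metis mult_2 add.right_inverse)
  then show ?thesis by simp
qed

text \<open>Tracks a coefficient 1 without naming its permutation: at length
  \<open>n choose 2\<close> only \<open>longest n\<close> is left, so the witnesses below the top
  need not be computed.\<close>

definition attains_one :: "nat \<Rightarrow> nat \<Rightarrow> ((nat \<Rightarrow> nat) \<Rightarrow> 'a::comm_ring_1) \<Rightarrow> bool" where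
  "attains_one n r F \<longleftrightarrow> (\<exists>w \<in> Sym n. inversions n w = r \<and> F w = 1)"

lemma attains_one_divided_diff:
  assumes "1 \<le> k" "Suc k \<le> n" "\<And>w. inj w \<Longrightarrow> divided_diff k F w = G w" "attains_one n r G"
  shows "attains_one n (Suc r) (F :: _ \<Rightarrow> 'a::comm_ring_1)"
proof -
  obtain w where w: "w \<in> Sym n" "inversions n w = r" "G w = 1"
    using assms(4) by (auto simp: attains_one_def)
  have "divided_diff k F w = 1"
    using assms(3) w Sym_inj by auto
  then have "w k < w (Suc k)" "F (w \<circ> transpose k (Suc k)) = 1"
    by (auto simp: divided_diff_def split: if_splits)
  then show ?thesis
    unfolding attains_one_def
    using w Sym_transpose[OF w(1)] inversions_swap[OF assms(1,2)] assms(1,2)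
    by (intro bexI[of _ "w \<circ> transpose k (Suc k)"]) auto
qed

text \<open>If x_k and x_{k+1} have equal exponents in f, then D_k f = 0, so the Leibniz rule gives
  D_k (x_k f) = f.\<close>

lemma attains_one_Cons:
  assumes "1 \<le> k" "Suc k \<le> n" "count_list ms k = count_list ms (Suc k)"
    and "attains_one n r (word_op n ms :: _ \<Rightarrow> 'a::{idom,ring_char_0})"
  shows "attains_one n (Suc r) (word_op n (k # ms) :: _ \<Rightarrow> 'a)"
proof (rule attains_one_divided_diff[OF assms(1,2) _ assms(4)])
  let ?s = "transpose k (Suc k)"
  have m: "mset (map ?s ms) = mset ms"
    by (rule mset_map_transpose[OF assms(3)])
  have z: "divided_diff k (word_op n ms) w = (0 :: 'a)" if "inj w" for w
  proof -
    have "divided_diff k (word_op n (map ?s ms)) w = (divided_diff k (word_op n ms) w :: 'a)"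
      by (rule divided_diff_cong[OF _ that]) (rule word_op_mset[OF _ m])
    then have "divided_diff k (word_op n ms) w = - (divided_diff k (word_op n ms) w :: 'a)"
      using divided_diff_swap_letters[OF that assms(1,2)] by metis
    then have "2 * divided_diff k (word_op n ms) w = (0 :: 'a)"
      by (metis mult_2 add.right_inverse)
    then show ?thesis by simp
  qed
  fix w :: "nat \<Rightarrow> nat" assume w: "inj w"
  have "var_op n (Suc k) (divided_diff k (word_op n ms)) w = var_op n (Suc k) (\<lambda>w. 0 :: 'a) w"
    by (rule var_op_cong[OF _ w]) (rule z)
  then show "divided_diff k (word_op n (k # ms)) w = (word_op n ms w :: 'a)"
    by (simp add: divided_diff_var_op[OF w assms(1,2)] var_op_zero)
qed

text \<open>The monomial x_1^(m-1) x_2^(m-2) ... x_{m-1}, the Schubert polynomial of the longest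
  permutation. Passing from \<open>m\<close> to \<open>Suc m\<close> multiplies it by x_1 ...
  x_m.\<close>

primrec staircase :: "nat \<Rightarrow> nat list" where
  "staircase 0 = []"
| "staircase (Suc m) = [1..<Suc m] @ staircase m"

lemma count_list_upt: "count_list [a..<b] x = of_bool (a \<le> x \<and> x < b)"
  by (induction b) auto

lemma count_staircase: "count_list (staircase m) i = (if 1 \<le> i then m - i else 0)"
  by (induction m) (auto simp: count_list_upt simp del: upt_Suc)

lemma staircase_attains_one:
  "m \<le> n \<Longrightarrow> attains_one n (length (staircase m)) (word_op n (staircase m) :: _ \<Rightarrow> 'a::{idom,ring_char_0})"
proof (induction m)
  case 0
  show ?case
    unfolding attains_one_def
    by (rule bexI[OF _ id_Sym]) (simp add: inversions_0_iff[OF id_Sym] unit_fun_def)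
next
  case (Suc m)
  \<comment> \<open>The prefix is prepended from the letter \<open>m\<close> downwards, and
    \<open>d\<close> counts the letters already there. When \<open>j\<close> comes next,
    \<open>Suc j\<close> has just been raised (or \<open>j = m\<close>, where both counts are 0), so
    \<open>j\<close> and \<open>Suc j\<close> occur equally often.\<close>
  have "attains_one n (length ([Suc m - d..<Suc m] @ staircase m))
      (word_op n ([Suc m - d..<Suc m] @ staircase m) :: _ \<Rightarrow> 'a)" if "d \<le> m" for d
    using that
  proof (induction d)
    case 0
    then show ?case using Suc by simp
  next
    case (Suc d)
    let ?j = "m - d"
    have e: "[Suc m - Suc d..<Suc m] = ?j # [Suc m - d..<Suc m]"
      using Suc.prems by (subst upt_conv_Cons) (auto simp: Suc_diff_le)
    show ?case
      unfolding e append_Cons list.size(4) add_Suc_right add_0_right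
    proof (rule attains_one_Cons)
      show "1 \<le> ?j" "Suc ?j \<le> n" using Suc.prems \<open>Suc m \<le> n\<close> by auto
      show "count_list ([Suc m - d..<Suc m] @ staircase m) ?j =
        count_list ([Suc m - d..<Suc m] @ staircase m) (Suc ?j)"
        using Suc.prems by (auto simp: count_list_upt count_staircase simp del: upt_Suc)
    qed (use Suc in simp)
  qed
  from this[of m] show ?case by simp
qed

lemma length_staircase: "length (staircase m) = m choose 2"
  by (induction m) (simp_all add: numeral_2_eq_2)

lemma top_coeff_staircase:
  assumes "set v \<subseteq> {0..<n}" "\<And>r. r < n \<Longrightarrow> count_list v r = r"
  shows "top_coeff n v = (1 :: 'a::{idom,ring_char_0})"
proof -
  have "mset (map (\<lambda>r. n - r) v) = mset (staircase n)"
  proof (rule multiset_eqI)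
    fix i
    show "count (mset (map (\<lambda>r. n - r) v)) i = count (mset (staircase n)) i"
    proof (cases "1 \<le> i \<and> i \<le> n")
      case True
      have "inj_on (\<lambda>r. n - r) (set v \<union> {n - i})"
        using assms(1) True by (auto simp: inj_on_def)
      then have "count_list (map (\<lambda>r. n - r) v) (n - (n - i)) = count_list v (n - i)"
        by (cases "n - i \<in> set v") (auto simp: count_list_inj_map count_list_0_iff inj_on_def)
      then show ?thesis
        using True assms(2)[of "n - i"] unfolding count_mset by (simp add: count_staircase)
    next
      case False
      then have "i \<notin> set (map (\<lambda>r. n - r) v)" using assms(1) by fastforce
      then show ?thesis
        using False by (simp only: count_mset count_notin count_staircase) auto
    qed
  qed
  then have "top_coeff n v = (word_op n (staircase n) (longest n) :: 'a)"
    unfolding top_coeff_def by (rule word_op_mset[OF Sym_inj[OF longest_Sym]])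
  also have "\<dots> = 1"
  proof -
    obtain w where "w \<in> Sym n" "inversions n w = n choose 2" "word_op n (staircase n) w = (1 :: 'a)"
      using staircase_attains_one[of n n, where 'a = 'a] unfolding attains_one_def length_staircase by auto
    then show ?thesis using inversions_max by metis
  qed
  finally show ?thesis .
qed

section \<open>The determinant of falling factorials\<close>

text \<open>The power of \<open>x\<close> for \<open>t = 0\<close> and the falling factorial for
  \<open>t = 1\<close>; \<open>j\<close> is the degree.\<close>

definition step_falling :: "'a::comm_ring_1 \<Rightarrow> nat \<Rightarrow> nat \<Rightarrow> 'a" where
  "step_falling t j x = (\<Prod>s<j. of_nat x - t * of_nat s)"

text \<open>Stirling-like numbers that express step \<open>t\<close> in step 1. With f_k the falling
  factorial of degree k, the recursion is (x - t j) f_k = f_{k+1} + (k - t j) f_k.\<close>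

fun step_coeff :: "'a::comm_ring_1 \<Rightarrow> nat \<Rightarrow> nat \<Rightarrow> 'a" where
  "step_coeff t 0 k = of_bool (k = 0)"
| "step_coeff t (Suc j) k =
    (if k = 0 then 0 else step_coeff t j (k - 1)) + (of_nat k - t * of_nat j) * step_coeff t j k"

lemma step_coeff_above: "j < k \<Longrightarrow> step_coeff t j k = 0"
  by (induction j arbitrary: k) auto

lemma step_coeff_diag: "step_coeff t j j = 1"
  by (induction j) (auto simp: step_coeff_above)

lemma step_falling_Suc: "step_falling t (Suc j) x = (of_nat x - t * of_nat j) * step_falling t j x"
  by (simp add: step_falling_def mult.commute)

lemma step_falling_expand:
  assumes "j < n"
  shows "step_falling t j x = (\<Sum>k<n. step_falling 1 k x * step_coeff t j k)"
  using assms
proof (induction j)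
  case 0
  have "(\<Sum>k<n. step_falling 1 k x * step_coeff t 0 k) = (\<Sum>k<n. if k = 0 then step_falling 1 k x else 0)"
    by (intro sum.cong) auto
  then show ?case using 0 by (simp add: step_falling_def)
next
  case (Suc j)
  then obtain m where n: "n = Suc m" by (cases n) auto
  let ?f = "\<lambda>k. step_falling 1 k x :: 'a" and ?q = "step_coeff t j"
  \<comment> \<open>Lets the shifted sum stop before index \<open>n\<close>, so that it stays inside
    an \<open>n\<close> by \<open>n\<close> matrix.\<close>
  have "?q m = 0" using Suc.prems n by (simp add: step_coeff_above)
  have *: "(of_nat x - t * of_nat j) * ?f k = ?f (Suc k) + (of_nat k - t * of_nat j) * ?f k" for k
    by (simp add: step_falling_Suc algebra_simps)
  have "step_falling t (Suc j) x = (\<Sum>k<n. (of_nat x - t * of_nat j) * ?f k * ?q k)"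
    using Suc by (simp add: step_falling_Suc sum_distrib_left mult.assoc)
  also have "\<dots> = (\<Sum>k<n. ?f (Suc k) * ?q k) + (\<Sum>k<n. (of_nat k - t * of_nat j) * ?f k * ?q k)"
    by (simp only: * distrib_right sum.distrib)
  also have "(\<Sum>k<n. ?f (Suc k) * ?q k) = (\<Sum>k<m. ?f (Suc k) * ?q k)"
    using \<open>?q m = 0\<close> by (simp add: n)
  also have "\<dots> = (\<Sum>k<n. ?f k * (if k = 0 then 0 else ?q (k - 1)))"
    unfolding n by (subst sum.lessThan_Suc_shift) simp
  finally show ?case
    by (simp add: algebra_simps sum.distrib sum_subtractf)
qed


lemma step_falling_one_zero: "x < k \<Longrightarrow> step_falling 1 k x = 0"
  unfolding step_falling_def by (rule prod_zero) auto

lemma step_falling_one_diag: "step_falling 1 x x = of_nat (fact x)"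
proof -
  have "step_falling 1 x x = (\<Prod>s<x. of_nat (x - s) :: 'a)"
    unfolding step_falling_def by (rule prod.cong) auto
  also have "\<dots> = (\<Prod>s<x. of_nat (Suc s))"
    by (rule prod.reindex_bij_witness[where i = "\<lambda>s. x - Suc s" and j = "\<lambda>s. x - Suc s"]) auto
  also have "\<dots> = of_nat (fact x)"
    by (simp add: fact_prod_Suc atLeast0LessThan del: of_nat_Suc)
  finally show ?thesis .
qed

text \<open>The falling factorial of degree \<open>k\<close> vanishes at \<open>i < k\<close>, so
  the step 1 matrix is lower triangular with factorials on the diagonal. The change of step is upper
  unitriangular and carries all of \<open>t\<close>.\<close>

lemma det_step_falling:
  "det (mat n n (\<lambda>(i, j). step_falling t j i)) = (\<Prod>i<n. of_nat (fact i) :: 'a::idom)"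
proof -
  let ?A = "mat n n (\<lambda>(i, k). step_falling 1 k i) :: 'a mat"
  let ?T = "mat n n (\<lambda>(k, j). step_coeff t j k) :: 'a mat"
  have "mat n n (\<lambda>(i, j). step_falling t j i) = ?A * ?T"
    by (rule eq_matI) (auto simp: scalar_prod_def step_falling_expand[of _ n] atLeast0LessThan)
  then have "det (mat n n (\<lambda>(i, j). step_falling t j i)) = det ?A * det ?T"
    using det_mult[of ?A n ?T] by simp
  also have "det ?A = (\<Prod>i<n. of_nat (fact i))"
    by (subst det_lower_triangular[of n])
       (auto simp: step_falling_one_zero prod_list_diag_prod step_falling_one_diag atLeast0LessThan
         simp del: of_nat_fact)
  also have "det ?T = 1"
    by (subst det_upper_triangular[of _ n])
       (auto simp: upper_triangular_def step_coeff_above prod_list_diag_prod step_coeff_diag)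
  finally show ?thesis by simp
qed

section \<open>Powers of the diagonal operator on monomials\<close>

primrec word_weight :: "'a::comm_ring_1 \<Rightarrow> nat list \<Rightarrow> 'a" where
  "word_weight t [] = 1"
| "word_weight t (r # v) = (of_nat r - t * of_nat (count_list v r)) * word_weight t v"

text \<open>Read from the right, the occurrences of a letter \<open>r\<close> meet the counts 0, 1,
  2, ..., so their factors are r, r - t, r - 2t, ... in any word.\<close>

lemma word_weight_prod:
  assumes "set v \<subseteq> {0..<n}"
  shows "word_weight t v = (\<Prod>r\<in>{0..<n}. step_falling t (count_list v r) r)"
  using assms
proof (induction v)
  case Nil
  then show ?case by (simp add: step_falling_def)
next
  case (Cons r v)
  then have r: "r \<in> {0..<n}" by simp
  have "(\<Prod>x\<in>{0..<n} - {r}. step_falling t (count_list (r # v) x) x) =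
      (\<Prod>x\<in>{0..<n} - {r}. step_falling t (count_list v x) x)"
    by (intro prod.cong) auto
  then show ?case
    using Cons unfolding prod.remove[OF finite_atLeastLessThan r]
    by (simp add: step_falling_Suc mult.assoc)
qed

text \<open>On a cover \<open>j - i\<close> equals 1 + b + d, so these are the weights 1 + (1+t) b +
  (1-t) d. Written with \<open>j - i\<close> they split into a linear form and a multiple of the
  derivation.\<close>

definition diag_op :: "nat \<Rightarrow> 'a \<Rightarrow> ((nat \<Rightarrow> nat) \<Rightarrow> 'a) \<Rightarrow> (nat \<Rightarrow> nat) \<Rightarrow> 'a::comm_ring_1" where
  "diag_op n t = cover_op n (\<lambda>w i j. of_nat (j - i)
     + t * (of_nat (above_between w i j) - of_nat (below_between w i j)))"

lemma cover_op_weight_cong: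
  assumes "\<And>i j. (i, j) \<in> position_pairs n \<Longrightarrow> g w i j = h w i j"
  shows "cover_op n g F w = cover_op n h F w"
  unfolding cover_op_def using assms by (intro sum.cong) auto

lemma cover_op_weight_zero: "cover_op n (\<lambda>w i j. 0) F w = 0"
  unfolding cover_op_def by (intro sum.neutral) auto

lemma cover_op_weight_sum:
  "finite A \<Longrightarrow> cover_op n (\<lambda>w i j. \<Sum>r\<in>A. f r * g r w i j) F w = (\<Sum>r\<in>A. f r * cover_op n (g r) F w)"
  by (induction rule: finite_induct)
     (simp_all add: cover_op_weight_zero cover_op_weight_add cover_op_weight_scale)

lemma cover_op_sum:
  "finite A \<Longrightarrow> cover_op n g (\<lambda>w. \<Sum>v\<in>A. c v * F v w) w = (\<Sum>v\<in>A. c v * cover_op n g (F v) w)"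
proof (induction rule: finite_induct)
  case empty
  show ?case using cover_op_scale[of n g 0 "\<lambda>w. 0"] by simp
qed (simp_all add: cover_op_add cover_op_scale)

text \<open>The linear form has coefficient n - m at x_m, so a cover at positions
  \<open>i < j\<close> receives (n - i) - (n - j) = j - i.\<close>

lemma diag_op_var_op:
  "diag_op n t F w = (\<Sum>r\<in>{0..<n}. of_nat r * var_op n (n - r) F w) - t * deriv_op n F w"
proof -
  let ?g = "\<lambda>r w i j. of_bool (i = n - r) - of_bool (j = n - r) :: 'a"
  let ?h = "\<lambda>w i j. of_nat (below_between w i j) - of_nat (above_between w i j) :: 'a"
  have s: "(\<Sum>r\<in>{0..<n}. of_nat r * of_bool (i = n - r)) = (of_nat (n - i) :: 'a)"
    if "1 \<le> i" "i \<le> n" for i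
  proof -
    have "(\<Sum>r\<in>{0..<n}. of_nat r * of_bool (i = n - r)) = (\<Sum>r\<in>{0..<n}. if r = n - i then of_nat r else 0 :: 'a)"
      using that by (intro sum.cong) auto
    then show ?thesis using that by simp
  qed
  have "diag_op n t F w =
      cover_op n (\<lambda>w i j. (\<Sum>r\<in>{0..<n}. of_nat r * ?g r w i j) + (- t) * ?h w i j) F w"
    unfolding diag_op_def
  proof (rule cover_op_weight_cong)
    fix i j assume "(i, j) \<in> position_pairs n"
    then have ij: "1 \<le> i" "i < j" "j \<le> n" by (auto simp: position_pairs_def)
    then have "(\<Sum>r\<in>{0..<n}. of_nat r * ?g r w i j) = of_nat (n - i) - of_nat (n - j)"
      using s[of i] s[of j] by (simp add: right_diff_distrib sum_subtractf)
    also have "\<dots> = of_nat (j - i)" using ij by simp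
    finally show "of_nat (j - i) + t * (of_nat (above_between w i j) - of_nat (below_between w i j)) =
      (\<Sum>r\<in>{0..<n}. of_nat r * ?g r w i j) + (- t) * ?h w i j"
      by (simp add: algebra_simps)
  qed
  also have "\<dots> = (\<Sum>r\<in>{0..<n}. of_nat r * var_op n (n - r) F w) + (- t) * deriv_op n F w"
    unfolding cover_op_weight_add cover_op_weight_scale var_op_def deriv_op_def
    by (simp only: cover_op_weight_sum[OF finite_atLeastLessThan])
  finally show ?thesis by simp
qed

lemma sum_list_count:
  assumes "finite X" "set v \<subseteq> X"
  shows "(\<Sum>r\<leftarrow>v. f r) = (\<Sum>r\<in>X. of_nat (count_list v r) * (f r :: 'a::comm_ring_1))"
  using assms(2)
proof (induction v)
  case (Cons r v)
  then have r: "r \<in> X" by simp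
  have "(\<Sum>x\<in>X - {r}. of_nat (count_list (r # v) x) * f x) = (\<Sum>x\<in>X - {r}. of_nat (count_list v x) * f x)"
    by (intro sum.cong) auto
  then show ?case
    using Cons unfolding sum.remove[OF assms(1) r] by (simp add: algebra_simps)
qed simp

text \<open>The derivation multiplies a monomial by each letter as often as it occurs, so prepending
  \<open>r\<close> is charged \<open>t\<close> times its present count.\<close>

lemma diag_op_word_op:
  assumes "inj w" "set v \<subseteq> {0..<n}"
  shows "diag_op n t (word_op n (map (\<lambda>r. n - r) v)) w =
    (\<Sum>r\<in>{0..<n}. (of_nat r - t * of_nat (count_list v r)) * word_op n (map (\<lambda>r. n - r) (r # v)) w)"
proof -
  have "deriv_op n (word_op n (map (\<lambda>r. n - r) v)) w =
      (\<Sum>r\<leftarrow>v. word_op n (map (\<lambda>r. n - r) (r # v)) w :: 'a)"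
    unfolding deriv_op_word_op[OF assms(1)] by (simp add: comp_def)
  also have "\<dots> = (\<Sum>r\<in>{0..<n}. of_nat (count_list v r) * word_op n (map (\<lambda>r. n - r) (r # v)) w)"
    by (rule sum_list_count[OF finite_atLeastLessThan assms(2)])
  finally show ?thesis
    unfolding diag_op_var_op by (simp add: sum_distrib_left sum_subtractf[symmetric] algebra_simps)
qed

section \<open>Words with distinct letter counts\<close>

definition words :: "nat \<Rightarrow> nat \<Rightarrow> nat list set" where
  "words n N = {v. set v \<subseteq> {0..<n} \<and> length v = N}"

lemma finite_words: "finite (words n N)"
  unfolding words_def by (rule finite_lists_length_eq) simp

lemma diag_op_power:
  assumes "inj w"
  shows "(diag_op n t ^^ N) unit_fun w =
    (\<Sum>v\<in>words n N. word_weight t v * word_op n (map (\<lambda>r. n - r) v) w)"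
  using assms
proof (induction N arbitrary: w)
  case 0
  have "words n 0 = {[]}" by (auto simp: words_def)
  then show ?case by simp
next
  case (Suc N)
  let ?W = "\<lambda>v. word_op n (map (\<lambda>r. n - r) v) :: _ \<Rightarrow> 'a"
  have "(diag_op n t ^^ Suc N) unit_fun w = diag_op n t (\<lambda>w. \<Sum>v\<in>words n N. word_weight t v * ?W v w) w"
    unfolding funpow.simps comp_apply diag_op_def
    by (rule cover_op_cong[OF _ Suc.prems]) (rule Suc.IH[unfolded diag_op_def])
  also have "\<dots> = (\<Sum>v\<in>words n N. word_weight t v * diag_op n t (?W v) w)"
    unfolding diag_op_def by (rule cover_op_sum[OF finite_words])
  also have "\<dots> = (\<Sum>v\<in>words n N. \<Sum>r\<in>{0..<n}. word_weight t (r # v) * ?W (r # v) w)"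
  proof (rule sum.cong[OF refl])
    fix v assume "v \<in> words n N"
    then have "set v \<subseteq> {0..<n}" by (simp add: words_def)
    show "word_weight t v * diag_op n t (?W v) w = (\<Sum>r\<in>{0..<n}. word_weight t (r # v) * ?W (r # v) w)"
      unfolding diag_op_word_op[OF Suc.prems \<open>set v \<subseteq> {0..<n}\<close>] word_weight.simps sum_distrib_left
      by (rule sum.cong[OF refl]) (simp only: mult.assoc mult.left_commute[of "word_weight t v"])
  qed
  also have "\<dots> = (\<Sum>v\<in>words n (Suc N). word_weight t v * ?W v w)"
    unfolding sum.cartesian_product
    by (rule sum.reindex_bij_witness[where i = "\<lambda>v. (tl v, hd v)" and j = "\<lambda>(v, r). r # v"])
       (auto simp: words_def length_Suc_conv)
  finally show ?case .
qed

text \<open>Applied to the letter counts of a word of length \<open>n choose 2\<close>: if they are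
  distinct, they are 0, ..., n - 1 in some order.\<close>

lemma sum_finite_set_ge:
  "finite A \<Longrightarrow> card A = n \<Longrightarrow> \<Sum>{0..<n} \<le> (\<Sum>A :: nat) \<and> (\<Sum>A = \<Sum>{0..<n} \<longrightarrow> A = {0..<n})"
proof (induction n arbitrary: A)
  case (Suc n)
  have "A \<noteq> {}" using Suc.prems(2) by auto
  define m where "m = Max A"
  have m: "m \<in> A" using Suc.prems \<open>A \<noteq> {}\<close> by (simp add: m_def)
  have "A \<subseteq> {0..m}" using Suc.prems by (auto simp: m_def)
  then have "n \<le> m" using card_mono[of "{0..m}" A] Suc.prems by simp
  have "card (A - {m}) = n" using m Suc.prems by simp
  then have IH: "\<Sum>{0..<n} \<le> \<Sum>(A - {m})" "\<Sum>(A - {m}) = \<Sum>{0..<n} \<longrightarrow> A - {m} = {0..<n}"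
    using Suc.IH[of "A - {m}"] Suc.prems by auto
  have "\<Sum>A = m + \<Sum>(A - {m})" using m Suc.prems by (simp add: sum.remove)
  moreover have s: "\<Sum>{0..<Suc n} = \<Sum>{0..<n} + n" by simp
  ultimately have ge: "\<Sum>{0..<Suc n} \<le> \<Sum>A" and
    eq: "\<Sum>A = \<Sum>{0..<Suc n} \<Longrightarrow> m = n \<and> \<Sum>(A - {m}) = \<Sum>{0..<n}"
    using IH(1) \<open>n \<le> m\<close> by linarith+
  have "A = {0..<Suc n}" if "\<Sum>A = \<Sum>{0..<Suc n}"
  proof -
    have "A = insert m (A - {m})" using m by auto
    also have "\<dots> = insert n {0..<n}" using eq[OF that] IH(2) by metis
    finally show ?thesis by (simp only: atLeast0_lessThan_Suc)
  qed
  with ge show ?case by blast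
qed auto

lemma sum_upto_choose: "\<Sum>{0..<n} = n choose 2"
  by (induction n) (simp_all add: numeral_2_eq_2)

definition staircase_words :: "nat \<Rightarrow> nat list set" where
  "staircase_words n = {u. set u \<subseteq> {0..<n} \<and> (\<forall>r<n. count_list u r = r)}"

lemma staircase_words_eq:
  "staircase_words n = permutations_of_multiset (\<Sum>r\<in>{0..<n}. replicate_mset r r)"
proof -
  have c: "count (\<Sum>r\<in>{0..<n}. replicate_mset r r) x = (if x < n then x else 0)" for x
    by (simp add: count_sum)
  have "u \<in> staircase_words n \<longleftrightarrow> mset u = (\<Sum>r\<in>{0..<n}. replicate_mset r r)" for u
  proof
    assume u: "u \<in> staircase_words n"
    show "mset u = (\<Sum>r\<in>{0..<n}. replicate_mset r r)"
    proof (rule multiset_eqI)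
      fix x
      show "count (mset u) x = count (\<Sum>r\<in>{0..<n}. replicate_mset r r) x"
        unfolding c count_mset using u by (auto simp: staircase_words_def count_list_0_iff)
    qed
  next
    assume "mset u = (\<Sum>r\<in>{0..<n}. replicate_mset r r)"
    then have "count_list u x = (if x < n then x else 0)" for x
      unfolding count_mset[symmetric] by (simp only: c)
    then show "u \<in> staircase_words n"
      by (auto simp: staircase_words_def) (metis count_list_0_iff)
  qed
  then show ?thesis by (auto simp: permutations_of_multiset_def)
qed

text \<open>A multinomial coefficient; its denominator is the product of factorials that the
  determinant restores.\<close>

lemma card_staircase_words: "card (staircase_words n) * (\<Prod>i<n. fact i) = fact (n choose 2)"
proof -
  let ?A = "\<Sum>r\<in>{0..<n}. replicate_mset r r"
  have c: "count ?A x = (if x < n then x else 0)" for x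
    by (simp add: count_sum)
  have s: "set_mset ?A = {1..<n}"
    unfolding set_mset_def c by auto
  have "(\<Prod>x\<in>set_mset ?A. fact (count ?A x)) = (\<Prod>i\<in>{1..<n}. fact i :: nat)"
    unfolding s c by (rule prod.cong) auto
  also have "\<dots> = (\<Prod>i<n. fact i)"
    by (rule prod.mono_neutral_left) (auto simp: Suc_le_eq)
  finally have "(\<Prod>x\<in>set_mset ?A. fact (count ?A x)) = (\<Prod>i<n. fact i :: nat)" .
  moreover have "size ?A = n choose 2"
    by (induction n) (simp_all add: numeral_2_eq_2)
  ultimately show ?thesis
    using card_permutations_of_multiset_aux[of ?A] by (simp add: staircase_words_eq)
qed

lemma staircase_words_subset: "staircase_words n \<subseteq> words n (n choose 2)"
proof
  fix u assume u: "u \<in> staircase_words n"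
  then have "length u = sum (count_list u) {0..<n}"
    by (intro sum_count_set[symmetric]) (auto simp: staircase_words_def)
  also have "\<dots> = \<Sum>{0..<n}"
    using u by (intro sum.cong) (auto simp: staircase_words_def)
  finally show "u \<in> words n (n choose 2)"
    using u by (simp add: words_def staircase_words_def sum_upto_choose)
qed

text \<open>Only words with distinct letter counts contribute. Such a word amounts to a permutation
  \<open>p\<close>, its letter counts, and a staircase word, its letters renamed by
  \<open>p\<close>; its coefficient is the sign of \<open>p\<close>. For a fixed staircase word the
  sum over \<open>p\<close> is the determinant.\<close>

lemma diag_op_top:
  fixes t :: "'a::{idom,ring_char_0}"
  shows "(diag_op n t ^^ (n choose 2)) unit_fun (longest n) = of_nat (fact (n choose 2))"
proof -
  let ?N = "n choose 2"
  let ?I = "{v \<in> words n ?N. inj_on (count_list v) {0..<n}}"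
  let ?P = "{p. p permutes {0..<n}}"
  \<comment> \<open>Letter counts, with the value outside \<open>{0..<n}\<close> changed from 0 to
    the identity as \<open>permutes\<close> demands.\<close>
  let ?pm = "\<lambda>v r. if r < n then count_list v r else r"
  let ?h = "\<lambda>(p, u). of_int (sign p) * (\<Prod>r\<in>{0..<n}. step_falling t (p r) r)"
  have perm: "?pm v permutes {0..<n}" if "v \<in> ?I" for v
  proof -
    have "\<Sum>(count_list v ` {0..<n}) = sum (count_list v) {0..<n}"
      using that by (simp add: sum.reindex)
    also have "\<dots> = \<Sum>{0..<n}"
      using that by (simp add: sum_count_set words_def sum_upto_choose)
    finally have "count_list v ` {0..<n} = {0..<n}"
      using sum_finite_set_ge[of "count_list v ` {0..<n}" n] that by (simp add: card_image)
    then have "bij_betw (count_list v) {0..<n} {0..<n}"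
      using that by (simp add: bij_betw_def)
    then have "bij_betw (?pm v) {0..<n} {0..<n}"
      by (rule bij_betw_cong[THEN iffD1, rotated]) auto
    then show ?thesis by (rule bij_imp_permutes) auto
  qed
  have count_inv: "count_list (map (Hilbert_Choice.inv p) u) r = count_list u (p r)" if "p permutes {0..<n}" for p u r
    using count_list_map_conv[OF permutes_inj[OF permutes_inv[OF that]], of u "p r"]
    by (simp add: permutes_inverses(2)[OF that])
  have stair: "map (?pm v) v \<in> staircase_words n" if v: "v \<in> ?I" for v
  proof -
    note p = perm[OF v]
    have "count_list (map (?pm v) v) r = r" if "r < n" for r
    proof -
      define s where "s = Hilbert_Choice.inv (?pm v) r"
      have "s \<in> {0..<n}" "?pm v s = r"
        using permutes_in_image[OF permutes_inv[OF p], of r] permutes_inverses(1)[OF p, of r] \<open>r < n\<close>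
        by (auto simp: s_def)
      then show ?thesis
        using count_list_map_conv[OF permutes_inj[OF p], of v s] by auto
    qed
    moreover have "set (map (?pm v) v) \<subseteq> {0..<n}"
    proof -
      have "set v \<subseteq> {0..<n}" using v by (simp add: words_def)
      then show ?thesis
        using image_mono[of "set v" "{0..<n}" "?pm v"] permutes_image[OF p] by (simp only: set_map)
    qed
    ultimately show ?thesis by (simp add: staircase_words_def)
  qed
  have pre: "map (Hilbert_Choice.inv p) u \<in> ?I" "?pm (map (Hilbert_Choice.inv p) u) = p"
    if p: "p permutes {0..<n}" and u: "u \<in> staircase_words n" for p u
  proof -
    have c: "count_list (map (Hilbert_Choice.inv p) u) r = p r" if "r < n" for r
      using count_inv[OF p] u permutes_in_image[OF p, of r] that by (auto simp: staircase_words_def)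
    then show "?pm (map (Hilbert_Choice.inv p) u) = p"
      using permutes_not_in[OF p] by (auto simp: fun_eq_iff)
    have "inj_on (count_list (map (Hilbert_Choice.inv p) u)) {0..<n}"
      using inj_on_cong[of "{0..<n}" "count_list (map (Hilbert_Choice.inv p) u)" p] c permutes_inj_on[OF p] by simp
    moreover have "map (Hilbert_Choice.inv p) u \<in> words n ?N"
    proof -
      have "length u = ?N" "set u \<subseteq> {0..<n}"
        using staircase_words_subset u by (auto simp: words_def)
      then show ?thesis
        using image_mono[of "set u" "{0..<n}" "Hilbert_Choice.inv p"] permutes_image[OF permutes_inv[OF p]]
        by (simp only: words_def set_map mem_Collect_eq length_map simp_thms)
    qed
    ultimately show "map (Hilbert_Choice.inv p) u \<in> ?I" by simp
  qed
  have "(diag_op n t ^^ ?N) unit_fun (longest n) = (\<Sum>v\<in>words n ?N. word_weight t v * top_coeff n v)"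
    unfolding top_coeff_def by (rule diag_op_power[OF Sym_inj[OF longest_Sym]])
  also have "\<dots> = (\<Sum>v\<in>?I. word_weight t v * top_coeff n v)"
  proof (rule sum.mono_neutral_right[OF finite_words])
    show "\<forall>v\<in>words n ?N - ?I. word_weight t v * top_coeff n v = 0"
    proof
      fix v assume v: "v \<in> words n ?N - ?I"
      then obtain a b where "a < n" "b < n" "a \<noteq> b" "count_list v a = count_list v b"
        by (auto simp: inj_on_def)
      moreover have "set v \<subseteq> {0..<n}" using v by (simp add: words_def)
      ultimately have "top_coeff n v = (0 :: 'a)" by (intro top_coeff_equal_counts)
      then show "word_weight t v * top_coeff n v = 0" by simp
    qed
  qed auto
  also have "\<dots> = (\<Sum>x\<in>?P \<times> staircase_words n. ?h x)"
  proof (rule sum.reindex_bij_witness[where j = "\<lambda>v. (?pm v, map (?pm v) v)" and i = "\<lambda>(p, u). map (Hilbert_Choice.inv p) u"])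
    fix v assume v: "v \<in> ?I"
    note p = perm[OF v]
    show "(case (?pm v, map (?pm v) v) of (p, u) \<Rightarrow> map (Hilbert_Choice.inv p) u) = v"
      by (simp add: comp_def permutes_inverses(2)[OF p])
    show "(?pm v, map (?pm v) v) \<in> ?P \<times> staircase_words n"
      using p stair[OF v] by simp
    have vs: "set v \<subseteq> {0..<n}" using v by (simp add: words_def)
    have "of_int (sign (?pm v)) * top_coeff n v = (1 :: 'a)"
      unfolding top_coeff_permutes[OF p vs, symmetric]
      by (rule top_coeff_staircase) (use stair[OF v] in \<open>simp_all only: staircase_words_def mem_Collect_eq\<close>)
    \<comment> \<open>A sign is its own inverse, so it moves to the other side.\<close>
    then have "of_int (sign (?pm v)) * (of_int (sign (?pm v)) * top_coeff n v) = (of_int (sign (?pm v)) :: 'a)"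
      by simp
    then have "top_coeff n v = (of_int (sign (?pm v)) :: 'a)"
      by (simp flip: mult.assoc of_int_mult)
    then show "?h (?pm v, map (?pm v) v) = word_weight t v * top_coeff n v"
      unfolding word_weight_prod[OF vs] by (simp add: mult.commute)
  next
    fix x assume "x \<in> ?P \<times> staircase_words n"
    then obtain p u where x: "x = (p, u)" "p permutes {0..<n}" "u \<in> staircase_words n" by auto
    show "(\<lambda>v. (?pm v, map (?pm v) v)) (case x of (p, u) \<Rightarrow> map (Hilbert_Choice.inv p) u) = x"
      unfolding x(1) prod.case pre(2)[OF x(2,3)] map_map permutes_inv_o(1)[OF x(2)] list.map_id ..
    show "(case x of (p, u) \<Rightarrow> map (Hilbert_Choice.inv p) u) \<in> ?I"
      using pre[OF x(2,3)] x by simp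
  qed
  also have "\<dots> = of_nat (card (staircase_words n)) *
      (\<Sum>p\<in>?P. of_int (sign p) * (\<Prod>r\<in>{0..<n}. step_falling t (p r) r))"
    by (simp add: sum.cartesian_product[symmetric] sum_distrib_left)
  also have "(\<Sum>p\<in>?P. of_int (sign p) * (\<Prod>r\<in>{0..<n}. step_falling t (p r) r)) =
      det (mat n n (\<lambda>(i, j). step_falling t j i))"
    by (subst det_def'[of _ n]) (auto intro!: sum.cong prod.cong simp: permutes_in_image)
  also have "\<dots> = (\<Prod>i<n. of_nat (fact i))"
    by (rule det_step_falling)
  also have "of_nat (card (staircase_words n)) * (\<Prod>i<n. of_nat (fact i)) = (of_nat (fact ?N) :: 'a)"
    unfolding card_staircase_words[of n, symmetric] by (simp only: of_nat_mult of_nat_prod)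
  finally show ?thesis .
qed

section \<open>Lengths, covers and chains\<close>

abbreviation word_product :: "nat list \<Rightarrow> nat \<Rightarrow> nat" where
  "word_product is \<equiv> foldr (\<circ>) (map (\<lambda>i. transpose i (i + 1)) is) id"

lemma word_product_snoc: "word_product (is @ [i]) = word_product is \<circ> transpose i (i + 1)"
proof -
  have *: "foldr (\<circ>) fs g = foldr (\<circ>) fs id \<circ> g" for fs :: "(nat \<Rightarrow> nat) list" and g :: "nat \<Rightarrow> nat"
    by (induction fs) (simp_all add: comp_assoc)
  show ?thesis
    unfolding map_append foldr_append by (simp, rule *)
qed

lemma inversions_word_product:
  "set is \<subseteq> {1..<n} \<Longrightarrow> word_product is \<in> Sym n \<and> inversions n (word_product is) \<le> length is"
proof (induction "is" rule: rev_induct)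
  case Nil
  have e: "word_product [] = id" by (simp add: fun_eq_iff)
  show ?case
    unfolding e using inversions_0_iff[OF id_Sym, of n] by (simp add: id_Sym del: id_apply)
next
  case (snoc i "is")
  let ?u = "word_product is"
  have i: "1 \<le> i" "Suc i \<le> n" using snoc.prems by auto
  have "set is \<subseteq> {1..<n}" using snoc.prems by simp
  note u = conjunct1[OF snoc.IH[OF this]] conjunct2[OF snoc.IH[OF this]]
  have "inversions n (?u \<circ> transpose i (Suc i)) \<le> Suc (inversions n ?u)"
  proof (cases "?u i < ?u (Suc i)")
    case True
    then show ?thesis using inversions_swap[OF i] by simp
  next
    case False
    then have "?u (Suc i) < ?u i"
      using Sym_inj[OF u(1)] by (metis inj_eq linorder_neqE_nat n_not_Suc_n)
    then show ?thesis using inversions_swap_descent[OF i, of ?u] by simp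
  qed
  moreover have "?u \<circ> transpose i (Suc i) \<in> Sym n"
    by (rule Sym_transpose[OF u(1)]) (use i in auto)
  ultimately show ?case
    unfolding word_product_snoc using u(2) by (simp only: Suc_eq_plus1 length_append list.size simp_thms)
qed

lemma word_product_exists:
  assumes "w \<in> Sym n"
  shows "\<exists>is. length is = inversions n w \<and> set is \<subseteq> {1..<n} \<and> w = word_product is"
  using assms
proof (induction "inversions n w" arbitrary: w)
  case 0
  then have "w = id" using inversions_0_iff by simp
  then show ?case using 0 by (intro exI[of _ "[]"]) simp
next
  case (Suc r)
  have "\<exists>k. 1 \<le> k \<and> Suc k \<le> n \<and> w (Suc k) < w k"
  proof (rule ccontr)
    assume "\<not> ?thesis"
    then have "w k < w (Suc k)" if "1 \<le> k" "Suc k \<le> n" for k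
      using that Sym_inj[OF Suc.prems] by (metis inj_eq linorder_neqE_nat n_not_Suc_n)
    then have "w = id"
      using mono_from_steps[of n w] by (intro sorted_Sym_id[OF Suc.prems]) auto
    then show False using Suc.hyps(2) inversions_0_iff[OF Suc.prems] by simp
  qed
  then obtain k where k: "1 \<le> k" "Suc k \<le> n" "w (Suc k) < w k" by blast
  let ?u = "w \<circ> transpose k (Suc k)"
  have "?u \<in> Sym n" using Sym_transpose[OF Suc.prems] k by simp
  moreover have "r = inversions n ?u" using inversions_swap_descent[OF k] Suc.hyps(2) by simp
  ultimately obtain "is" where i: "length is = r" "set is \<subseteq> {1..<n}" "?u = word_product is"
    using Suc.hyps(1)[of ?u] by metis
  have "w = ?u \<circ> transpose k (k + 1)" by (simp add: comp_assoc)
  then have "w = word_product (is @ [k])" unfolding word_product_snoc i(3)[symmetric] .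
  then show ?case
    using i k Suc.hyps(2) by (intro exI[of _ "is @ [k]"]) auto
qed

lemma coxeter_length_eq:
  assumes "w \<in> Sym n"
  shows "coxeter_length n w = inversions n w"
  unfolding coxeter_length_def
proof (rule Least_equality)
  show "\<exists>is. length is = inversions n w \<and> set is \<subseteq> {1..<n} \<and> w = word_product is"
    by (rule word_product_exists[OF assms])
next
  fix k assume "\<exists>is. length is = k \<and> set is \<subseteq> {1..<n} \<and> w = word_product is"
  then show "inversions n w \<le> k" using inversions_word_product by blast
qed

text \<open>Besides the exchanged pair, every position in between with an intermediate value
  accounts for two inversions. Induction on \<open>j\<close> conjugates by the last adjacent
  transposition: both adjacent steps lower the count if the value at \<open>k\<close> is
  intermediate, and their effects cancel otherwise.\<close>

lemma inversions_transpose: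
  assumes "inj w" "1 \<le> i" "i < j" "j \<le> n" "w j < w i"
  shows "inversions n w = Suc (inversions n (w \<circ> transpose i j) +
    2 * card {m. i < m \<and> m < j \<and> w j < w m \<and> w m < w i})"
  using assms(1,3-5)
proof (induction "j" arbitrary: w)
  case (Suc k)
  show ?case
  proof (cases "i = k")
    case True
    have e: "{m. k < m \<and> m < Suc k \<and> P m} = {}" for P by auto
    show ?thesis
      using True inversions_swap_descent[of k n w] assms(2) Suc.prems by (simp add: e del: o_apply)
  next
    case False
    then have ik: "i < k" and k: "1 \<le> k" "Suc k \<le> n" using Suc.prems assms(2) by auto
    let ?s = "transpose k (Suc k)"
    let ?u = "w \<circ> ?s"
    let ?x = "?u \<circ> transpose i k"
    let ?C = "\<lambda>m. w (Suc k) < w m \<and> w m < w i"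
    have uk: "?u k = w (Suc k)" and uSk: "?u (Suc k) = w k" by simp_all
    have um: "?u m = w m" if "m < k" for m using that by simp
    have xs: "?x \<circ> ?s = w \<circ> transpose i (Suc k)"
      using transpose_comp_triple[of "Suc k" i k] ik by (simp add: comp_assoc transpose_commute)
    have xk: "?x k = w i" "?x (Suc k) = w k" using ik by simp_all
    have "inversions n ?u = Suc (inversions n ?x +
        2 * card {m. i < m \<and> m < k \<and> ?u k < ?u m \<and> ?u m < ?u i})"
      by (rule Suc.IH[OF inj_comp_transpose[OF Suc.prems(1)] ik]) (use Suc.prems ik in auto)
    also have "{m. i < m \<and> m < k \<and> ?u k < ?u m \<and> ?u m < ?u i} = {m. i < m \<and> m < k \<and> ?C m}"
      unfolding uk using um ik by auto
    finally have IH: "inversions n ?u = Suc (inversions n ?x + 2 * card {m. i < m \<and> m < k \<and> ?C m})" .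
    have C: "card {m. i < m \<and> m < Suc k \<and> ?C m} = of_bool (?C k) + card {m. i < m \<and> m < k \<and> ?C m}"
      by (rule card_interval_right[OF ik])
    have "w k \<noteq> w i" "w k \<noteq> w (Suc k)"
      using Suc.prems(1) ik by (simp_all add: inj_eq)
    then consider "?C k" | "w k < w (Suc k)" | "w i < w k" by linarith
    then show ?thesis
    proof cases
      case 1
      have "Suc (inversions n ?u) = inversions n w"
        by (rule inversions_swap_descent[OF k]) (use 1 Suc.prems(4) in simp)
      moreover have "Suc (inversions n (w \<circ> transpose i (Suc k))) = inversions n ?x"
        using inversions_swap_descent[OF k, of ?x] 1 Suc.prems(4) by (simp only: xk xs)
      moreover have "card {m. i < m \<and> m < Suc k \<and> ?C m} = Suc (card {m. i < m \<and> m < k \<and> ?C m})"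
        using C 1 by simp
      ultimately show ?thesis using IH by linarith
    next
      case 2
      have "inversions n ?u = Suc (inversions n w)"
        by (rule inversions_swap[OF k]) (use 2 Suc.prems(4) in simp)
      moreover have "Suc (inversions n (w \<circ> transpose i (Suc k))) = inversions n ?x"
        using inversions_swap_descent[OF k, of ?x] 2 Suc.prems(4) by (simp only: xk xs)
      moreover have "card {m. i < m \<and> m < Suc k \<and> ?C m} = card {m. i < m \<and> m < k \<and> ?C m}"
        using C 2 by simp
      ultimately show ?thesis using IH by linarith
    next
      case 3
      have "Suc (inversions n ?u) = inversions n w"
        by (rule inversions_swap_descent[OF k]) (use 3 Suc.prems(4) in simp)
      moreover have "inversions n (w \<circ> transpose i (Suc k)) = Suc (inversions n ?x)"
        using inversions_swap[OF k, of ?x] 3 Suc.prems(4) by (simp only: xk xs)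
      moreover have "card {m. i < m \<and> m < Suc k \<and> ?C m} = card {m. i < m \<and> m < k \<and> ?C m}"
        using C 3 by simp
      ultimately show ?thesis using IH by linarith
    qed
  qed
qed simp

lemma down_cover_inversions:
  assumes "w \<in> Sym n" "(i, j) \<in> position_pairs n" "down_cover w i j"
  shows "inversions n w = Suc (inversions n (w \<circ> transpose i j))"
proof -
  have "{m. i < m \<and> m < j \<and> w j < w m \<and> w m < w i} = {}"
    using assms(3) unfolding down_cover_def by (auto dest: less_asym)
  then show ?thesis
    using inversions_transpose[of w i j n] assms Sym_inj by (simp add: position_pairs_def down_cover_def)
qed

text \<open>Replaces the length condition by a condition on the upper permutation, over which the
  operators sum. The previous count shows that length drops by one exactly when no intermediate
  value lies in between.\<close>

lemma Cov_iff:
  "(v, w) \<in> Cov n \<longleftrightarrow> w \<in> Sym n \<and>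
    (\<exists>i j. (i, j) \<in> position_pairs n \<and> down_cover w i j \<and> v = w \<circ> transpose i j)"
proof
  assume "(v, w) \<in> Cov n"
  then obtain i j where vw: "v \<in> Sym n" "w \<in> Sym n" "1 \<le> i" "i < j" "j \<le> n" "w = v \<circ> transpose i j"
    and len: "inversions n w = Suc (inversions n v)"
    by (auto simp: Cov_def coxeter_length_eq)
  have v: "v = w \<circ> transpose i j" using vw(6) by (simp add: comp_assoc)
  have wij: "w i = v j" "w j = v i" using vw(6) by simp_all
  have inj: "inj v" "inj w" using Sym_inj vw(1,2) by auto
  have "v i < v j"
  proof (rule ccontr)
    assume "\<not> v i < v j"
    then have "v j < v i" using vw(4) inj(1) by (metis inj_eq linorder_neqE_nat less_irrefl)
    then have "inversions n v \<ge> Suc (inversions n w)"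
      using inversions_transpose[OF inj(1) vw(3-5)] vw(6) by simp
    then show False using len by simp
  qed
  then have lt: "w j < w i" by (simp add: wij)
  have "card {m. i < m \<and> m < j \<and> w j < w m \<and> w m < w i} = 0"
    using inversions_transpose[OF inj(2) vw(3-5) lt] len v by simp
  then have e: "{m. i < m \<and> m < j \<and> w j < w m \<and> w m < w i} = {}"
    by simp
  have "w m < w j \<or> w i < w m" if "i < m" "m < j" for m
  proof -
    have "\<not> (w j < w m \<and> w m < w i)" using e that by blast
    moreover have "w m \<noteq> w i" "w m \<noteq> w j" using inj(2) that by (auto simp: inj_eq)
    ultimately show ?thesis by linarith
  qed
  then have "down_cover w i j" using vw(4) lt by (simp add: down_cover_def)
  then show "w \<in> Sym n \<and> (\<exists>i j. (i, j) \<in> position_pairs n \<and> down_cover w i j \<and> v = w \<circ> transpose i j)"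
    using vw(2-5) v by (auto simp: position_pairs_def)
next
  assume "w \<in> Sym n \<and> (\<exists>i j. (i, j) \<in> position_pairs n \<and> down_cover w i j \<and> v = w \<circ> transpose i j)"
  then obtain i j where w: "w \<in> Sym n" and ij: "(i, j) \<in> position_pairs n" "down_cover w i j"
    and v: "v = w \<circ> transpose i j" by auto
  have ij': "1 \<le> i" "i < j" "j \<le> n" using ij(1) by (auto simp: position_pairs_def)
  have vS: "v \<in> Sym n" unfolding v using ij' by (intro Sym_transpose[OF w]) auto
  moreover have "w = v \<circ> transpose i j" by (simp add: v comp_assoc)
  moreover have "coxeter_length n w = coxeter_length n v + 1"
    using down_cover_inversions[OF w ij] vS w by (simp add: coxeter_length_eq v)
  ultimately show "(v, w) \<in> Cov n"
    unfolding Cov_def using w ij' by blast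
qed

lemma Cov_inversions: "(v, w) \<in> Cov n \<Longrightarrow> inversions n w = Suc (inversions n v)"
  unfolding Cov_iff using down_cover_inversions by blast

lemma Cov_Sym: "(v, w) \<in> Cov n \<Longrightarrow> v \<in> Sym n \<and> w \<in> Sym n"
  by (auto simp: Cov_def)

section \<open>Recursion of the chain sum along the last cover\<close>

lemma finite_Sym: "finite (Sym n)"
  unfolding Sym_def by (rule finite_permutations) simp

lemma finite_lower_covers: "finite {u. (u, w) \<in> Cov n}"
  by (rule finite_subset[OF _ finite_Sym[of n]]) (auto dest: Cov_Sym)

lemma saturated_chains_last:
  assumes "v \<in> Sym n"
  shows "saturated_chains n v w = (if v = w then {[v]} else {}) \<union>
    (\<Union>u\<in>{u. (u, w) \<in> Cov n}. (\<lambda>us. us @ [w]) ` saturated_chains n v u)"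
    (is "?L = ?R")
proof (intro equalityI subsetI)
  fix us assume us: "us \<in> ?L"
  then have "us \<noteq> []" by (simp add: saturated_chains_def)
  moreover have "last us = w" using us by (simp add: saturated_chains_def)
  ultimately obtain xs where xs: "us = xs @ [w]"
    using append_butlast_last_id by metis
  show "us \<in> ?R"
  proof (cases "xs = []")
    case True
    then show ?thesis using us xs by (simp add: saturated_chains_def)
  next
    case False
    then have "(last xs, w) \<in> Cov n" "xs \<in> saturated_chains n v (last xs)"
      using us unfolding xs saturated_chains_def by (auto simp: successively_append_iff)
    then show ?thesis using xs by blast
  qed
next
  fix us assume "us \<in> ?R"
  then show "us \<in> ?L"
    using assms
    by (auto simp: saturated_chains_def successively_append_iff split: if_splits dest: Cov_Sym)
qed

lemma finite_saturated_chains: "v \<in> Sym n \<Longrightarrow> finite (saturated_chains n v w)"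
proof (induction "inversions n w" arbitrary: w rule: less_induct)
  case less
  have "finite (saturated_chains n v u)" if "(u, w) \<in> Cov n" for u
    using less Cov_inversions[OF that] by simp
  then show ?case
    using finite_lower_covers[of w n] by (subst saturated_chains_last[OF less.prems]) auto
qed

lemma chain_weight_snoc:
  "us \<noteq> [] \<Longrightarrow> chain_weight wt (us @ [w]) = chain_weight wt us * wt (last us, w)"
proof -
  assume "us \<noteq> []"
  then have "zip (us @ [w]) (tl (us @ [w])) = zip us (tl us) @ [(last us, w)]"
    by (induction us rule: induct_list012) auto
  then show ?thesis by (simp add: chain_weight_def)
qed

lemma weighted_chain_sum_last:
  assumes "v \<in> Sym n"
  shows "weighted_chain_sum n wt v w = of_bool (v = w) +
    (\<Sum>u | (u, w) \<in> Cov n. weighted_chain_sum n wt v u * wt (u, w))"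
proof -
  let ?C = "{u. (u, w) \<in> Cov n}"
  let ?S = "\<lambda>u. (\<lambda>us. us @ [w]) ` saturated_chains n v u"
  have disj: "(if v = w then {[v]} else {}) \<inter> (\<Union>u\<in>?C. ?S u) = {}"
    by (auto simp: saturated_chains_def)
  have "weighted_chain_sum n wt v w =
      sum (chain_weight wt) (if v = w then {[v]} else {}) + sum (chain_weight wt) (\<Union>u\<in>?C. ?S u)"
    unfolding weighted_chain_sum_def saturated_chains_last[OF assms, of w]
    using finite_lower_covers[of w n] finite_saturated_chains[OF assms]
    by (intro sum.union_disjoint[OF _ _ disj]) auto
  also have "sum (chain_weight wt) (if v = w then {[v]} else {}) = of_bool (v = w)"
    by (simp add: chain_weight_def)
  also have "sum (chain_weight wt) (\<Union>u\<in>?C. ?S u) = (\<Sum>u\<in>?C. sum (chain_weight wt) (?S u))"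
    using finite_lower_covers[of w n] finite_saturated_chains[OF assms]
    by (intro sum.UNION_disjoint) (auto simp: saturated_chains_def)
  also have "\<dots> = (\<Sum>u\<in>?C. weighted_chain_sum n wt v u * wt (u, w))"
  proof (rule sum.cong[OF refl])
    fix u
    have "sum (chain_weight wt) (?S u) = (\<Sum>us\<in>saturated_chains n v u. chain_weight wt (us @ [w]))"
      by (subst sum.reindex) (auto simp: inj_on_def)
    also have "\<dots> = (\<Sum>us\<in>saturated_chains n v u. chain_weight wt us * wt (u, w))"
      by (rule sum.cong) (auto simp: saturated_chains_def chain_weight_snoc)
    finally show "sum (chain_weight wt) (?S u) = weighted_chain_sum n wt v u * wt (u, w)"
      by (simp add: weighted_chain_sum_def sum_distrib_right)
  qed
  finally show ?thesis .
qed

lemma transpose_comp_inj: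
  fixes i j i' j' :: nat
  assumes "inj w" "i < j" "i' < j'" "w \<circ> transpose i j = w \<circ> transpose i' j'"
  shows "i = i' \<and> j = j'"
proof -
  have "transpose i j k = transpose i' j' k" for k
    using fun_cong[OF assms(4), of k] assms(1) by (simp add: inj_eq)
  from this[of i] this[of j] show ?thesis
    using assms(2,3) by (auto simp: transpose_def split: if_splits)
qed

lemma sum_lower_covers:
  fixes F :: "(nat \<Rightarrow> nat) \<Rightarrow> 'a::comm_ring_1"
  assumes "w \<in> Sym n"
  shows "(\<Sum>u | (u, w) \<in> Cov n. F u * wt (u, w)) = cover_op n (\<lambda>w i j. wt (w \<circ> transpose i j, w)) F w"
proof -
  let ?D = "{p \<in> position_pairs n. down_cover w (fst p) (snd p)}"
  let ?f = "\<lambda>p. w \<circ> transpose (fst p) (snd p)"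
  have "(u, w) \<in> Cov n \<longleftrightarrow> (\<exists>p\<in>?D. u = ?f p)" for u
    using assms by (simp add: Cov_iff Bex_def del: o_apply)
  then have "{u. (u, w) \<in> Cov n} = ?f ` ?D" by (simp only: image_def)
  moreover have "inj_on ?f ?D"
  proof (rule inj_onI)
    fix p q assume "p \<in> ?D" "q \<in> ?D" "?f p = ?f q"
    then show "p = q"
      using transpose_comp_inj[OF Sym_inj[OF assms], of "fst p" "snd p" "fst q" "snd q"]
      by (simp add: position_pairs_def prod_eq_iff case_prod_unfold del: o_apply)
  qed
  ultimately have "(\<Sum>u | (u, w) \<in> Cov n. F u * wt (u, w)) = (\<Sum>p\<in>?D. F (?f p) * wt (?f p, w))"
    by (simp add: sum.reindex)
  also have "\<dots> = (\<Sum>p\<in>position_pairs n. if down_cover w (fst p) (snd p) then F (?f p) * wt (?f p, w) else 0)"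
    by (simp add: sum.inter_filter)
  also have "\<dots> = cover_op n (\<lambda>w i j. wt (w \<circ> transpose i j, w)) F w"
    unfolding cover_op_def by (intro sum.cong) (auto simp: mult.commute)
  finally show ?thesis .
qed

section \<open>The diagonal weights as an operator\<close>

lemma b_stat_transpose:
  assumes "(i, j) \<in> position_pairs n"
  shows "b_stat n (w \<circ> transpose i j) i j = above_between w i j"
proof -
  have "{k \<in> {1..n}. i < k \<and> k < j \<and> (w \<circ> transpose i j) k > (w \<circ> transpose i j) j} =
    {k. i < k \<and> k < j \<and> w i < w k}"
    using assms by (auto simp: position_pairs_def)
  then show ?thesis by (simp add: b_stat_def above_between_def)
qed

lemma d_stat_transpose:
  assumes "(i, j) \<in> position_pairs n"
  shows "d_stat n (w \<circ> transpose i j) i j = below_between w i j"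
proof -
  have "{k \<in> {1..n}. i < k \<and> k < j \<and> (w \<circ> transpose i j) k < (w \<circ> transpose i j) i} =
    {k. i < k \<and> k < j \<and> w k < w j}"
    using assms by (auto simp: position_pairs_def)
  then show ?thesis by (simp add: d_stat_def below_between_def)
qed

text \<open>In a cover each position in between has a value above both exchanged values or below
  both.\<close>

lemma between_sum:
  assumes "down_cover w i j"
  shows "j - i = Suc (above_between w i j + below_between w i j)"
proof -
  have "w m < w j \<Longrightarrow> \<not> w i < w m" for m
    using assms by (auto simp: down_cover_def)
  then have "card {m. i < m \<and> m < j \<and> w i < w m} + card {m. i < m \<and> m < j \<and> w m < w j} =
      card ({m. i < m \<and> m < j \<and> w i < w m} \<union> {m. i < m \<and> m < j \<and> w m < w j})"
    by (intro card_Un_disjoint[symmetric]) auto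
  also have "{m. i < m \<and> m < j \<and> w i < w m} \<union> {m. i < m \<and> m < j \<and> w m < w j} = {i<..<j}"
    using assms by (auto simp: down_cover_def)
  finally show ?thesis
    using assms by (simp add: above_between_def below_between_def down_cover_def Suc_diff_Suc)
qed

text \<open>The generic weight with its variables already replaced, over any commutative ring, so
  that symmetries can permute the four parameters.\<close>

definition stat_weight :: "nat \<Rightarrow> 'a::comm_ring_1 \<Rightarrow> 'a \<Rightarrow> 'a \<Rightarrow> 'a \<Rightarrow> (nat \<Rightarrow> nat) \<times> (nat \<Rightarrow> nat) \<Rightarrow> 'a" where
  "stat_weight n \<alpha> \<beta> \<gamma> \<delta> = (\<lambda>(v, w). let (i, j) = cover_positions n (v, w) in
     1 + of_nat (a_stat n v i j) * \<alpha> + of_nat (b_stat n v i j) * \<beta>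
       + of_nat (c_stat n v i j) * \<gamma> + of_nat (d_stat n v i j) * \<delta>)"

lemma stat_weight_transpose:
  assumes "w \<in> Sym n" "(i, j) \<in> position_pairs n"
  defines "v \<equiv> w \<circ> transpose i j"
  shows "stat_weight n \<alpha> \<beta> \<gamma> \<delta> (v, w) = 1 + of_nat (a_stat n v i j) * \<alpha> + of_nat (b_stat n v i j) * \<beta>
       + of_nat (c_stat n v i j) * \<gamma> + of_nat (d_stat n v i j) * \<delta>"
proof -
  have ij: "1 \<le> i" "i < j" "j \<le> n" using assms(2) by (auto simp: position_pairs_def)
  have "v \<in> Sym n" unfolding v_def using ij by (intro Sym_transpose[OF assms(1)]) auto
  moreover have "w = v \<circ> transpose i j" by (simp add: v_def comp_assoc)
  ultimately have "cover_positions n (v, w) = (i, j)" using cover_positions_eq ij by metis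
  then show ?thesis by (simp add: stat_weight_def)
qed

lemma cover_op_id: "cover_op n g F id = 0"
  by (rule cover_op_sorted) simp

lemma cover_op_term_cong:
  assumes "\<And>i j. (i, j) \<in> position_pairs n \<Longrightarrow> down_cover w i j \<Longrightarrow>
    g w i j * F (w \<circ> transpose i j) = h w i j * G (w \<circ> transpose i j)"
  shows "cover_op n g F w = cover_op n h G w"
  unfolding cover_op_def using assms by (intro sum.cong) auto

lemma weighted_chain_sum_cover_op:
  fixes wt :: "(nat \<Rightarrow> nat) \<times> (nat \<Rightarrow> nat) \<Rightarrow> 'a::comm_ring_1"
  assumes "w \<in> Sym n"
  shows "weighted_chain_sum n wt id w =
    of_bool (w = id) + cover_op n (\<lambda>w i j. wt (w \<circ> transpose i j, w)) (weighted_chain_sum n wt id) w"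
  using weighted_chain_sum_last[OF id_Sym, of n wt w] unfolding sum_lower_covers[OF assms]
  by (simp only: eq_commute[of id])

lemma stat_weight_diagonal:
  assumes "w \<in> Sym n" "(i, j) \<in> position_pairs n" "down_cover w i j"
  shows "stat_weight n 0 (1 + t) 0 (1 - t) (w \<circ> transpose i j, w) =
    of_nat (j - i) + t * (of_nat (above_between w i j) - of_nat (below_between w i j))"
  unfolding stat_weight_transpose[OF assms(1,2)] b_stat_transpose[OF assms(2)]
    d_stat_transpose[OF assms(2)] between_sum[OF assms(3)]
  by (simp add: algebra_simps)

text \<open>Each cover of a chain from \<open>id\<close> to \<open>w\<close> is one application of
  the operator, so the exponent is the length of \<open>w\<close>; the inhomogeneous term of the
  recursion only appears at length 0.\<close>

lemma weighted_chain_sum_diag: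
  fixes t :: "'a::{idom,ring_char_0}"
  assumes "w \<in> Sym n"
  shows "weighted_chain_sum n (stat_weight n 0 (1 + t) 0 (1 - t)) id w =
    (diag_op n t ^^ inversions n w) unit_fun w"
  using assms
proof (induction "inversions n w" arbitrary: w)
  case 0
  then have "w = id" using inversions_0_iff by simp
  then show ?case
    unfolding weighted_chain_sum_cover_op[OF 0(2)] 0(1)[symmetric]
    by (simp only: cover_op_id unit_fun_def funpow_0) simp
next
  case (Suc r)
  let ?wt = "stat_weight n 0 (1 + t) 0 (1 - t)"
  let ?M = "weighted_chain_sum n ?wt id"
  have "w \<noteq> id" using Suc inversions_0_iff[OF Suc.prems] by auto
  then have "?M w = cover_op n (\<lambda>w i j. ?wt (w \<circ> transpose i j, w)) ?M w"
    unfolding weighted_chain_sum_cover_op[OF Suc.prems, of ?wt] by simp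
  also have "\<dots> = diag_op n t ((diag_op n t ^^ r) unit_fun) w"
    unfolding diag_op_def[of n t]
  proof (rule cover_op_term_cong)
    fix i j assume ij: "(i, j) \<in> position_pairs n" and d: "down_cover w i j"
    have "w \<circ> transpose i j \<in> Sym n"
      using ij by (intro Sym_transpose[OF Suc.prems]) (auto simp: position_pairs_def)
    moreover have "r = inversions n (w \<circ> transpose i j)"
      using down_cover_inversions[OF Suc.prems ij d] Suc.hyps(2) by simp
    ultimately have "?M (w \<circ> transpose i j) = (diag_op n t ^^ r) unit_fun (w \<circ> transpose i j)"
      using Suc.hyps(1) by metis
    then show "?wt (w \<circ> transpose i j, w) * ?M (w \<circ> transpose i j) =
        (of_nat (j - i) + t * (of_nat (above_between w i j) - of_nat (below_between w i j))) *
        (cover_op n (\<lambda>w i j. of_nat (j - i) + t * (of_nat (above_between w i j) - of_nat (below_between w i j)))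
          ^^ r) unit_fun (w \<circ> transpose i j)"
      unfolding stat_weight_diagonal[OF Suc.prems ij d] diag_op_def[of n t] by (simp only:)
  qed
  finally show ?case unfolding Suc.hyps(2)[symmetric] by simp
qed

lemma diagonal_weights:
  fixes t :: "'a::{idom,ring_char_0}"
  shows "weighted_chain_sum n (stat_weight n 0 (1 + t) 0 (1 - t)) id (longest n) = of_nat (fact (n choose 2))"
  unfolding weighted_chain_sum_diag[OF longest_Sym] inversions_longest by (rule diag_op_top)

section \<open>Macdonald's sum over reduced words\<close>

text \<open>When \<open>r\<close> is the length of \<open>w\<close>, the words of length \<open>r\<close> with product \<open>w\<close> are the reduced ones.\<close>

primrec macdonald_sum :: "nat \<Rightarrow> nat \<Rightarrow> (nat \<Rightarrow> nat) \<Rightarrow> int" where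
  "macdonald_sum n 0 w = of_bool (w = id)"
| "macdonald_sum n (Suc r) w = (\<Sum>a\<in>{1..<n}. int a * macdonald_sum n r (w \<circ> transpose a (Suc a)))"

text \<open>The definition removes letters at the right end of a word. Removal at the left end
  commutes with it, which is what makes the sum invariant under inversion.\<close>

lemma macdonald_sum_left:
  "macdonald_sum n (Suc r) w = (\<Sum>a\<in>{1..<n}. int a * macdonald_sum n r (transpose a (Suc a) \<circ> w))"
proof (induction r arbitrary: w)
  case 0
  have "w \<circ> transpose a (Suc a) = id \<longleftrightarrow> transpose a (Suc a) \<circ> w = id" for a
    by (metis comp_assoc comp_id id_comp transpose_comp_involutory)
  then show ?case by (simp only: macdonald_sum.simps)
next
  case (Suc r)
  have "macdonald_sum n (Suc (Suc r)) w = (\<Sum>a\<in>{1..<n}. \<Sum>b\<in>{1..<n}.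
      int a * (int b * macdonald_sum n r (transpose b (Suc b) \<circ> w \<circ> transpose a (Suc a))))"
    unfolding macdonald_sum.simps(2)[of n "Suc r"] Suc sum_distrib_left comp_assoc ..
  also have "\<dots> = (\<Sum>b\<in>{1..<n}. \<Sum>a\<in>{1..<n}.
      int b * (int a * macdonald_sum n r (transpose b (Suc b) \<circ> w \<circ> transpose a (Suc a))))"
    by (subst sum.swap) (simp only: mult.left_commute)
  also have "\<dots> = (\<Sum>b\<in>{1..<n}. int b * macdonald_sum n (Suc r) (transpose b (Suc b) \<circ> w))"
    unfolding macdonald_sum.simps(2)[of n r] sum_distrib_left ..
  finally show ?case .
qed

lemma macdonald_sum_inverse:
  "bij w \<Longrightarrow> macdonald_sum n r (inv_into UNIV w) = macdonald_sum n r w"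
proof (induction r arbitrary: w)
  case 0
  have "inv_into UNIV w = id \<longleftrightarrow> w = id"
    using 0 by (metis inv_id inv_inv_eq)
  then show ?case by simp
next
  case (Suc r)
  have "inv_into UNIV w \<circ> transpose a (Suc a) = inv_into UNIV (transpose a (Suc a) \<circ> w)" for a
    using Suc.prems by (simp add: o_inv_distrib)
  then have "macdonald_sum n (Suc r) (inv_into UNIV w) =
      (\<Sum>a\<in>{1..<n}. int a * macdonald_sum n r (inv_into UNIV (transpose a (Suc a) \<circ> w)))"
    by simp
  also have "\<dots> = (\<Sum>a\<in>{1..<n}. int a * macdonald_sum n r (transpose a (Suc a) \<circ> w))"
    using Suc.prems by (intro sum.cong refl arg_cong2[where f = "(*)"] Suc.IH bij_comp) auto
  also have "\<dots> = macdonald_sum n (Suc r) w"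
    by (rule macdonald_sum_left[symmetric])
  finally show ?case .
qed

lemma macdonald_sum_zero:
  "w \<in> Sym n \<Longrightarrow> r < inversions n w \<Longrightarrow> macdonald_sum n r w = 0"
proof (induction r arbitrary: w)
  case 0
  then show ?case using inversions_0_iff by force
next
  case (Suc r)
  have "macdonald_sum n r (w \<circ> transpose a (Suc a)) = 0" if a: "a \<in> {1..<n}" for a
  proof (rule Suc.IH)
    show "w \<circ> transpose a (Suc a) \<in> Sym n"
      using a by (intro Sym_transpose[OF Suc.prems(1)]) auto
    have "w a < w (Suc a) \<or> w (Suc a) < w a"
      using Sym_inj[OF Suc.prems(1)] by (metis inj_eq linorder_neqE_nat n_not_Suc_n)
    then show "r < inversions n (w \<circ> transpose a (Suc a))"
      using inversions_swap[of a n w] inversions_swap_descent[of a n w] a Suc.prems(2) by auto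
  qed
  then show ?case by simp
qed

section \<open>The diagonal term of the sl_2 relation\<close>

lemma sum_by_parts: "(\<Sum>a\<in>{1..<n}. int a * (G a - G (Suc a))) = (\<Sum>a\<in>{1..<n}. G a) - int (n - 1) * G n"
proof (induction n)
  case (Suc n)
  then show ?case by (cases n) (auto simp: algebra_simps)
qed simp

lemma sum_sgn_pairs:
  assumes "w \<in> Sym n"
  shows "(\<Sum>(i, j)\<in>position_pairs n. sgn (int (w j) - int (w i))) = int (n choose 2) - 2 * int (inversions n w)"
proof -
  have "(\<Sum>(i, j)\<in>position_pairs n. sgn (int (w j) - int (w i))) =
      (\<Sum>(i, j)\<in>position_pairs n. 1 - 2 * of_bool (w j < w i))"
  proof (intro sum.cong refl, clarify)
    fix i j assume "(i, j) \<in> position_pairs n"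
    then have "w i \<noteq> w j" using Sym_inj[OF assms] by (auto simp: position_pairs_def inj_eq)
    then show "sgn (int (w j) - int (w i)) = 1 - 2 * of_bool (w j < w i)"
      by (auto simp: sgn_if)
  qed
  also have "\<dots> = int (card (position_pairs n)) - 2 * (\<Sum>(i, j)\<in>position_pairs n. of_bool (w j < w i))"
    by (simp add: case_prod_unfold sum_subtractf sum_distrib_left)
  also have "(\<Sum>(i, j)\<in>position_pairs n. of_bool (w j < w i)) = int (inversions n w)"
    unfolding inversions_sum by (simp add: case_prod_unfold del: sum_of_bool_eq)
  finally show ?thesis by (simp add: card_position_pairs)
qed

text \<open>The weight 1 + 2c of the cover joining \<open>w\<close> and \<open>w \<circ> s\<close>,
  positive if it goes up from \<open>w\<close> and negative if it goes down: what one letter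
  contributes to the diagonal of the commutator.\<close>

definition signed_step :: "nat \<Rightarrow> (nat \<Rightarrow> nat) \<Rightarrow> nat \<Rightarrow> int" where
  "signed_step n w a =
    (if w a < w (Suc a) then 1 + 2 * int (c_stat n w a (Suc a))
     else - (1 + 2 * int (c_stat n (w \<circ> transpose a (Suc a)) a (Suc a))))"

text \<open>The eigenvalue of the sl_2 weight element at the rank of \<open>w\<close>. With G p the
  sum of signs over the positions after p, a step is G a - G (a+1), since a later value contributes
  2 or -2 exactly when it lies between the two neighbours. Summation by parts, with G n empty,
  leaves the signs of all pairs.\<close>

lemma signed_step_sum:
  assumes "w \<in> Sym n"
  shows "(\<Sum>a\<in>{1..<n}. int a * signed_step n w a) = int (n choose 2) - 2 * int (inversions n w)"
proof -
  let ?g = "\<lambda>p m. sgn (int (w m) - int (w p))"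
  let ?G = "\<lambda>p. \<Sum>m\<in>{p<..n}. ?g p m"
  have ne: "w p = w q \<longleftrightarrow> p = q" for p q
    using Sym_inj[OF assms] by (simp add: inj_eq)
  have "signed_step n w a = ?G a - ?G (Suc a)" if a: "a \<in> {1..<n}" for a
  proof -
    let ?K = "{Suc a<..n}"
    have split: "{a<..n} = insert (Suc a) ?K" using a by auto
    have "?G a - ?G (Suc a) = ?g a (Suc a) + (\<Sum>m\<in>?K. ?g a m - ?g (Suc a) m)"
      unfolding split by (simp add: sum_subtractf)
    also have "\<dots> = signed_step n w a"
    proof (cases "w a < w (Suc a)")
      case True
      have "(\<Sum>m\<in>?K. ?g a m - ?g (Suc a) m) = (\<Sum>m\<in>?K. 2 * of_bool (w a < w m \<and> w m < w (Suc a)))"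
      proof (intro sum.cong refl)
        fix m assume "m \<in> ?K"
        then have "w m \<noteq> w a" "w m \<noteq> w (Suc a)" by (auto simp: ne)
        then show "?g a m - ?g (Suc a) m = 2 * of_bool (w a < w m \<and> w m < w (Suc a))"
          using True by (auto simp: sgn_if)
      qed
      also have "\<dots> = 2 * int (c_stat n w a (Suc a))"
      proof -
        have "{k \<in> {1..n}. Suc a < k \<and> w a < w k \<and> w k < w (Suc a)} =
          ?K \<inter> {m. w a < w m \<and> w m < w (Suc a)}" by auto
        then show ?thesis by (simp add: c_stat_def sum_distrib_left[symmetric])
      qed
      finally show ?thesis using True by (simp add: signed_step_def sgn_if)
    next
      case False
      then have lt: "w (Suc a) < w a" using ne[of a "Suc a"] by simp
      have "(\<Sum>m\<in>?K. ?g a m - ?g (Suc a) m) = (\<Sum>m\<in>?K. - 2 * of_bool (w (Suc a) < w m \<and> w m < w a))"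
      proof (intro sum.cong refl)
        fix m assume "m \<in> ?K"
        then have "w m \<noteq> w a" "w m \<noteq> w (Suc a)" by (auto simp: ne)
        then show "?g a m - ?g (Suc a) m = - 2 * of_bool (w (Suc a) < w m \<and> w m < w a)"
          using lt by (auto simp: sgn_if)
      qed
      also have "\<dots> = - 2 * int (c_stat n (w \<circ> transpose a (Suc a)) a (Suc a))"
      proof -
        have "{k \<in> {1..n}. Suc a < k \<and> (w \<circ> transpose a (Suc a)) a < (w \<circ> transpose a (Suc a)) k \<and>
            (w \<circ> transpose a (Suc a)) k < (w \<circ> transpose a (Suc a)) (Suc a)} =
          ?K \<inter> {m. w (Suc a) < w m \<and> w m < w a}" by auto
        then show ?thesis by (simp only: c_stat_def sum_distrib_left[symmetric]) simp
      qed
      finally show ?thesis using False lt by (simp add: signed_step_def sgn_if)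
    qed
    finally show ?thesis ..
  qed
  then have "(\<Sum>a\<in>{1..<n}. int a * signed_step n w a) = (\<Sum>a\<in>{1..<n}. int a * (?G a - ?G (Suc a)))"
    by (intro sum.cong) auto
  also have "\<dots> = (\<Sum>a\<in>{1..<n}. ?G a)"
    using sum_by_parts[of ?G n] by simp
  also have "\<dots> = (\<Sum>(i, j)\<in>position_pairs n. ?g i j)"
    by (subst sum.Sigma) (auto intro!: sum.cong simp: position_pairs_def)
  also have "\<dots> = int (n choose 2) - 2 * int (inversions n w)"
    by (rule sum_sgn_pairs[OF assms])
  finally show ?thesis .
qed

section \<open>Upper covers acting on Macdonald's sum\<close>

abbreviation up_cover :: "(nat \<Rightarrow> nat) \<Rightarrow> nat \<Rightarrow> nat \<Rightarrow> bool" where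
  "up_cover w i j \<equiv> down_cover (w \<circ> transpose i j) i j"

lemma transpose_transpose_comp:
  fixes w :: "nat \<Rightarrow> nat" and i j k :: nat
  defines "s \<equiv> transpose k (Suc k)"
  shows "w \<circ> transpose i j \<circ> s = w \<circ> s \<circ> transpose (s i) (s j)"
  using transpose_comp_eq[of s i j] by (simp add: s_def comp_assoc)

text \<open>The lifting property seen from below, by reading \<open>down_cover_lift\<close> at
  \<open>w \<circ> transpose i j \<circ> s\<close>; \<open>down_cover_descent\<close> supplies the
  ascent needed for the converse.\<close>

lemma up_cover_swap:
  assumes w: "inj w" and ij: "i < j" "(i, j) \<noteq> (k, Suc k)"
  defines "s \<equiv> transpose k (Suc k)"
  shows "up_cover w i j \<and> (w \<circ> transpose i j) (Suc k) < (w \<circ> transpose i j) k \<longleftrightarrow>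
    w (Suc k) < w k \<and> up_cover (w \<circ> s) (s i) (s j)"
proof -
  let ?u = "w \<circ> transpose i j \<circ> s"
  have u: "?u = w \<circ> s \<circ> transpose (s i) (s j)"
    unfolding s_def by (rule transpose_transpose_comp)
  have uinj: "inj ?u" unfolding s_def by (intro inj_comp_transpose w)
  have us: "?u \<circ> s = w \<circ> transpose i j" by (simp add: s_def comp_assoc)
  have ut: "?u \<circ> transpose (s i) (s j) = w \<circ> s" unfolding u by (simp add: comp_assoc)
  have uk: "?u k = (w \<circ> transpose i j) (Suc k)" "?u (Suc k) = (w \<circ> transpose i j) k"
    by (simp_all add: s_def)
  have wk: "(w \<circ> s) k = w (Suc k)" "(w \<circ> s) (Suc k) = w k" by (simp_all add: s_def)
  have ij': "s i < s j" "(s i, s j) \<noteq> (k, Suc k)"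
    using ij by (auto simp: s_def transpose_def)
  have lift: "up_cover w i j \<longleftrightarrow> up_cover (w \<circ> s) (s i) (s j) \<and> w (Suc k) < w k" if "?u k < ?u (Suc k)"
    using down_cover_lift[OF uinj that ij] unfolding s_def[symmetric] unfolding us ut unfolding wk unfolding u .
  show ?thesis
  proof
    assume l: "up_cover w i j \<and> (w \<circ> transpose i j) (Suc k) < (w \<circ> transpose i j) k"
    then have "?u k < ?u (Suc k)" unfolding uk by blast
    from lift[OF this] l show "w (Suc k) < w k \<and> up_cover (w \<circ> s) (s i) (s j)" by blast
  next
    assume r: "w (Suc k) < w k \<and> up_cover (w \<circ> s) (s i) (s j)"
    then have d: "down_cover ?u (s i) (s j)" unfolding u by blast
    have asc: "?u k < ?u (Suc k)"
    proof (rule ccontr)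
      assume "\<not> ?u k < ?u (Suc k)"
      then have "?u (Suc k) < ?u k"
        using uinj by (metis inj_eq linorder_neqE_nat n_not_Suc_n)
      then have "(w \<circ> s) (Suc k) < (w \<circ> s) k"
        using down_cover_descent[OF uinj _ d ij'(2)] unfolding ut by blast
      then show False using r unfolding wk by linarith
    qed
    then show "up_cover w i j \<and> (w \<circ> transpose i j) (Suc k) < (w \<circ> transpose i j) k"
      using lift[OF asc] r unfolding uk by blast
  qed
qed

text \<open>The set of later positions changes only if \<open>j\<close> is \<open>k\<close> or
  \<open>Suc k\<close>. The value in question is excluded by the first descent if
  \<open>j = k\<close> and by the second if \<open>j = Suc k\<close>.\<close>

lemma c_stat_swap:
  assumes k: "1 \<le> k" "Suc k \<le> n" and ij: "i < j" "(i, j) \<noteq> (k, Suc k)"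
    and desc: "(w \<circ> transpose i j) (Suc k) < (w \<circ> transpose i j) k" "w (Suc k) < w k"
  defines "s \<equiv> transpose k (Suc k)"
  shows "c_stat n (w \<circ> s) (s i) (s j) = c_stat n w i j"
proof -
  have "bij_betw s {m \<in> {1..n}. s j < m \<and> w i < w (s m) \<and> w (s m) < w j}
      {m \<in> {1..n}. j < m \<and> w i < w m \<and> w m < w j}"
  proof (rule bij_betwI[where g = s])
    show "s \<in> {m \<in> {1..n}. s j < m \<and> w i < w (s m) \<and> w (s m) < w j} \<rightarrow>
      {m \<in> {1..n}. j < m \<and> w i < w m \<and> w m < w j}"
      using assms by (auto simp: s_def transpose_def split: if_splits)
    show "s \<in> {m \<in> {1..n}. j < m \<and> w i < w m \<and> w m < w j} \<rightarrow>
      {m \<in> {1..n}. s j < m \<and> w i < w (s m) \<and> w (s m) < w j}"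
      using assms by (auto simp: s_def transpose_def split: if_splits)
  qed (simp_all add: s_def)
  then show ?thesis
    unfolding c_stat_def by (simp add: bij_betw_same_card s_def)
qed

definition up_sum :: "nat \<Rightarrow> nat \<Rightarrow> (nat \<Rightarrow> nat) \<Rightarrow> int" where
  "up_sum n r w = (\<Sum>(i, j)\<in>position_pairs n.
     if up_cover w i j then (1 + 2 * int (c_stat n w i j)) * macdonald_sum n r (w \<circ> transpose i j) else 0)"

text \<open>Moves one letter past the covers. Upper covers of \<open>w\<close> other than
  \<open>w \<circ> s\<close> that descend at \<open>k\<close> match those of
  \<open>w \<circ> s\<close>; the ones that ascend contribute 0. The cover joining \<open>w\<close>
  and \<open>w \<circ> s\<close> occurs on one side only, and this is the signed step.\<close>

lemma up_sum_swap:
  assumes w: "w \<in> Sym n" and k: "1 \<le> k" "Suc k \<le> n" and r: "r = inversions n w"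
  defines "s \<equiv> transpose k (Suc k)"
  shows "(\<Sum>(i, j)\<in>position_pairs n. if up_cover w i j
      then (1 + 2 * int (c_stat n w i j)) * macdonald_sum n r (w \<circ> transpose i j \<circ> s) else 0) =
    signed_step n w k * macdonald_sum n r w + (if w (Suc k) < w k then up_sum n r (w \<circ> s) else 0)"
proof -
  let ?P = "position_pairs n - {(k, Suc k)}"
  let ?\<psi> = "macdonald_sum n r"
  let ?h = "\<lambda>u i j. if up_cover u i j then (1 + 2 * int (c_stat n u i j)) * ?\<psi> (u \<circ> transpose i j) else 0"
  have kP: "(k, Suc k) \<in> position_pairs n"
    using k by (simp add: position_pairs_def)
  have inj: "inj w" by (rule Sym_inj[OF w])
  have up_k: "up_cover u k (Suc k) \<longleftrightarrow> u k < u (Suc k)" for u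
    by (auto simp: down_cover_def)
  have off_diag: "(if up_cover w i j then (1 + 2 * int (c_stat n w i j)) * ?\<psi> (w \<circ> transpose i j \<circ> s) else 0) =
      (if w (Suc k) < w k then ?h (w \<circ> s) (s i) (s j) else 0)"
    if ij: "(i, j) \<in> ?P" for i j
  proof -
    have ij': "i < j" "(i, j) \<noteq> (k, Suc k)" "i \<in> {1..n}" "j \<in> {1..n}"
      using ij by (auto simp: position_pairs_def)
    note swap = up_cover_swap[OF inj ij'(1,2), folded s_def]
    let ?v = "w \<circ> transpose i j"
    have vS: "?v \<in> Sym n" by (rule Sym_transpose[OF w ij'(3,4)])
    show ?thesis
    proof (cases "up_cover w i j \<and> ?v (Suc k) < ?v k")
      case True
      then have "w (Suc k) < w k" "up_cover (w \<circ> s) (s i) (s j)" using swap by auto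
      moreover have "c_stat n (w \<circ> s) (s i) (s j) = c_stat n w i j"
        unfolding s_def using True calculation(1) by (intro c_stat_swap[OF k ij'(1,2)]) auto
      moreover have "?v \<circ> s = w \<circ> s \<circ> transpose (s i) (s j)"
        unfolding s_def by (rule transpose_transpose_comp)
      ultimately show ?thesis using True by simp
    next
      case False
      \<comment> \<open>Such a \<open>?v\<close> ascends at \<open>k\<close>, so
        \<open>?v \<circ> s\<close> is two longer than \<open>w\<close> and no word of length
        \<open>r\<close> reaches it.\<close>
      have "?\<psi> (?v \<circ> s) = 0" if up: "up_cover w i j"
      proof -
        have "inversions n ?v = Suc r"
          using down_cover_inversions[OF vS _ up] ij r by (simp add: comp_assoc)
        moreover have "?v k < ?v (Suc k)"
          using False up Sym_inj[OF vS] by (metis inj_eq linorder_neqE_nat n_not_Suc_n)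
        ultimately have "inversions n (?v \<circ> s) = Suc (Suc r)"
          unfolding s_def using inversions_swap[OF k, of ?v] by simp
        moreover have "?v \<circ> s \<in> Sym n"
          unfolding s_def using k by (intro Sym_transpose[OF vS]) auto
        ultimately show ?thesis by (intro macdonald_sum_zero) auto
      qed
      moreover have "\<not> (w (Suc k) < w k \<and> up_cover (w \<circ> s) (s i) (s j))"
        using False swap by blast
      ultimately show ?thesis by auto
    qed
  qed
  have "(\<Sum>(i, j)\<in>position_pairs n. if up_cover w i j
      then (1 + 2 * int (c_stat n w i j)) * ?\<psi> (w \<circ> transpose i j \<circ> s) else 0) =
    (if w k < w (Suc k) then (1 + 2 * int (c_stat n w k (Suc k))) * ?\<psi> w else 0) +
    (\<Sum>(i, j)\<in>?P. if up_cover w i j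
      then (1 + 2 * int (c_stat n w i j)) * ?\<psi> (w \<circ> transpose i j \<circ> s) else 0)"
    by (rule trans[OF sum.remove[OF finite_position_pairs kP]])
       (simp only: prod.case up_k s_def comp_assoc transpose_comp_involutory comp_id)
  also have "(\<Sum>(i, j)\<in>?P. if up_cover w i j
      then (1 + 2 * int (c_stat n w i j)) * ?\<psi> (w \<circ> transpose i j \<circ> s) else 0) =
    (\<Sum>(i, j)\<in>?P. if w (Suc k) < w k then ?h (w \<circ> s) (s i) (s j) else 0)"
    by (rule sum.cong[OF refl]) (use off_diag in auto)
  also have "\<dots> = (if w (Suc k) < w k then (\<Sum>(i, j)\<in>?P. ?h (w \<circ> s) (s i) (s j)) else 0)"
    by (simp add: case_prod_unfold)
  also have "(\<Sum>(i, j)\<in>?P. ?h (w \<circ> s) (s i) (s j)) = (\<Sum>(i, j)\<in>?P. ?h (w \<circ> s) i j)"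
    using sum.reindex_bij_betw[OF swap_positions_bij[OF k], of "\<lambda>(i, j). ?h (w \<circ> s) i j"]
    by (simp only: case_prod_unfold prod.sel s_def)
  also have "\<dots> = up_sum n r (w \<circ> s) - ?h (w \<circ> s) k (Suc k)"
  proof -
    have "up_sum n r (w \<circ> s) = ?h (w \<circ> s) k (Suc k) + (\<Sum>(i, j)\<in>?P. ?h (w \<circ> s) i j)"
      unfolding up_sum_def
      by (rule trans[OF sum.remove[OF finite_position_pairs kP]]) (simp only: prod.case)
    then show ?thesis by linarith
  qed
  finally have eq: "(\<Sum>(i, j)\<in>position_pairs n. if up_cover w i j
      then (1 + 2 * int (c_stat n w i j)) * ?\<psi> (w \<circ> transpose i j \<circ> s) else 0) =
    (if w k < w (Suc k) then (1 + 2 * int (c_stat n w k (Suc k))) * ?\<psi> w else 0) +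
    (if w (Suc k) < w k then up_sum n r (w \<circ> s) - ?h (w \<circ> s) k (Suc k) else 0)" .
  have wss: "w \<circ> s \<circ> s = w" by (simp add: s_def comp_assoc)
  have "w k \<noteq> w (Suc k)" using inj by (simp add: inj_eq)
  then consider "w k < w (Suc k)" | "w (Suc k) < w k" by linarith
  then show ?thesis
  proof cases
    case 1
    then show ?thesis unfolding eq by (simp add: signed_step_def)
  next
    case 2
    then have "?h (w \<circ> s) k (Suc k) = (1 + 2 * int (c_stat n (w \<circ> s) k (Suc k))) * ?\<psi> w"
    proof -
      have "up_cover (w \<circ> s) k (Suc k)"
        unfolding up_k using 2 by (simp add: s_def)
      moreover have "w \<circ> s \<circ> transpose k (Suc k) = w"
        using wss unfolding s_def .
      ultimately show ?thesis by (simp only: if_True)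
    qed
    moreover have "signed_step n w k = - (1 + 2 * int (c_stat n (w \<circ> s) k (Suc k)))"
      unfolding signed_step_def s_def using 2 by simp
    moreover have "\<not> w k < w (Suc k)" using 2 by simp
    ultimately show ?thesis
      unfolding eq using 2 by (simp only: if_True if_False mult_minus_left)
  qed
qed

lemma up_sum_step:
  assumes w: "w \<in> Sym n" and r: "r = inversions n w"
  shows "up_sum n (Suc r) w = (int (n choose 2) - 2 * int r) * macdonald_sum n r w +
    (\<Sum>a\<in>{1..<n}. int a * (if w (Suc a) < w a then up_sum n r (w \<circ> transpose a (Suc a)) else 0))"
proof -
  let ?\<psi> = "macdonald_sum n r"
  let ?T = "\<lambda>a i j. if up_cover w i j
    then (1 + 2 * int (c_stat n w i j)) * ?\<psi> (w \<circ> transpose i j \<circ> transpose a (Suc a)) else 0"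
  have "up_sum n (Suc r) w = (\<Sum>(i, j)\<in>position_pairs n. \<Sum>a\<in>{1..<n}. int a * ?T a i j)"
    unfolding up_sum_def
  proof (intro sum.cong refl, clarify)
    fix i j
    show "(if up_cover w i j then (1 + 2 * int (c_stat n w i j)) * macdonald_sum n (Suc r) (w \<circ> transpose i j)
        else 0) = (\<Sum>a\<in>{1..<n}. int a * ?T a i j)"
      by (cases "up_cover w i j")
        (simp_all only: if_True if_False macdonald_sum.simps sum_distrib_left mult.left_commute mult_zero_right sum.neutral_const)
  qed
  also have "\<dots> = (\<Sum>a\<in>{1..<n}. int a * (\<Sum>(i, j)\<in>position_pairs n. ?T a i j))"
    unfolding case_prod_unfold sum_distrib_left by (rule sum.swap)
  also have "\<dots> = (\<Sum>a\<in>{1..<n}. int a * (signed_step n w a * ?\<psi> w +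
      (if w (Suc a) < w a then up_sum n r (w \<circ> transpose a (Suc a)) else 0)))"
    by (rule sum.cong[OF refl], rule arg_cong[where f = "(*) _"], rule up_sum_swap[OF w _ _ r]) auto
  also have "\<dots> = (\<Sum>a\<in>{1..<n}. int a * signed_step n w a) * ?\<psi> w +
      (\<Sum>a\<in>{1..<n}. int a * (if w (Suc a) < w a then up_sum n r (w \<circ> transpose a (Suc a)) else 0))"
    by (simp only: distrib_left sum.distrib sum_distrib_right mult.assoc)
  finally show ?thesis unfolding signed_step_sum[OF w] r .
qed

text \<open>With N the binomial coefficient, the factor is the sum of the eigenvalues N - 2q over q
  = 0, ..., r, as in a lowest weight representation of sl_2: each length passed on the way down adds
  its own.\<close>

lemma up_sum_eq:
  assumes "w \<in> Sym n" "r = inversions n w"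
  shows "up_sum n (Suc r) w = int (Suc r) * (int (n choose 2) - int r) * macdonald_sum n r w"
  using assms
proof (induction r arbitrary: w)
  case 0
  then have "w = id" using inversions_0_iff by simp
  then show ?case unfolding up_sum_step[OF 0] by (simp add: id_def)
next
  case (Suc r)
  let ?N = "int (n choose 2)"
  have "(if w (Suc a) < w a then up_sum n (Suc r) (w \<circ> transpose a (Suc a)) else 0) =
      int (Suc r) * (?N - int r) * macdonald_sum n r (w \<circ> transpose a (Suc a))" if a: "a \<in> {1..<n}" for a
  proof -
    have a': "1 \<le> a" "Suc a \<le> n" using a by auto
    have S: "w \<circ> transpose a (Suc a) \<in> Sym n"
      using a by (intro Sym_transpose[OF Suc.prems(1)]) auto
    show ?thesis
    proof (cases "w (Suc a) < w a")
      case True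
      then have "r = inversions n (w \<circ> transpose a (Suc a))"
        using inversions_swap_descent[OF a' True] Suc.prems(2) by simp
      from Suc.IH[OF S this] show ?thesis using True by (simp only: if_True)
    next
      case False
      \<comment> \<open>At an ascent the left side is 0, and so is the right one, whose argument is
        longer than \<open>r\<close>.\<close>
      then have "w a < w (Suc a)"
        using Sym_inj[OF Suc.prems(1)] by (metis inj_eq linorder_neqE_nat n_not_Suc_n)
      then have "r < inversions n (w \<circ> transpose a (Suc a))"
        using inversions_swap[OF a', of w] Suc.prems(2) by simp
      then show ?thesis using False macdonald_sum_zero[OF S] by simp
    qed
  qed
  then have "(\<Sum>a\<in>{1..<n}. int a * (if w (Suc a) < w a then up_sum n (Suc r) (w \<circ> transpose a (Suc a)) else 0)) =
      (\<Sum>a\<in>{1..<n}. int a * (int (Suc r) * (?N - int r) * macdonald_sum n r (w \<circ> transpose a (Suc a))))"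
    by (intro sum.cong refl) (simp only:)
  also have "\<dots> = int (Suc r) * (?N - int r) * macdonald_sum n (Suc r) w"
    by (simp only: macdonald_sum.simps sum_distrib_left mult.left_commute)
  finally show ?case
    unfolding up_sum_step[OF Suc.prems] by (simp add: algebra_simps)
qed

section \<open>Symmetries of the chain sum\<close>

lemma Cov_cases:
  assumes "(v, w) \<in> Cov n"
  obtains i j where "v \<in> Sym n" "w \<in> Sym n" "1 \<le> i" "i < j" "j \<le> n" "w = v \<circ> transpose i j"
    "v i < v j" "inversions n w = Suc (inversions n v)"
proof -
  obtain i j where ij: "(i, j) \<in> position_pairs n" "down_cover w i j" "v = w \<circ> transpose i j"
    using assms Cov_iff by blast
  have "w = v \<circ> transpose i j" using ij(3) by (simp add: comp_assoc)
  moreover have "v i < v j" using ij by (simp add: down_cover_def)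
  ultimately show ?thesis
    using that[of i j] ij(1) Cov_Sym[OF assms] Cov_inversions[OF assms] by (simp add: position_pairs_def)
qed

lemma CovI:
  assumes "v \<in> Sym n" "w \<in> Sym n" "1 \<le> i" "i < j" "j \<le> n" "w = v \<circ> transpose i j"
    "inversions n w = Suc (inversions n v)"
  shows "(v, w) \<in> Cov n"
  using assms unfolding Cov_def by (auto simp: coxeter_length_eq)

lemma stat_weight_cover:
  assumes "v \<in> Sym n" "1 \<le> i" "i < j" "j \<le> n"
  shows "stat_weight n \<alpha> \<beta> \<gamma> \<delta> (v, v \<circ> transpose i j) = 1 + of_nat (a_stat n v i j) * \<alpha>
    + of_nat (b_stat n v i j) * \<beta> + of_nat (c_stat n v i j) * \<gamma> + of_nat (d_stat n v i j) * \<delta>"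
  by (simp add: stat_weight_def cover_positions_eq[OF assms])

lemma chain_weight_map:
  assumes "\<And>v w. (v, w) \<in> Cov n \<Longrightarrow> wt' (\<phi> v, \<phi> w) = wt (v, w)"
    and "successively (\<lambda>x y. (x, y) \<in> Cov n) us"
  shows "chain_weight wt' (map \<phi> us) = chain_weight wt us"
  using assms(2)
  by (induction us rule: induct_list012) (simp_all add: chain_weight_def assms(1))

lemma chain_weight_rev_map:
  fixes wt wt' :: "(nat \<Rightarrow> nat) \<times> (nat \<Rightarrow> nat) \<Rightarrow> 'a::comm_ring_1"
  assumes "\<And>v w. (v, w) \<in> Cov n \<Longrightarrow> wt' (\<phi> w, \<phi> v) = wt (v, w)"
    and "successively (\<lambda>x y. (x, y) \<in> Cov n) us"
  shows "chain_weight wt' (rev (map \<phi> us)) = chain_weight wt us"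
  using assms(2)
proof (induction us rule: induct_list012)
  case (3 x y zs)
  have "chain_weight wt' (rev (map \<phi> (x # y # zs))) =
      chain_weight wt' (rev (map \<phi> (y # zs))) * wt' (last (rev (map \<phi> (y # zs))), \<phi> x)"
    using chain_weight_snoc[of "rev (map \<phi> (y # zs))" wt' "\<phi> x"] by simp
  also have "last (rev (map \<phi> (y # zs))) = \<phi> y" by simp
  also have "wt' (\<phi> y, \<phi> x) = wt (x, y)" using 3 by (intro assms(1)) simp
  also have "chain_weight wt' (rev (map \<phi> (y # zs))) = chain_weight wt (y # zs)" using 3 by simp
  finally show ?case by (simp add: chain_weight_def)
qed (simp_all add: chain_weight_def)

text \<open>Besides symmetries this covers, with the identity as \<open>\<phi>\<close>, the
  replacement of a weight by one that agrees with it on covers.\<close>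

lemma weighted_chain_sum_map:
  assumes cov: "\<And>v w. (v, w) \<in> Cov n \<Longrightarrow> (\<phi> v, \<phi> w) \<in> Cov n"
    and wt: "\<And>v w. (v, w) \<in> Cov n \<Longrightarrow> wt' (\<phi> v, \<phi> w) = wt (v, w)"
    and inv: "\<And>v. v \<in> Sym n \<Longrightarrow> \<phi> v \<in> Sym n \<and> \<phi> (\<phi> v) = v"
    and vw: "v \<in> Sym n" "w \<in> Sym n"
  shows "weighted_chain_sum n wt v w = weighted_chain_sum n wt' (\<phi> v) (\<phi> w)"
proof -
  have m: "map \<phi> us \<in> saturated_chains n (\<phi> v) (\<phi> w)" if "us \<in> saturated_chains n v w" for us v w
    using that inv
    by (auto simp: saturated_chains_def hd_map last_map successively_map intro: successively_mono[OF _ cov])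
  have mm: "map \<phi> (map \<phi> us) = us" if "us \<in> saturated_chains n v w" for us v w
    using that inv by (auto simp: saturated_chains_def intro!: map_idI)
  show ?thesis
    unfolding weighted_chain_sum_def
  proof (rule sum.reindex_bij_witness[where i = "map \<phi>" and j = "map \<phi>"])
    fix us assume us: "us \<in> saturated_chains n v w"
    show "map \<phi> (map \<phi> us) = us" by (rule mm[OF us])
    show "map \<phi> us \<in> saturated_chains n (\<phi> v) (\<phi> w)" by (rule m[OF us])
    show "chain_weight wt' (map \<phi> us) = chain_weight wt us"
      using us by (intro chain_weight_map wt) (auto simp: saturated_chains_def)
  next
    fix us assume us: "us \<in> saturated_chains n (\<phi> v) (\<phi> w)"
    show "map \<phi> (map \<phi> us) = us" by (rule mm[OF us])
    show "map \<phi> us \<in> saturated_chains n v w" using m[OF us] inv vw by simp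
  qed
qed

lemma weighted_chain_sum_rev:
  fixes wt wt' :: "(nat \<Rightarrow> nat) \<times> (nat \<Rightarrow> nat) \<Rightarrow> 'a::comm_ring_1"
  assumes cov: "\<And>v w. (v, w) \<in> Cov n \<Longrightarrow> (\<phi> w, \<phi> v) \<in> Cov n"
    and wt: "\<And>v w. (v, w) \<in> Cov n \<Longrightarrow> wt' (\<phi> w, \<phi> v) = wt (v, w)"
    and inv: "\<And>v. v \<in> Sym n \<Longrightarrow> \<phi> v \<in> Sym n \<and> \<phi> (\<phi> v) = v"
    and vw: "v \<in> Sym n" "w \<in> Sym n"
  shows "weighted_chain_sum n wt v w = weighted_chain_sum n wt' (\<phi> w) (\<phi> v)"
proof -
  let ?f = "\<lambda>us. rev (map \<phi> us)"
  have m: "?f us \<in> saturated_chains n (\<phi> w) (\<phi> v)" if "us \<in> saturated_chains n v w" for us v w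
    using that inv
    by (auto simp: saturated_chains_def hd_map last_map hd_rev last_rev successively_map
        intro: successively_mono[OF _ cov])
  have mm: "?f (?f us) = us" if "us \<in> saturated_chains n v w" for us v w
    using that inv by (auto simp: saturated_chains_def rev_map intro!: map_idI)
  show ?thesis
    unfolding weighted_chain_sum_def
  proof (rule sum.reindex_bij_witness[where i = ?f and j = ?f])
    fix us assume us: "us \<in> saturated_chains n v w"
    show "?f (?f us) = us" by (rule mm[OF us])
    show "?f us \<in> saturated_chains n (\<phi> w) (\<phi> v)" by (rule m[OF us])
    show "chain_weight wt' (?f us) = chain_weight wt us"
      using us by (intro chain_weight_rev_map wt) (auto simp: saturated_chains_def)
  next
    fix us assume us: "us \<in> saturated_chains n (\<phi> w) (\<phi> v)"
    show "?f (?f us) = us" by (rule mm[OF us])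
    show "?f us \<in> saturated_chains n v w" using m[OF us] inv vw by simp
  qed
qed

abbreviation inverse_perm :: "(nat \<Rightarrow> nat) \<Rightarrow> nat \<Rightarrow> nat" where
  "inverse_perm w \<equiv> inv_into UNIV w"

lemma Sym_inverse: "w \<in> Sym n \<Longrightarrow> inverse_perm w \<in> Sym n \<and> inverse_perm (inverse_perm w) = w"
  by (simp add: Sym_def permutes_inv permutes_inv_inv)

lemma Sym_bij: "w \<in> Sym n \<Longrightarrow> bij w"
  by (simp add: Sym_def permutes_bij)

lemma inverse_perm_apply:
  assumes "w \<in> Sym n"
  shows "inverse_perm w (w i) = i" "w (inverse_perm w i) = i"
  using assms permutes_inverses[of w] by (auto simp: Sym_def)

lemma inversions_inverse:
  assumes "w \<in> Sym n"
  shows "inversions n (inverse_perm w) = inversions n w"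
proof -
  have sub: "(\<lambda>(i, j). (w j, w i)) ` inversion_set n w \<subseteq> inversion_set n (inverse_perm w)"
    if w: "w \<in> Sym n" for w
  proof clarify
    fix i j assume "(i, j) \<in> inversion_set n w"
    then have ij: "1 \<le> i" "i < j" "j \<le> n" "w j < w i"
      by (auto simp: inversion_set_def position_pairs_def)
    then have "1 \<le> w j" "w i \<le> n"
      using Sym_bounds[OF w, of i] Sym_bounds[OF w, of j] by auto
    with ij show "(w j, w i) \<in> inversion_set n (inverse_perm w)"
      by (simp add: inversion_set_def position_pairs_def inverse_perm_apply[OF w])
  qed
  have le: "inversions n w \<le> inversions n (inverse_perm w)" if w: "w \<in> Sym n" for w
  proof -
    have "inj_on (\<lambda>(i, j). (w j, w i)) (inversion_set n w)"
      by (rule inj_onI) (auto dest: injD[OF Sym_inj[OF w]])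
    then show ?thesis
      unfolding inversions_def by (rule card_inj_on_le[OF _ sub[OF w] finite_inversion_set])
  qed
  show ?thesis
    using le[OF assms] le[of "inverse_perm w"] Sym_inverse[OF assms] by simp
qed

lemma card_positions_values:
  assumes "v \<in> Sym n"
  shows "card {k \<in> {1..n}. P k (inverse_perm v k)} = card {m \<in> {1..n}. P (v m) m}"
proof -
  have "bij_betw v {m \<in> {1..n}. P (v m) m} {k \<in> {1..n}. P k (inverse_perm v k)}"
    using Sym_bounds[OF assms] Sym_bounds[OF conjunct1[OF Sym_inverse[OF assms]]]
    by (intro bij_betwI[where g = "inverse_perm v"]) (auto simp: inverse_perm_apply[OF assms])
  then show ?thesis by (simp add: bij_betw_same_card)
qed

text \<open>Inversion reflects the permutation diagram in its diagonal: left with intermediate value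
  becomes in between with smaller value, so a and d are exchanged, and likewise b and c.\<close>

lemma Cov_inverse:
  assumes "(v, w) \<in> Cov n"
  shows "(inverse_perm v, inverse_perm w) \<in> Cov n"
    and "stat_weight n \<delta> \<gamma> \<beta> \<alpha> (inverse_perm v, inverse_perm w) = stat_weight n \<alpha> \<beta> \<gamma> \<delta> (v, w)"
proof -
  obtain i j where vw: "v \<in> Sym n" "w \<in> Sym n" and ij: "1 \<le> i" "i < j" "j \<le> n"
    and w: "w = v \<circ> transpose i j" and lt: "v i < v j"
    and len: "inversions n w = Suc (inversions n v)"
    by (rule Cov_cases[OF assms])
  let ?v = "inverse_perm v" and ?w = "inverse_perm w"
  note app = inverse_perm_apply[OF vw(1)]
  have S: "?v \<in> Sym n" "?w \<in> Sym n" using Sym_inverse vw by auto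
  have b: "1 \<le> v i" "v j \<le> n" using Sym_bounds[OF vw(1), of i] Sym_bounds[OF vw(1), of j] ij by auto
  have "?w = transpose i j \<circ> ?v"
    unfolding w using Sym_bij[OF vw(1)] by (simp add: o_inv_distrib)
  also have "\<dots> = ?v \<circ> transpose (v i) (v j)"
    using transpose_comp_eq[OF Sym_bij[OF S(1)], of i j] Sym_inverse[OF vw(1)] by simp
  finally have w': "?w = ?v \<circ> transpose (v i) (v j)" .
  show "(?v, ?w) \<in> Cov n"
    by (rule CovI[OF S b(1) lt b(2) w']) (simp add: inversions_inverse vw len)
  have "a_stat n ?v (v i) (v j) = d_stat n v i j"
    unfolding a_stat_def d_stat_def app
    using card_positions_values[OF vw(1), of "\<lambda>k m. k < v i \<and> i < m \<and> m < j"] by (simp add: conj_commute conj_left_commute)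
  moreover have "b_stat n ?v (v i) (v j) = c_stat n v i j"
    unfolding b_stat_def c_stat_def app
    using card_positions_values[OF vw(1), of "\<lambda>k m. v i < k \<and> k < v j \<and> m > j"] by (simp add: conj_commute conj_left_commute)
  moreover have "c_stat n ?v (v i) (v j) = b_stat n v i j"
    unfolding b_stat_def c_stat_def app
    using card_positions_values[OF vw(1), of "\<lambda>k m. k > v j \<and> i < m \<and> m < j"] by (simp add: conj_commute conj_left_commute)
  moreover have "d_stat n ?v (v i) (v j) = a_stat n v i j"
    unfolding a_stat_def d_stat_def app
    using card_positions_values[OF vw(1), of "\<lambda>k m. v i < k \<and> k < v j \<and> m < i"] by (simp add: conj_commute conj_left_commute)
  ultimately show "stat_weight n \<delta> \<gamma> \<beta> \<alpha> (?v, ?w) = stat_weight n \<alpha> \<beta> \<gamma> \<delta> (v, w)"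
    unfolding w' stat_weight_cover[OF S(1) b(1) lt b(2)]
    unfolding w stat_weight_cover[OF vw(1) ij]
    by (simp add: algebra_simps)
qed

lemma inversions_longest_comp:
  assumes "w \<in> Sym n"
  shows "inversions n (longest n \<circ> w) + inversions n w = n choose 2"
proof -
  have "longest n (w j) < longest n (w i) \<longleftrightarrow> w i < w j" if "(i, j) \<in> position_pairs n" for i j
    using that Sym_bounds[OF assms, of i] Sym_bounds[OF assms, of j]
    by (auto simp: longest_def position_pairs_def)
  moreover have "w i < w j \<longleftrightarrow> \<not> w j < w i" if "(i, j) \<in> position_pairs n" for i j
    using that Sym_inj[OF assms] by (auto simp: position_pairs_def) (metis inj_eq linorder_neqE_nat less_irrefl)
  ultimately have "inversion_set n (longest n \<circ> w) = position_pairs n - inversion_set n w"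
    by (auto simp: inversion_set_def)
  moreover have "inversion_set n w \<subseteq> position_pairs n" by (auto simp: inversion_set_def)
  ultimately show ?thesis
    unfolding inversions_def card_position_pairs[symmetric]
    by (simp add: card_Diff_subset card_mono)
qed

lemma Sym_longest_comp: "w \<in> Sym n \<Longrightarrow> longest n \<circ> w \<in> Sym n \<and> longest n \<circ> (longest n \<circ> w) = w"
  using longest_Sym[of n] by (auto simp: Sym_def longest_longest fun_eq_iff intro: permutes_compose)

text \<open>Turning the values upside down reverses the order and exchanges above with below, that
  is b with d; the intermediate values counted by a and c stay intermediate.\<close>

lemma Cov_longest:
  assumes "(v, w) \<in> Cov n"
  shows "(longest n \<circ> w, longest n \<circ> v) \<in> Cov n"
    and "stat_weight n \<alpha> \<delta> \<gamma> \<beta> (longest n \<circ> w, longest n \<circ> v) = stat_weight n \<alpha> \<beta> \<gamma> \<delta> (v, w)"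
proof -
  obtain i j where vw: "v \<in> Sym n" "w \<in> Sym n" and ij: "1 \<le> i" "i < j" "j \<le> n"
    and w: "w = v \<circ> transpose i j" and lt: "v i < v j"
    and len: "inversions n w = Suc (inversions n v)"
    by (rule Cov_cases[OF assms])
  let ?v = "longest n \<circ> v" and ?w = "longest n \<circ> w"
  have S: "?v \<in> Sym n" "?w \<in> Sym n" using Sym_longest_comp vw by auto
  have v': "?v = ?w \<circ> transpose i j" unfolding w by (simp add: comp_assoc)
  show "(?w, ?v) \<in> Cov n"
    by (rule CovI[OF S(2,1) ij v'])
      (use inversions_longest_comp[OF vw(1)] inversions_longest_comp[OF vw(2)] len in linarith)
  have l: "longest n (v k) = n + 1 - v k" "1 \<le> v k" "v k \<le> n" if "k \<in> {1..n}" for k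
    using Sym_bounds[OF vw(1) that] by (auto simp: longest_def)
  have ijn: "i \<in> {1..n}" "j \<in> {1..n}" using ij by auto
  have wi: "?w i = n + 1 - v j" "?w j = n + 1 - v i"
    using l ijn by (simp_all add: w)
  have wk: "?w k = n + 1 - v k" if "k \<in> {1..n}" "k \<noteq> i" "k \<noteq> j" for k
    using l that by (simp add: w)
  have cmp: "?w i < ?w k \<longleftrightarrow> v k < v j" "?w k < ?w i \<longleftrightarrow> v j < v k"
    "?w j < ?w k \<longleftrightarrow> v k < v i" "?w k < ?w j \<longleftrightarrow> v i < v k"
    if "k \<in> {1..n}" "k \<noteq> i" "k \<noteq> j" for k
    unfolding wi wk[OF that] using l(2,3)[OF that(1)] l(2,3)[OF ijn(1)] l(2,3)[OF ijn(2)] by linarith+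
  have "a_stat n ?w i j = a_stat n v i j"
    unfolding a_stat_def
  proof (intro arg_cong[where f = card] Collect_cong)
    fix k
    show "k \<in> {1..n} \<and> k < i \<and> ?w i < ?w k \<and> ?w k < ?w j \<longleftrightarrow> k \<in> {1..n} \<and> k < i \<and> v i < v k \<and> v k < v j"
      using cmp[of k] ij(2) by (cases "k \<in> {1..n} \<and> k \<noteq> i \<and> k \<noteq> j") auto
  qed
  moreover have "b_stat n ?w i j = d_stat n v i j"
    unfolding b_stat_def d_stat_def
  proof (intro arg_cong[where f = card] Collect_cong)
    fix k
    show "k \<in> {1..n} \<and> i < k \<and> k < j \<and> ?w j < ?w k \<longleftrightarrow> k \<in> {1..n} \<and> i < k \<and> k < j \<and> v k < v i"
      using cmp[of k] ij(2) by (cases "k \<in> {1..n} \<and> k \<noteq> i \<and> k \<noteq> j") auto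
  qed
  moreover have "c_stat n ?w i j = c_stat n v i j"
    unfolding c_stat_def
  proof (intro arg_cong[where f = card] Collect_cong)
    fix k
    show "k \<in> {1..n} \<and> j < k \<and> ?w i < ?w k \<and> ?w k < ?w j \<longleftrightarrow> k \<in> {1..n} \<and> j < k \<and> v i < v k \<and> v k < v j"
      using cmp[of k] ij(2) by (cases "k \<in> {1..n} \<and> k \<noteq> i \<and> k \<noteq> j") auto
  qed
  moreover have "d_stat n ?w i j = b_stat n v i j"
    unfolding d_stat_def b_stat_def
  proof (intro arg_cong[where f = card] Collect_cong)
    fix k
    show "k \<in> {1..n} \<and> i < k \<and> k < j \<and> ?w k < ?w i \<longleftrightarrow> k \<in> {1..n} \<and> i < k \<and> k < j \<and> v j < v k"
      using cmp[of k] ij(2) by (cases "k \<in> {1..n} \<and> k \<noteq> i \<and> k \<noteq> j") auto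
  qed
  ultimately show "stat_weight n \<alpha> \<delta> \<gamma> \<beta> (?w, ?v) = stat_weight n \<alpha> \<beta> \<gamma> \<delta> (v, w)"
    unfolding v' stat_weight_cover[OF S(2) ij] unfolding w stat_weight_cover[OF vw(1) ij]
    by (simp add: algebra_simps)
qed

definition max_chain_sum :: "nat \<Rightarrow> 'a::comm_ring_1 \<Rightarrow> 'a \<Rightarrow> 'a \<Rightarrow> 'a \<Rightarrow> 'a" where
  "max_chain_sum n \<alpha> \<beta> \<gamma> \<delta> = weighted_chain_sum n (stat_weight n \<alpha> \<beta> \<gamma> \<delta>) id (longest n)"

lemma max_chain_sum_inverse: "max_chain_sum n \<alpha> \<beta> \<gamma> \<delta> = max_chain_sum n \<delta> \<gamma> \<beta> \<alpha>"
proof -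
  have "inverse_perm (longest n) = longest n"
    by (rule inv_equality) (simp_all add: longest_longest)
  moreover have "weighted_chain_sum n (stat_weight n \<alpha> \<beta> \<gamma> \<delta>) id (longest n) =
      weighted_chain_sum n (stat_weight n \<delta> \<gamma> \<beta> \<alpha>) (inverse_perm id) (inverse_perm (longest n))"
    by (rule weighted_chain_sum_map[where \<phi> = inverse_perm])
      (erule Cov_inverse(1), erule Cov_inverse(2), erule Sym_inverse, rule id_Sym, rule longest_Sym)
  ultimately show ?thesis
    unfolding max_chain_sum_def by (simp only: inv_id)
qed

lemma max_chain_sum_reverse: "max_chain_sum n \<alpha> \<beta> \<gamma> \<delta> = max_chain_sum n \<alpha> \<delta> \<gamma> \<beta>"
proof -
  have "longest n \<circ> longest n = id" by (simp add: fun_eq_iff longest_longest)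
  moreover have "weighted_chain_sum n (stat_weight n \<alpha> \<beta> \<gamma> \<delta>) id (longest n) =
      weighted_chain_sum n (stat_weight n \<alpha> \<delta> \<gamma> \<beta>) (longest n \<circ> longest n) (longest n \<circ> id)"
    by (rule weighted_chain_sum_rev[where \<phi> = "\<lambda>w. longest n \<circ> w"])
      (erule Cov_longest(1), erule Cov_longest(2), erule Sym_longest_comp, rule id_Sym, rule longest_Sym)
  ultimately show ?thesis
    unfolding max_chain_sum_def by (simp only: comp_id)
qed

section \<open>Pairing chain sums with Macdonald's sum\<close>

lemma sum_upper_covers_c:
  assumes w: "w \<in> Sym n"
  shows "(\<Sum>u | (w, u) \<in> Cov n. stat_weight n 0 0 2 0 (w, u) * of_int (macdonald_sum n r u)) =
    (of_int (up_sum n r w) :: 'a::comm_ring_1)"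
proof -
  let ?D = "{p \<in> position_pairs n. up_cover w (fst p) (snd p)}"
  let ?f = "\<lambda>p. w \<circ> transpose (fst p) (snd p)"
  have "(w, u) \<in> Cov n \<longleftrightarrow> (\<exists>p\<in>?D. u = ?f p)" for u
  proof
    assume "(w, u) \<in> Cov n"
    then obtain i j where ij: "(i, j) \<in> position_pairs n" "down_cover u i j" "w = u \<circ> transpose i j"
      using Cov_iff by blast
    have u: "u = w \<circ> transpose i j" using ij(3) by (simp add: comp_assoc)
    have "up_cover w i j" unfolding u[symmetric] by (rule ij(2))
    then have "(i, j) \<in> ?D" using ij(1) by (simp only: mem_Collect_eq fst_conv snd_conv simp_thms)
    then show "\<exists>p\<in>?D. u = ?f p" by (rule bexI[rotated]) (simp only: u fst_conv snd_conv)
  next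
    assume "\<exists>p\<in>?D. u = ?f p"
    then obtain i j where ij: "(i, j) \<in> position_pairs n" "up_cover w i j" "u = w \<circ> transpose i j"
      by auto
    then have "u \<in> Sym n" by (auto intro!: Sym_transpose[OF w] simp: position_pairs_def)
    moreover have "w = u \<circ> transpose i j" unfolding ij(3) by (simp add: comp_assoc)
    moreover have "down_cover u i j" unfolding ij(3) by (rule ij(2))
    ultimately show "(w, u) \<in> Cov n" using ij(1) Cov_iff by blast
  qed
  then have "{u. (w, u) \<in> Cov n} = ?f ` ?D" by (simp only: image_def)
  moreover have "inj_on ?f ?D"
  proof (rule inj_onI)
    fix p q assume "p \<in> ?D" "q \<in> ?D" "?f p = ?f q"
    then show "p = q"
      using transpose_comp_inj[OF Sym_inj[OF w], of "fst p" "snd p" "fst q" "snd q"]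
      by (simp add: position_pairs_def prod_eq_iff case_prod_unfold del: o_apply)
  qed
  ultimately have "(\<Sum>u | (w, u) \<in> Cov n. stat_weight n 0 0 2 0 (w, u) * of_int (macdonald_sum n r u)) =
      (\<Sum>p\<in>?D. stat_weight n 0 0 2 0 (w, ?f p) * of_int (macdonald_sum n r (?f p)) :: 'a)"
    by (simp add: sum.reindex)
  also have "\<dots> = (\<Sum>p\<in>?D. of_int ((1 + 2 * int (c_stat n w (fst p) (snd p))) * macdonald_sum n r (?f p)))"
    by (rule sum.cong) (auto simp: position_pairs_def stat_weight_cover[OF w] mult.commute)
  also have "\<dots> = of_int (\<Sum>p\<in>?D. (1 + 2 * int (c_stat n w (fst p) (snd p))) * macdonald_sum n r (?f p))"
    by (rule of_int_sum[symmetric])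
  also have "(\<Sum>p\<in>?D. (1 + 2 * int (c_stat n w (fst p) (snd p))) * macdonald_sum n r (?f p)) = up_sum n r w"
    unfolding up_sum_def sum.inter_filter[OF finite_position_pairs] by (rule sum.cong) auto
  finally show ?thesis .
qed

lemma sum_upper_covers_b:
  assumes w: "w \<in> Sym n"
  shows "(\<Sum>u | (w, u) \<in> Cov n. stat_weight n 0 2 0 0 (w, u) * of_int (macdonald_sum n r u)) =
    (of_int (up_sum n r (inverse_perm w)) :: 'a::comm_ring_1)"
proof -
  note [simp] = Sym_inverse[OF w]
  have "(\<Sum>u | (w, u) \<in> Cov n. stat_weight n 0 2 0 0 (w, u) * of_int (macdonald_sum n r u)) =
    (\<Sum>u | (inverse_perm w, u) \<in> Cov n.
      stat_weight n 0 0 2 0 (inverse_perm w, u) * of_int (macdonald_sum n r u) :: 'a)"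
  proof (rule sum.reindex_bij_witness[where i = inverse_perm and j = inverse_perm])
    fix u assume "u \<in> {u. (w, u) \<in> Cov n}"
    then have u: "(w, u) \<in> Cov n" by simp
    then have S: "u \<in> Sym n" using Cov_Sym by blast
    show "inverse_perm (inverse_perm u) = u" using Sym_inverse[OF S] by simp
    show "inverse_perm u \<in> {u. (inverse_perm w, u) \<in> Cov n}" using Cov_inverse(1)[OF u] by simp
    show "stat_weight n 0 0 2 0 (inverse_perm w, inverse_perm u) *
        of_int (macdonald_sum n r (inverse_perm u)) =
        (stat_weight n 0 2 0 0 (w, u) * of_int (macdonald_sum n r u) :: 'a)"
      by (simp only: Cov_inverse(2)[OF u] macdonald_sum_inverse[OF Sym_bij[OF S]])
  next
    fix u assume "u \<in> {u. (inverse_perm w, u) \<in> Cov n}"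
    then have u: "(inverse_perm w, u) \<in> Cov n" by simp
    then have S: "u \<in> Sym n" using Cov_Sym by blast
    show "inverse_perm (inverse_perm u) = u" using Sym_inverse[OF S] by simp
    show "inverse_perm u \<in> {u. (w, u) \<in> Cov n}" using Cov_inverse(1)[OF u] by simp
  qed
  then show ?thesis using sum_upper_covers_c[of "inverse_perm w" n r] by simp
qed

lemma sum_upper_covers:
  fixes x y :: "'a::{idom,ring_char_0}"
  assumes w: "w \<in> Sym n" and xy: "x + y = 2" and r: "r = inversions n w"
  shows "(\<Sum>u | (w, u) \<in> Cov n. stat_weight n 0 x y 0 (w, u) * of_int (macdonald_sum n (Suc r) u)) =
    of_nat (Suc r) * (of_nat (n choose 2) - of_nat r) * of_int (macdonald_sum n r w)"
proof -
  let ?\<psi> = "\<lambda>u. of_int (macdonald_sum n (Suc r) u) :: 'a"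
  let ?R = "of_nat (Suc r) * (of_nat (n choose 2) - of_nat r) * of_int (macdonald_sum n r w) :: 'a"
  have c: "(\<Sum>u | (w, u) \<in> Cov n. stat_weight n 0 0 2 0 (w, u) * ?\<psi> u) = ?R"
    unfolding sum_upper_covers_c[OF w] up_sum_eq[OF w r] by simp
  have b: "(\<Sum>u | (w, u) \<in> Cov n. stat_weight n 0 2 0 0 (w, u) * ?\<psi> u) = ?R"
    unfolding sum_upper_covers_b[OF w]
    using up_sum_eq[of "inverse_perm w" n r] Sym_inverse[OF w] inversions_inverse[OF w] r
      macdonald_sum_inverse[OF Sym_bij[OF w]] by simp
  have y: "y = 2 - x" using xy by (simp add: algebra_simps)
  \<comment> \<open>The place of x + y = 2: the constant terms match. Both sides are doubled because
    the ring need not contain 1/2.\<close>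
  have lin: "2 * stat_weight n 0 x y 0 p = x * stat_weight n 0 2 0 0 p + y * stat_weight n 0 0 2 0 p" for p
    by (simp add: stat_weight_def y algebra_simps split: prod.split)
  have "2 * (\<Sum>u | (w, u) \<in> Cov n. stat_weight n 0 x y 0 (w, u) * ?\<psi> u) =
      x * (\<Sum>u | (w, u) \<in> Cov n. stat_weight n 0 2 0 0 (w, u) * ?\<psi> u) +
      y * (\<Sum>u | (w, u) \<in> Cov n. stat_weight n 0 0 2 0 (w, u) * ?\<psi> u)"
    by (simp only: sum_distrib_left mult.assoc[symmetric] lin distrib_right sum.distrib)
  also have "\<dots> = 2 * ?R" unfolding b c using xy by (simp only: distrib_right[symmetric])
  finally show ?thesis by simp
qed

text \<open>Double counting of the covers between consecutive ranks: the chain sum is unfolded from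
  its upper end, Macdonald's sum is folded from its lower one.\<close>

lemma layer_sum:
  fixes x y :: "'a::{idom,ring_char_0}" and n :: nat
  assumes xy: "x + y = 2"
  defines "S \<equiv> \<lambda>r. \<Sum>w | w \<in> Sym n \<and> inversions n w = r.
    weighted_chain_sum n (stat_weight n 0 x y 0) id w * of_int (macdonald_sum n r w)"
  shows "S (Suc r) = of_nat (Suc r) * (of_nat (n choose 2) - of_nat r) * S r"
proof -
  let ?wt = "stat_weight n 0 x y 0"
  let ?M = "weighted_chain_sum n ?wt id"
  let ?L = "\<lambda>r. {w. w \<in> Sym n \<and> inversions n w = r}"
  let ?\<psi> = "\<lambda>u. of_int (macdonald_sum n (Suc r) u) :: 'a"
  have fin: "finite (?L r)" for r
    by (rule finite_subset[OF _ finite_Sym[of n]]) auto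
  have "S (Suc r) = (\<Sum>u\<in>?L (Suc r). \<Sum>w | w \<in> ?L r \<and> (w, u) \<in> Cov n. ?M w * ?wt (w, u) * ?\<psi> u)"
    unfolding S_def
  proof (rule sum.cong[OF refl])
    fix u assume u: "u \<in> ?L (Suc r)"
    then have "id \<noteq> u" using inversions_0_iff[OF id_Sym] by force
    then have "?M u = (\<Sum>w | (w, u) \<in> Cov n. ?M w * ?wt (w, u))"
      using weighted_chain_sum_last[OF id_Sym, of n ?wt u] by simp
    also have "{w. (w, u) \<in> Cov n} = {w. w \<in> ?L r \<and> (w, u) \<in> Cov n}"
      using u Cov_inversions Cov_Sym by fastforce
    finally show "?M u * ?\<psi> u = (\<Sum>w | w \<in> ?L r \<and> (w, u) \<in> Cov n. ?M w * ?wt (w, u) * ?\<psi> u)"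
      by (simp only: sum_distrib_right)
  qed
  also have "\<dots> = (\<Sum>w\<in>?L r. \<Sum>u | u \<in> ?L (Suc r) \<and> (w, u) \<in> Cov n. ?M w * ?wt (w, u) * ?\<psi> u)"
    by (rule sum.swap_restrict[OF fin fin])
  also have "\<dots> = (\<Sum>w\<in>?L r. of_nat (Suc r) * (of_nat (n choose 2) - of_nat r) *
      (?M w * of_int (macdonald_sum n r w)))"
  proof (rule sum.cong[OF refl])
    fix w assume w: "w \<in> ?L r"
    have "{u. u \<in> ?L (Suc r) \<and> (w, u) \<in> Cov n} = {u. (w, u) \<in> Cov n}"
      using w Cov_inversions Cov_Sym by fastforce
    then have "(\<Sum>u | u \<in> ?L (Suc r) \<and> (w, u) \<in> Cov n. ?M w * ?wt (w, u) * ?\<psi> u) =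
        ?M w * (\<Sum>u | (w, u) \<in> Cov n. ?wt (w, u) * ?\<psi> u)"
      by (simp only: sum_distrib_left mult.assoc)
    also have "\<dots> = ?M w * (of_nat (Suc r) * (of_nat (n choose 2) - of_nat r) * of_int (macdonald_sum n r w))"
      using w by (subst sum_upper_covers[OF _ xy]) auto
    finally show "(\<Sum>u | u \<in> ?L (Suc r) \<and> (w, u) \<in> Cov n. ?M w * ?wt (w, u) * ?\<psi> u) =
        of_nat (Suc r) * (of_nat (n choose 2) - of_nat r) * (?M w * of_int (macdonald_sum n r w))"
      by (simp only: mult.left_commute)
  qed
  also have "\<dots> = of_nat (Suc r) * (of_nat (n choose 2) - of_nat r) * S r"
    unfolding S_def by (rule sum_distrib_left[symmetric])
  finally show ?thesis .
qed

text \<open>With N the binomial coefficient, the product of (r + 1)(N - r) over r < N is the square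
  of N!, and each extreme rank consists of a single permutation.\<close>

lemma adjacent_pairing:
  fixes x y :: "'a::{idom,ring_char_0}"
  assumes xy: "x + y = 2"
  shows "max_chain_sum n 0 x y 0 * of_int (macdonald_sum n (n choose 2) (longest n)) =
    of_nat (fact (n choose 2)) * of_nat (fact (n choose 2))"
proof -
  let ?N = "n choose 2"
  let ?M = "weighted_chain_sum n (stat_weight n 0 x y 0) id"
  define S where "S = (\<lambda>r. \<Sum>w | w \<in> Sym n \<and> inversions n w = r. ?M w * of_int (macdonald_sum n r w))"
  have step: "S (Suc r) = of_nat (Suc r) * (of_nat ?N - of_nat r) * S r" for r
    unfolding S_def by (rule layer_sum[OF xy])
  \<comment> \<open>That is, S r = r! N! / (N - r)!, cleared of its denominator.\<close>
  have "of_nat (fact (?N - r)) * S r = of_nat (fact r) * of_nat (fact ?N)" if "r \<le> ?N" for r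
    using that
  proof (induction r)
    case 0
    have "{w. w \<in> Sym n \<and> inversions n w = 0} = {id}"
      using inversions_0_iff id_Sym by auto
    moreover have "?M id = 1"
      using weighted_chain_sum_cover_op[OF id_Sym, of n "stat_weight n 0 x y 0"] by (simp only: cover_op_id) simp
    ultimately have "S 0 = 1" unfolding S_def by simp
    then show ?case by simp
  next
    case (Suc r)
    have "?N - r = Suc (?N - Suc r)" using Suc.prems by simp
    then have f: "fact (?N - r) = (?N - r) * fact (?N - Suc r)"
      by (metis fact_Suc of_nat_id)
    have "of_nat (fact (?N - Suc r)) * S (Suc r) =
        of_nat (Suc r) * (of_nat ((?N - r) * fact (?N - Suc r)) * S r)"
      unfolding step using Suc.prems by (simp add: of_nat_diff)
    also have "\<dots> = of_nat (Suc r) * (of_nat (fact r) * of_nat (fact ?N))"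
      unfolding f[symmetric] using Suc by simp
    finally show ?case by (simp only: fact_Suc of_nat_mult of_nat_id mult.assoc)
  qed
  from this[of ?N] have "S ?N = of_nat (fact ?N) * of_nat (fact ?N)" by simp
  moreover have "{w. w \<in> Sym n \<and> inversions n w = ?N} = {longest n}"
    using inversions_max longest_Sym inversions_longest by auto
  ultimately show ?thesis unfolding S_def max_chain_sum_def by simp
qed

section \<open>The six placements of the two nonzero parameters\<close>

lemma max_chain_sum_bd:
  fixes x y :: "'a::{idom,ring_char_0}"
  assumes "x + y = 2"
  shows "max_chain_sum n 0 x 0 y = of_nat (fact (n choose 2))"
proof -
  have "x = 1 + (x - 1)" "y = 1 - (x - 1)" using assms by (simp_all add: algebra_simps)
  then show ?thesis unfolding max_chain_sum_def using diagonal_weights[of n "x - 1"] by metis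
qed

lemma max_chain_sum_bc:
  fixes x y :: "'a::{idom,ring_char_0}"
  assumes "x + y = 2"
  shows "max_chain_sum n 0 x y 0 = of_nat (fact (n choose 2))"
proof -
  let ?F = "of_nat (fact (n choose 2)) :: 'a"
  let ?p = "of_int (macdonald_sum n (n choose 2) (longest n)) :: 'a"
  have "?F \<noteq> 0" by simp
  \<comment> \<open>The parameters 2 and 0 may be read as belonging to b and c or to b and d, so the
    chain sum is already known here.\<close>
  have "?F * ?p = ?F * ?F"
    using adjacent_pairing[of "2 :: 'a" 0 n] max_chain_sum_bd[of "2 :: 'a" 0 n] by simp
  then have p: "?p = ?F" using mult_left_cancel[OF \<open>?F \<noteq> 0\<close>] by blast
  have "max_chain_sum n 0 x y 0 * ?F = ?F * ?F"
    using adjacent_pairing[OF assms, of n] unfolding p .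
  then show ?thesis using mult_right_cancel[OF \<open>?F \<noteq> 0\<close>] by blast
qed

text \<open>Under the two symmetries the placements form two orbits, {bd, ac} and {bc, cd, ab, ad},
  and each contains one that is already evaluated.\<close>

lemma max_chain_sum_all:
  fixes x y :: "'a::{idom,ring_char_0}"
  assumes "x + y = 2"
  shows "max_chain_sum n 0 x 0 y = of_nat (fact (n choose 2))"
    and "max_chain_sum n x 0 y 0 = of_nat (fact (n choose 2))"
    and "max_chain_sum n 0 x y 0 = of_nat (fact (n choose 2))"
    and "max_chain_sum n 0 0 x y = of_nat (fact (n choose 2))"
    and "max_chain_sum n x y 0 0 = of_nat (fact (n choose 2))"
    and "max_chain_sum n x 0 0 y = of_nat (fact (n choose 2))"
proof -
  have yx: "y + x = 2" using assms by (simp add: add.commute)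
  show "max_chain_sum n 0 x 0 y = of_nat (fact (n choose 2))"
    by (rule max_chain_sum_bd[OF assms])
  show "max_chain_sum n x 0 y 0 = of_nat (fact (n choose 2))"
    by (subst max_chain_sum_inverse) (rule max_chain_sum_bd[OF yx])
  show "max_chain_sum n 0 x y 0 = of_nat (fact (n choose 2))"
    by (rule max_chain_sum_bc[OF assms])
  have cd: "max_chain_sum n 0 0 x y = of_nat (fact (n choose 2))" if "x + y = 2" for x y :: 'a
    by (subst max_chain_sum_reverse) (rule max_chain_sum_bc, use that in \<open>simp add: add.commute\<close>)
  show "max_chain_sum n 0 0 x y = of_nat (fact (n choose 2))"
    by (rule cd[OF assms])
  show ab: "max_chain_sum n x y 0 0 = of_nat (fact (n choose 2))"
    by (subst max_chain_sum_inverse) (rule cd[OF yx])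
  show "max_chain_sum n x 0 0 y = of_nat (fact (n choose 2))"
    by (subst max_chain_sum_reverse) (rule ab)
qed

theorem theorem1p2:
  fixes n :: nat
    and \<sigma> :: "zvar \<Rightarrow> int poly"
    and wt :: "(nat \<Rightarrow> nat) \<times> (nat \<Rightarrow> nat) \<Rightarrow> int poly"
  assumes "n \<ge> 1"
    and "{#\<sigma> ZA, \<sigma> ZB, \<sigma> ZC, \<sigma> ZD#} = {#0, 0, [:0, 1:], 2 - [:0, 1:]#}"
    and "\<And>c. c \<in> Cov n \<Longrightarrow> wt c = specialize \<sigma> (generic_weight n c)"
  shows "weighted_chain_sum n wt id (longest n) = of_nat (fact (n choose 2)) \<and>
         degree (weighted_chain_sum n wt id (longest n)) = 0"
proof -
  define z :: "int poly" where "z = [:0, 1:]"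
  have sw: "stat_weight n (\<sigma> ZA) (\<sigma> ZB) (\<sigma> ZC) (\<sigma> ZD) (v, w) = wt (v, w)" if cov: "(v, w) \<in> Cov n" for v w
  proof -
    obtain i j where v: "v \<in> Sym n" and ij: "1 \<le> i" "i < j" "j \<le> n" and w: "w = v \<circ> transpose i j"
      by (rule Cov_cases[OF cov])
    show ?thesis
      unfolding assms(3)[OF cov] unfolding w stat_weight_cover[OF v ij] specialize_generic_weight[OF v ij] ..
  qed
  have "weighted_chain_sum n wt id (longest n) = max_chain_sum n (\<sigma> ZA) (\<sigma> ZB) (\<sigma> ZC) (\<sigma> ZD)"
    unfolding max_chain_sum_def
    using weighted_chain_sum_map[where \<phi> = "\<lambda>v. v" and wt = wt, OF _ sw _ id_Sym longest_Sym] by simp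
  also have "\<dots> = of_nat (fact (n choose 2))"
  proof -
    \<comment> \<open>Both orders are required: either of the two nonzero values may come first
      among the four parameters.\<close>
    have "z + (2 - z) = 2" "(2 - z) + z = 2" by simp_all
    note all = max_chain_sum_all[OF this(1)] max_chain_sum_all[OF this(2)]
    have "mset [\<sigma> ZA, \<sigma> ZB, \<sigma> ZC, \<sigma> ZD] = mset [0, 0, z, 2 - z]"
      using assms(2) by (simp add: z_def)
    then show ?thesis
      using all by (auto simp: add_eq_conv_ex)
  qed
  finally show ?thesis
    by (simp add: of_nat_poly)
qed

end
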